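(* For each $n=1,2,\ldots$ and $d=0,1,\ldots$, the map $\lambda_d\colon \mathscr P^{(n)}\to\mathbb R_{\ge 0}$ (the $d$-dimensional rational measure) has the following properties, for all $P,Q\in\mathscr P^{(n)}$: (i) (Invariance) If $P=\gamma(Q)$ for some $\gamma\in\mathcal G_n$, then $\lambda_d(P)=\lambda_d(Q)$. (ii) (Valuation) $\lambda_d(\emptyset)=0$, $\lambda_d(P)=\lambda_d(P^{(d)})$, and the restriction of $\lambda_d$ to the set of all rational polyhedra in $\mathbb R^n$ of dimension at most $d$ is a valuation: if $P,Q$ have dimension at most $d$ then $$\lambda_d(P)+\lambda_d(Q)=\lambda_d(P\cup Q)+\lambda_d(P\cap Q).$$ (iii) (Conservativity) Let $(P,0)=\{(x,0)\in\mathbb R^{n+1}\mid x\in P\}$. Then $\lambda_d(P)=\lambda_d(P,0)$, where on the right $\lambda_d$ is the $d$-dimensional rational measure on $\mathscr P^{(n+1)}$. (iv) (Pyramid) For $k=1,\ldots,n$, if $\operatorname{conv}(v_0,\ldots,v_k)$ is a regular $k$-simplex in $\mathbb R^n$ with $v_0\in\mathbb Z^n$, then $$\lambda_k(\operatorname{conv}(v_0,\ldots,v_k))=\frac{\lambda_{k-1}(\operatorname{conv}(v_1,\ldots,v_k))}{k}.$$ (v) (Normalization) Let $j=1,\ldots,n$. Suppose the set $B=\{w_1,\ldots,w_j\}\subseteq\mathbb Z^n$ (of $j$ elements) is part of a basis of the free abelian group $\mathbb Z^n$. Let the closed parallelepiped $P_B\subseteq\mathbb R^n$ be $P_B=\{x\in\mathbb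 R^n\mid x=\sum_{i=1}^j\gamma_iw_i,\ 0\le\gamma_i\le1\}$. Then $\lambda_j(P_B)=1$. (vi) (Proportionality) Let $A$ be an $m$-dimensional rational affine subspace of $\mathbb R^n$ for some $m=0,\ldots,n$. Then there is a constant $\kappa_A>0$, depending only on $A$, such that $\lambda_m(Q)=\kappa_A\cdot\mathcal H^m(Q)$ for every rational $m$-simplex $Q\subseteq A$, where $\mathcal H^m$ denotes $m$-dimensional Hausdorff measure.
   Context: A rational polyhedron in $\mathbb R^n$ is a union of finitely many (closed) simplexes in $\mathbb R^n$ whose vertices are in $\mathbb Q^n$ (the empty set is included; it need not be convex or connected). $\mathscr P^{(n)}$ is the set of all rational polyhedra in $\mathbb R^n$. $\mathcal G_n=GL(n,\mathbb Z)\ltimes\mathbb Z^n$ is the group of maps $x\mapsto Ax+t$ of $\mathbb R^n$, with $t\in\mathbb Z^n$ and $A$ an $n\times n$ integer matrix of determinant $\pm1$. For a rational point $x=(x_1,\ldots,x_n)\in\mathbb Q^n$, $\operatorname{den}(x)$ is the least common denominator (a positive integer) of its coordinates, and $\tilde x=\operatorname{den}(x)(x_1,\ldots,x_n,1)\in\mathbb Z^{n+1}$ is its homogeneous correspondent. A simplex is rational if all its vertices are rational. A rational $m$-simplex $\operatorname{conv}(v_0,\ldots,v_m)\subseteq\mathbb R^n$ is regular if $\{\tilde v_0,\ldots,\tilde v_m\}$ is part of a basis of the free abelian group $\mathbb Z^{n+1}$. A simplicial complex $\Delta$ is a finite set of simplexes in $\mathbb R^n$, closed under taking faces, any two of which intersect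 in a common face; it is regular if all its simplexes are rational and regular; its support is the union of its simplexes; a triangulation of $P$ is a simplicial complex with support $P$. For a triangulation $\mathcal T$ and $i=0,1,\ldots$, $\mathcal T^{\max}(i)$ denotes the set of $i$-dimensional simplexes of $\mathcal T$ that are maximal (with respect to inclusion) in $\mathcal T$. The $i$-dimensional part of a polyhedron $Q$ is $Q^{(i)}=\bigcup\{T\mid T\in\mathcal T^{\max}(i)\}$, for any triangulation $\mathcal T$ of $Q$ (this does not depend on $\mathcal T$). For a regular simplex $S=\operatorname{conv}(v_0,\ldots,v_m)$ put $\operatorname{den}(S)=\prod_{j=0}^m\operatorname{den}(v_j)$. For $P\in\mathscr P^{(n)}$ the $d$-dimensional rational measure is $$\lambda_d(P)=\sum_{T\in\Delta^{\max}(d)}\frac{1}{d!\,\operatorname{den}(T)},$$ where $\Delta$ is an arbitrary regular triangulation of $P$ (one exists and the value does not depend on the choice of $\Delta$), the sum being $0$ if $\Delta^{\max}(d)=\emptyset$. The same symbol $\lambda_d$ is used for every ambient space $\mathbb R^n$. A rational affine hyperplane in $\mathbb R^n$ is a set $\{x\in\mathbb R^n\mid a\circ x+t=0\}$ with $\circ$ the scalar product, $0\neq a\in\mathbb Q^n$ and $t\in\mathbb Q$; a rational affine subspace of $\mathbb R^n$ is the intersection of a finite (possibly empty) set of rational hyperplanes, the empty intersection being $\mathbb R^n$. Hausdorff measure $\mathcal H^m$ is normalized to agree with Lebesgue measure on $\mathbb R^m$; $\mathcal H^0$ is counting measure. *)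

theory Defs
  imports "HOL-Analysis.Analysis"
begin

section \<open>Integer and rational points\<close>

definition of_int_vec :: "int ^ 'n \<Rightarrow> real ^ 'n" where
  "of_int_vec z = (\<chi> i. real_of_int (z $ i))"

definition rational_point :: "real ^ 'n \<Rightarrow> bool" where
  "rational_point x \<longleftrightarrow> (\<forall>i. x $ i \<in> \<rat>)"

definition integer_point :: "real ^ 'n \<Rightarrow> bool" where
  "integer_point x \<longleftrightarrow> (\<forall>i. x $ i \<in> \<int>)"

definition den :: "real ^ 'n \<Rightarrow> nat" where
  "den x = (LEAST k. 0 < k \<and> (\<forall>i. real k * x $ i \<in> \<int>))"

text \<open>
  The index type \<^typ>\<open>'n option\<close> has one element more than \<^typ>\<open>'n\<close>, so that
  \<^typ>\<open>real ^ 'n option\<close> plays the role of the $(n+1)$-dimensional space when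
  \<^typ>\<open>real ^ 'n\<close> is the $n$-dimensional one; \<^term>\<open>None\<close> indexes the last coordinate.
\<close>

definition append_coord :: "'a ^ 'n \<Rightarrow> 'a \<Rightarrow> 'a ^ 'n option" where
  "append_coord x c = (\<chi> i. case i of None \<Rightarrow> c | Some j \<Rightarrow> x $ j)"

text \<open>
  On rational points the floor below is taken of an integer and serves as a type conversion only;
  see the lemma \<open>of_int_vec_homog\<close>.
\<close>

definition homog :: "real ^ 'n \<Rightarrow> int ^ 'n option" where
  "homog x = (\<chi> i. \<lfloor>real (den x) * append_coord x 1 $ i\<rfloor>)"

lemma rational_point_common_denominator:
  fixes x :: "real ^ 'n"
  assumes "rational_point x"
  shows "\<exists>k::nat. 0 < k \<and> (\<forall>i. real k * x $ i \<in> \<int>)"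
proof -
  have "\<exists>k::nat. 0 < k \<and> real k * x $ i \<in> \<int>" for i
  proof -
    have "x $ i \<in> \<rat>" using assms by (simp add: rational_point_def)
    then obtain a b :: int where ab: "b > 0" "x $ i = of_int a / of_int b"
      by (meson Rats_cases')
    then have "real (nat b) * x $ i = of_int a" by simp
    then show ?thesis using ab(1) by (intro exI[of _ "nat b"]) auto
  qed
  then obtain k :: "'n \<Rightarrow> nat" where k: "\<And>i. 0 < k i" "\<And>i. real (k i) * x $ i \<in> \<int>"
    by metis
  have "real (\<Prod>j\<in>UNIV. k j) * x $ i \<in> \<int>" for i
  proof -
    have "(\<Prod>j\<in>UNIV. k j) = k i * (\<Prod>j\<in>UNIV - {i}. k j)"
      by (rule prod.remove) auto
    then have "real (\<Prod>j\<in>UNIV. k j) * x $ i = real (\<Prod>j\<in>UNIV - {i}. k j) * (real (k i) * x $ i)"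
      by (simp add: mult_ac)
    also have "\<dots> \<in> \<int>" by (rule Ints_mult[OF Ints_of_nat k(2)])
    finally show ?thesis .
  qed
  then show ?thesis using k(1) by (intro exI[of _ "\<Prod>j\<in>UNIV. k j"]) (auto intro: prod_pos)
qed

lemma of_int_vec_homog:
  assumes "rational_point x"
  shows "of_int_vec (homog x) = real (den x) *\<^sub>R append_coord x 1"
proof -
  have "0 < den x \<and> (\<forall>i. real (den x) * x $ i \<in> \<int>)"
    unfolding den_def by (rule LeastI_ex) (rule rational_point_common_denominator[OF assms])
  then show ?thesis
    by (auto simp: vec_eq_iff of_int_vec_def homog_def append_coord_def of_int_floor
        split: option.split)
qed

text \<open>
  Bases of the free abelian group are linearly independent spanning sets of the
  module of integer vectors over the ring of integers.
\<close>

lemma module_int_vec: "module ((*s) :: int \<Rightarrow> int ^ 'n \<Rightarrow> int ^ 'n)"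
  by unfold_locales (auto simp: vec_eq_iff algebra_simps)

definition is_int_basis :: "(int ^ 'n) set \<Rightarrow> bool" where
  "is_int_basis B \<longleftrightarrow> \<not> module.dependent (*s) B \<and> module.span (*s) B = UNIV"

definition part_of_int_basis :: "(int ^ 'n) set \<Rightarrow> bool" where
  "part_of_int_basis S \<longleftrightarrow> (\<exists>B. S \<subseteq> B \<and> is_int_basis B)"

definition integral_affine_group :: "(real ^ 'n \<Rightarrow> real ^ 'n) set" where
  "integral_affine_group =
     {\<gamma>. \<exists>(A :: int ^ 'n ^ 'n) (t :: int ^ 'n). (det A = 1 \<or> det A = - 1) \<and>
          \<gamma> = (\<lambda>x. map_matrix real_of_int A *v x + of_int_vec t)}"


section \<open>Rational polyhedra and their triangulations\<close>

definition vertices :: "(real ^ 'n) set \<Rightarrow> (real ^ 'n) set" where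
  "vertices S = {v. v extreme_point_of S}"

text \<open>
  As in the library, the empty set counts as a simplex (of dimension $-1$) and as a face of every
  simplex. It is never an \<open>i\<close>-dimensional maximal simplex for a natural number \<open>i\<close>.
\<close>

definition rational_simplex :: "(real ^ 'n) set \<Rightarrow> bool" where
  "rational_simplex S \<longleftrightarrow> (\<exists>k. k simplex S) \<and> (\<forall>v\<in>vertices S. rational_point v)"

definition regular_simplex :: "(real ^ 'n) set \<Rightarrow> bool" where
  "regular_simplex S \<longleftrightarrow> rational_simplex S \<and> part_of_int_basis (homog ` vertices S)"

definition rational_polyhedron :: "(real ^ 'n) set \<Rightarrow> bool" where
  "rational_polyhedron P \<longleftrightarrow> (\<exists>F. finite F \<and> (\<forall>S\<in>F. rational_simplex S) \<and> P = \<Union>F)"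

text \<open>
  The library constant \<^const>\<open>triangulation\<close> does not require closure under faces, hence
  the use of \<^const>\<open>simplicial_complex\<close>.
\<close>

definition triangulates :: "(real ^ 'n) set set \<Rightarrow> (real ^ 'n) set \<Rightarrow> bool" where
  "triangulates T P \<longleftrightarrow> simplicial_complex T \<and> \<Union>T = P"

definition regular_triangulation :: "(real ^ 'n) set set \<Rightarrow> (real ^ 'n) set \<Rightarrow> bool" where
  "regular_triangulation T P \<longleftrightarrow> triangulates T P \<and> (\<forall>S\<in>T. regular_simplex S)"

definition maximal_simplexes :: "(real ^ 'n) set set \<Rightarrow> nat \<Rightarrow> (real ^ 'n) set set" where
  "maximal_simplexes T i = {S \<in> T. int i simplex S \<and> (\<forall>S'\<in>T. S \<subseteq> S' \<longrightarrow> S' = S)}"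

definition dim_part :: "nat \<Rightarrow> (real ^ 'n) set \<Rightarrow> (real ^ 'n) set" where
  "dim_part i Q = \<Union>(maximal_simplexes (SOME T. triangulates T Q) i)"

text \<open>
  The dimension of a polyhedron is the largest dimension of a simplex in it. This is not the
  dimension \<^term>\<open>aff_dim P\<close> of the affine hull: a pair of points has dimension $0$.
  The empty polyhedron has dimension $-1$.
\<close>

definition polyhedron_dim :: "(real ^ 'n) set \<Rightarrow> int" where
  "polyhedron_dim P = Max {k. \<exists>S. k simplex S \<and> S \<subseteq> P}"


section \<open>The rational measure\<close>

definition simplex_den :: "(real ^ 'n) set \<Rightarrow> nat" where
  "simplex_den S = (\<Prod>v\<in>vertices S. den v)"

definition rational_measure :: "nat \<Rightarrow> (real ^ 'n) set \<Rightarrow> real" where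
  "rational_measure d P =
     (\<Sum>S\<in>maximal_simplexes (SOME T. regular_triangulation T P) d.
        1 / (fact d * real (simplex_den S)))"


section \<open>Rational affine subspaces\<close>

definition rational_hyperplane :: "(real ^ 'n) set \<Rightarrow> bool" where
  "rational_hyperplane H \<longleftrightarrow>
     (\<exists>a t. a \<noteq> 0 \<and> rational_point a \<and> t \<in> \<rat> \<and> H = {x. a \<bullet> x + t = 0})"

definition rational_affine_subspace :: "(real ^ 'n) set \<Rightarrow> bool" where
  "rational_affine_subspace A \<longleftrightarrow>
     (\<exists>\<H>. finite \<H> \<and> (\<forall>H\<in>\<H>. rational_hyperplane H) \<and> A = \<Inter>\<H>)"


section \<open>Hausdorff measure\<close>

text \<open>
  A covering set \<open>C\<close> contributes the volume of an \<open>m\<close>-dimensional ball of diameter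
  \<^term>\<open>diameter C\<close>; by the isodiametric inequality, this normalization makes the
  \<open>m\<close>-dimensional measure agree with Lebesgue measure on \<open>m\<close>-dimensional Euclidean space.
  For \<open>m = 0\<close> every nonempty set contributes $1$ (as \<^term>\<open>(0::real) ^ 0 = 1\<close>), which yields
  counting measure; the empty set always contributes $0$.
\<close>

definition hausdorff_gauge :: "nat \<Rightarrow> 'a::metric_space set \<Rightarrow> ennreal" where
  "hausdorff_gauge m C =
     (if C = {} then 0 else ennreal (unit_ball_vol (real m) * (diameter C / 2) ^ m))"

definition hausdorff_premeasure :: "nat \<Rightarrow> real \<Rightarrow> 'a::metric_space set \<Rightarrow> ennreal" where
  "hausdorff_premeasure m \<delta> E =
     (INF C \<in> {C :: nat \<Rightarrow> 'a set.
                E \<subseteq> (\<Union>i. C i) \<and> (\<forall>i. bounded (C i) \<and> diameter (C i) \<le> \<delta>)}.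
        \<Sum>i. hausdorff_gauge m (C i))"

definition hausdorff_measure :: "nat \<Rightarrow> 'a::metric_space set \<Rightarrow> ennreal" where
  "hausdorff_measure m E = (SUP \<delta>\<in>{0<..}. hausdorff_premeasure m \<delta> E)"

end

theory Submission
  imports Defs "HOL-Library.Multiset"
begin

text \<open>
  Attach to a rational polyhedron \<open>P\<close> the number of integer points \<open>(z, q)\<close> with \<open>0 < q \<le> t\<close> and
  \<open>z / q \<in> P\<close>. The integer points of the cone over a regular \<open>d\<close>-simplex \<open>S\<close> are the nonnegative integer
  combinations of the homogeneous correspondents of its vertices, so for \<open>S\<close> this number is asymptotic to
  \<open>t ^ (d + 1) / ((d + 1)! den S)\<close>. Summing over the relatively open simplexes of a regular triangulation,
  \<open>rational_measure d P\<close> is \<open>d + 1\<close> times the limit of the count for the \<open>d\<close>-dimensional part of \<open>P\<close>,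
  divided by \<open>t ^ (d + 1)\<close>. This makes it independent of the triangulation, invariant, conservative and a
  valuation.

  Regular triangulations adapted to finitely many rational hyperplanes come from a single unimodular cone by
  replacing edges \<open>a, b\<close> that cross a hyperplane with their mediant \<open>a + b\<close>; unimodularity is preserved at
  each step.

  For proportionality, the points of denominator \<open>q\<close> in a rational affine subspace form a translate of a
  scaled lattice (or the empty set). Covering a simplex with the cells of this lattice, and packing slightly shrunken
  cells into it, compares the count with the Hausdorff measure; of the latter only finite subadditivity,
  additivity on separated sets, scaling, and its positivity and finiteness on a parallelepiped matter.
\<close>

section \<open>Unimodular sets of integer vectors\<close>


text \<open>Both \<open>rational_measure\<close> and \<open>dim_part\<close> choose a triangulation
  by \<open>SOME\<close>. For \<open>dim_part\<close> independence of the choice is a topological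
  fact. For the measure it holds because the limit formula mentions no triangulation, so two regular
  triangulations never have to be refined to a common one.

  The count runs over all heights up to \<open>t\<close> because at a single height there may be no
  limit: an affine subspace may contain points with denominator dividing \<open>q\<close> only when
  \<open>q\<close> is a multiple of some \<open>c > 1\<close>. Summing over the heights restores
  convergence and causes the exponent and the factor \<open>d + 1\<close>.

  Polyhedra need not be convex, so they are described by the signs of finitely many integer affine
  forms and not by half-spaces. This description survives unions, and a relatively open simplex on
  which all signs are constant lies either inside the polyhedron or outside it.

  In the proportionality constant \<open>1 / (e * c)\<close>, \<open>e\<close> is the Hausdorff
  measure of a cell of the lattice of directions and \<open>c\<close> is the least denominator of a
  point of the subspace.\<close>

definition dual_basis :: "(real ^ 'm) set \<Rightarrow> (real ^ 'm \<Rightarrow> real ^ 'm) \<Rightarrow> bool" where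
  "dual_basis B \<phi> \<longleftrightarrow> finite B \<and> (\<forall>w\<in>B. integer_point w \<and> integer_point (\<phi> w)) \<and>
     (\<forall>v\<in>B. \<forall>w\<in>B. \<phi> w \<bullet> v = (if v = w then 1 else 0)) \<and>
     (\<forall>x. x = (\<Sum>w\<in>B. (\<phi> w \<bullet> x) *\<^sub>R w))"

text \<open>Working with real vectors and dual integer forms, rather than in the module of integer vectors, makes
  coordinates available as inner products.\<close>

definition unimodular :: "(real ^ 'm) set \<Rightarrow> bool" where
  "unimodular S \<longleftrightarrow> (\<exists>B \<phi>. S \<subseteq> B \<and> dual_basis B \<phi>)"

section \<open>Integer points and integer bases as real vectors\<close>

lemma integer_point_simps [simp]:
  "integer_point 0" 
  "integer_point x \<Longrightarrow> integer_point y \<Longrightarrow> integer_point (x + y)"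
  "integer_point x \<Longrightarrow> integer_point y \<Longrightarrow> integer_point (x - y)"
  "integer_point x \<Longrightarrow> integer_point (- x)"
  "k \<in> \<int> \<Longrightarrow> integer_point x \<Longrightarrow> integer_point (k *\<^sub>R x)"
  "integer_point (axis i 1)"
  by (auto simp: integer_point_def axis_def)

lemma integer_point_sum: "(\<And>i. i \<in> I \<Longrightarrow> integer_point (f i)) \<Longrightarrow> integer_point (sum f I)"
  by (auto simp: integer_point_def intro!: Ints_sum)

lemma integer_point_inner [simp]: "integer_point x \<Longrightarrow> integer_point y \<Longrightarrow> x \<bullet> y \<in> \<int>"
  by (auto simp: integer_point_def inner_vec_def intro!: Ints_sum Ints_mult)

lemma of_int_vec_simps:
  "of_int_vec (x + y) = of_int_vec x + of_int_vec y"
  "of_int_vec 0 = 0"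
  "of_int_vec (k *s x) = of_int k *\<^sub>R of_int_vec x"
  "of_int_vec (axis i 1) = axis i 1"
  "integer_point (of_int_vec x)"
  by (auto simp: of_int_vec_def vec_eq_iff axis_def integer_point_def)

lemma of_int_vec_sum: "of_int_vec (sum f A) = (\<Sum>x\<in>A. of_int_vec (f x))"
  by (induction A rule: infinite_finite_induct) (auto simp: of_int_vec_simps)

lemma of_int_vec_inject [simp]: "of_int_vec x = of_int_vec y \<longleftrightarrow> x = y"
  by (auto simp: of_int_vec_def vec_eq_iff)

lemma inj_of_int_vec: "inj of_int_vec"
  by (auto simp: inj_on_def)

lemma integer_pointE:
  assumes "integer_point x" obtains z where "x = of_int_vec z"
proof
  show "x = of_int_vec (\<chi> i. \<lfloor>x $ i\<rfloor>)"
    using assms by (auto simp: integer_point_def of_int_vec_def vec_eq_iff of_int_floor)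
qed

lemma dual_basisD:
  assumes "dual_basis B \<phi>"
  shows "finite B" "w \<in> B \<Longrightarrow> integer_point w" "w \<in> B \<Longrightarrow> integer_point (\<phi> w)"
    "w \<in> B \<Longrightarrow> v \<in> B \<Longrightarrow> \<phi> w \<bullet> v = (if v = w then 1 else 0)"
    "(\<Sum>w\<in>B. (\<phi> w \<bullet> x) *\<^sub>R w) = x"
  using assms unfolding dual_basis_def by auto

lemma dual_coeff:
  assumes "dual_basis B \<phi>" "S \<subseteq> B" "w \<in> B"
  shows "\<phi> w \<bullet> (\<Sum>v\<in>S. c v *\<^sub>R v) = (if w \<in> S then c w else 0)"
proof -
  have fin: "finite S" using assms dual_basisD(1) finite_subset by blast
  have "\<phi> w \<bullet> (\<Sum>v\<in>S. c v *\<^sub>R v) = (\<Sum>v\<in>S. if v = w then c v else 0)"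
    unfolding inner_sum_right using assms dual_basisD(4)[OF assms(1)]
    by (intro sum.cong) auto
  then show ?thesis using fin by simp
qed

text \<open>The coefficient at a basis element \<open>w\<close> is linear over the integers, so it
  is the inner product with the integer vector \<open>m w\<close> of its values at the unit vectors.
  The expansion, known at first for integer vectors only, extends to real vectors by
  linearity.\<close>

lemma is_int_basis_imp_dual_basis:
  fixes B :: "(int ^ 'm) set"
  assumes "is_int_basis B"
  shows "\<exists>\<phi>. dual_basis (of_int_vec ` B) \<phi>"
proof -
  interpret M: module "(*s) :: int \<Rightarrow> int ^ 'm \<Rightarrow> int ^ 'm" by (rule module_int_vec)
  have ind: "M.independent B" and sp: "\<And>z. z \<in> M.span B"
    using assms by (auto simp: is_int_basis_def)
  let ?r = "M.representation B"
  define m where "m w = (\<chi> j. ?r (axis j 1) w)" for w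
  have r: "?r z w = (\<Sum>j\<in>UNIV. z $ j * m w $ j)" for z w
  proof -
    have "z = (\<Sum>j\<in>UNIV. z $ j *s axis j 1)" by (rule basis_expansion[symmetric])
    then have "?r z w = ?r (\<Sum>j\<in>UNIV. z $ j *s axis j 1) w" by simp
    also have "\<dots> = (\<Sum>j\<in>UNIV. z $ j * m w $ j)"
      by (simp add: M.representation_sum[OF ind sp] M.representation_scale[OF ind sp] m_def)
    finally show ?thesis .
  qed
  \<comment> \<open>Finiteness is not part of the definition of a basis. An element has coefficient
    1 at itself, so it occurs in the expansion of some unit vector, and these expansions are finite
    in number and length.\<close>
  have "B \<subseteq> (\<Union>j\<in>UNIV. {w. ?r (axis j 1) w \<noteq> 0})"
  proof
    fix w assume w: "w \<in> B"
    have "?r w w = 1" by (simp add: M.representation_basis[OF ind w])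
    then obtain j where "m w $ j \<noteq> 0" unfolding r by (metis (no_types, lifting) mult_zero_right sum.neutral zero_neq_one)
    then show "w \<in> (\<Union>j\<in>UNIV. {w. ?r (axis j 1) w \<noteq> 0})" by (auto simp: m_def)
  qed
  then have fin: "finite B"
    by (rule finite_subset) (auto intro: M.finite_representation)
  define \<phi> where "\<phi> x = of_int_vec (m (inv of_int_vec x))" for x :: "real ^ 'm"
  have \<phi>: "\<phi> (of_int_vec w) = of_int_vec (m w)" for w
    by (simp add: \<phi>_def inv_f_f[OF inj_of_int_vec])
  have inner: "\<phi> (of_int_vec w) \<bullet> of_int_vec z = of_int (?r z w)" for w z
    unfolding \<phi> r by (simp add: inner_vec_def of_int_vec_def mult.commute)
  have ex: "of_int_vec z = (\<Sum>w\<in>B. (\<phi> (of_int_vec w) \<bullet> of_int_vec z) *\<^sub>R of_int_vec w)" for z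
  proof -
    have "z = (\<Sum>w\<in>B. ?r z w *s w)" by (rule M.sum_representation_eq[symmetric, OF ind sp fin order_refl])
    then have "of_int_vec z = of_int_vec (\<Sum>w\<in>B. ?r z w *s w)" by simp
    also have "\<dots> = (\<Sum>w\<in>B. (\<phi> (of_int_vec w) \<bullet> of_int_vec z) *\<^sub>R of_int_vec w)"
      by (simp add: of_int_vec_sum of_int_vec_simps inner)
    finally show ?thesis .
  qed
  have "x = (\<Sum>w\<in>B. (\<phi> (of_int_vec w) \<bullet> x) *\<^sub>R of_int_vec w)" for x
  proof -
    have "x = (\<Sum>j\<in>UNIV. x $ j *\<^sub>R axis j 1)" by (metis (no_types) basis_expansion scalar_mult_eq_scaleR sum.cong)
    also have "\<dots> = (\<Sum>j\<in>UNIV. x $ j *\<^sub>R (\<Sum>w\<in>B. (\<phi> (of_int_vec w) \<bullet> axis j 1) *\<^sub>R of_int_vec w))"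
      using ex[of "axis _ 1", symmetric] by (simp only: of_int_vec_simps)
    also have "\<dots> = (\<Sum>w\<in>B. (\<Sum>j\<in>UNIV. x $ j * (\<phi> (of_int_vec w) \<bullet> axis j 1)) *\<^sub>R of_int_vec w)"
      by (simp add: scaleR_sum_right scaleR_sum_left sum.swap[of _ B])
    also have "\<dots> = (\<Sum>w\<in>B. (\<phi> (of_int_vec w) \<bullet> x) *\<^sub>R of_int_vec w)"
      by (simp only: inner_axis) (simp add: inner_vec_def mult.commute)
    finally show ?thesis .
  qed
  then have "dual_basis (of_int_vec ` B) \<phi>"
    unfolding dual_basis_def
    by (simp add: sum.reindex[OF inj_on_subset[OF inj_of_int_vec]] of_int_vec_simps fin inner M.representation_basis[OF ind])
      (simp add: \<phi> of_int_vec_simps)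
  then show ?thesis by blast
qed

text \<open>The dual forms read off coefficients, which gives independence. Spanning holds over the
  integers because the inner product of two integer vectors is an integer.\<close>

lemma dual_basis_imp_is_int_basis:
  fixes B :: "(int ^ 'm) set"
  assumes "dual_basis (of_int_vec ` B) \<phi>"
  shows "is_int_basis B"
proof -
  interpret M: module "(*s) :: int \<Rightarrow> int ^ 'm \<Rightarrow> int ^ 'm" by (rule module_int_vec)
  have fin: "finite B" using dual_basisD(1)[OF assms] finite_imageD inj_on_subset[OF inj_of_int_vec] by blast
  have "M.independent B"
  proof
    assume "M.dependent B"
    then obtain u v where u: "(\<Sum>w\<in>B. u w *s w) = 0" and v: "v \<in> B" "u v \<noteq> 0"
      using M.dependent_finite[OF fin] by auto
    define c where "c x = real_of_int (u (inv of_int_vec x))" for x :: "real ^ 'm"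
    have "0 = of_int_vec (\<Sum>w\<in>B. u w *s w)" by (simp add: u of_int_vec_simps)
    also have "\<dots> = (\<Sum>w\<in>B. of_int (u w) *\<^sub>R of_int_vec w)" by (simp add: of_int_vec_simps of_int_vec_sum)
    also have "\<dots> = (\<Sum>x\<in>of_int_vec ` B. c x *\<^sub>R x)"
      by (simp add: sum.reindex[OF inj_on_subset[OF inj_of_int_vec]] c_def inv_f_f[OF inj_of_int_vec])
    finally have "\<phi> (of_int_vec v) \<bullet> 0 = c (of_int_vec v)" 
      using dual_coeff[OF assms order_refl, of "of_int_vec v" c] v(1) by (metis imageI)
    then have "0 = c (of_int_vec v)" by simp
    then show False using v by (simp add: c_def inv_f_f[OF inj_of_int_vec])
  qed
  moreover have "z \<in> M.span B" for z
  proof -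
    define n where "n w = \<lfloor>\<phi> (of_int_vec w) \<bullet> of_int_vec z\<rfloor>" for w
    have n: "of_int (n w) = \<phi> (of_int_vec w) \<bullet> of_int_vec z" if "w \<in> B" for w
      unfolding n_def by (intro of_int_floor integer_point_inner) (use that dual_basisD[OF assms] of_int_vec_simps in auto)
    have "of_int_vec z = (\<Sum>w\<in>B. (\<phi> (of_int_vec w) \<bullet> of_int_vec z) *\<^sub>R of_int_vec w)"
      using dual_basisD(5)[OF assms, of "of_int_vec z"] by (simp add: sum.reindex[OF inj_on_subset[OF inj_of_int_vec]])
    also have "\<dots> = of_int_vec (\<Sum>w\<in>B. n w *s w)" by (simp add: of_int_vec_sum of_int_vec_simps n)
    finally have "z = (\<Sum>w\<in>B. n w *s w)" by simp
    also have "\<dots> \<in> M.span B" by (intro M.span_sum M.span_scale M.span_base)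
    finally show ?thesis .
  qed
  ultimately show ?thesis unfolding is_int_basis_def by auto
qed

lemma part_of_int_basis_iff_unimodular:
  "part_of_int_basis S \<longleftrightarrow> unimodular (of_int_vec ` S)"
proof
  assume "part_of_int_basis S"
  then obtain B where "S \<subseteq> B" "is_int_basis B" by (auto simp: part_of_int_basis_def)
  then show "unimodular (of_int_vec ` S)"
    unfolding unimodular_def using is_int_basis_imp_dual_basis[of B] image_mono[of S B of_int_vec] by metis
next
  assume "unimodular (of_int_vec ` S)"
  then obtain B \<phi> where B: "of_int_vec ` S \<subseteq> B" "dual_basis B \<phi>" unfolding unimodular_def by blast
  define B0 where "B0 = {z. of_int_vec z \<in> B}"
  have "x \<in> of_int_vec ` B0" if "x \<in> B" for x
    using integer_pointE[OF dual_basisD(2)[OF B(2) that]] that unfolding B0_def by (metis imageI mem_Collect_eq)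
  then have "B = of_int_vec ` B0" unfolding B0_def by blast
  then have "is_int_basis B0" using dual_basis_imp_is_int_basis B by metis
  moreover have "S \<subseteq> B0" using B(1) by (auto simp: B0_def)
  ultimately show "part_of_int_basis S" unfolding part_of_int_basis_def by blast
qed

text \<open>A transvection, which replaces \<open>b\<close> by \<open>k a + b\<close>. On the dual
  side it acts transposed: the form of \<open>a\<close> loses \<open>k\<close> times the form of
  \<open>b\<close>, and the form of \<open>b\<close> becomes the form of the new vector.\<close>

lemma dual_basis_exchange:
  assumes "dual_basis B \<phi>" "a \<in> B" "b \<in> B" "a \<noteq> b" and k: "k \<in> \<int>"
  shows "dual_basis (insert (k *\<^sub>R a + b) (B - {b})) 
     (\<lambda>w. if w = k *\<^sub>R a + b then \<phi> b else if w = a then \<phi> a - k *\<^sub>R \<phi> b else \<phi> w)"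
    and "k *\<^sub>R a + b \<notin> B - {b}"
proof -
  let ?c = "k *\<^sub>R a + b"
  note D = dual_basisD[OF assms(1)]
  have nb: "\<phi> b \<bullet> ?c = 1" using D(4) assms by (simp add: inner_add_right)
  have nc: "?c \<notin> B - {b}"
  proof
    assume "?c \<in> B - {b}"
    then have "\<phi> b \<bullet> ?c = 0" using D(4)[of b ?c] assms by auto
    then show False using nb by simp
  qed
  then show "k *\<^sub>R a + b \<notin> B - {b}" .
  let ?\<psi> = "\<lambda>w. if w = ?c then \<phi> b else if w = a then \<phi> a - k *\<^sub>R \<phi> b else \<phi> w"
  have ac: "a \<noteq> ?c" using nc assms by auto
  show "dual_basis (insert ?c (B - {b})) ?\<psi>"
    unfolding dual_basis_def
  proof (intro conjI ballI allI)
    show "finite (insert ?c (B - {b}))" using D by simp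
    fix w assume w: "w \<in> insert ?c (B - {b})"
    show "integer_point w" "integer_point (?\<psi> w)" using w D assms by auto
    fix v assume v: "v \<in> insert ?c (B - {b})"
    have p: "\<phi> x \<bullet> ?c = k * (if x = a then 1 else 0) + (if x = b then 1 else 0)" if "x \<in> B" for x
      using that assms(2-4) D(4)[OF that assms(2)] D(4)[OF that assms(3)] 
      by (simp add: inner_add_right)
    show "?\<psi> w \<bullet> v = (if v = w then 1 else 0)"
    proof (cases "v = ?c")
      case True
      have "w \<in> B" if "w \<noteq> ?c" using w that by simp
      then show ?thesis unfolding True using nb assms(2-4) w p[OF assms(2)] p[of w] by (auto simp: inner_diff_left)
    next
      case False
      then have vB: "v \<in> B" "v \<noteq> b" using v by auto
      then show ?thesis using False w D(4) assms by (auto simp: inner_diff_left)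
    qed
  next
    fix x
    have "(\<Sum>w\<in>insert ?c (B - {b}). (?\<psi> w \<bullet> x) *\<^sub>R w) = (\<phi> b \<bullet> x) *\<^sub>R ?c + (\<Sum>w\<in>B - {b}. (?\<psi> w \<bullet> x) *\<^sub>R w)"
      using nc D(1) by simp
    also have "(\<Sum>w\<in>B - {b}. (?\<psi> w \<bullet> x) *\<^sub>R w) = (?\<psi> a \<bullet> x) *\<^sub>R a + (\<Sum>w\<in>B - {b} - {a}. (?\<psi> w \<bullet> x) *\<^sub>R w)"
      using assms D(1) by (intro sum.remove) auto
    also have "(\<Sum>w\<in>B - {b} - {a}. (?\<psi> w \<bullet> x) *\<^sub>R w) = (\<Sum>w\<in>B - {b} - {a}. (\<phi> w \<bullet> x) *\<^sub>R w)"
      using nc by (intro sum.cong) auto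
    also have "(\<phi> b \<bullet> x) *\<^sub>R ?c + ((?\<psi> a \<bullet> x) *\<^sub>R a + (\<Sum>w\<in>B - {b} - {a}. (\<phi> w \<bullet> x) *\<^sub>R w))
       = (\<phi> b \<bullet> x) *\<^sub>R b + ((\<phi> a \<bullet> x) *\<^sub>R a + (\<Sum>w\<in>B - {b} - {a}. (\<phi> w \<bullet> x) *\<^sub>R w))"
      using ac by (simp add: inner_diff_left algebra_simps)
    also have "\<dots> = (\<Sum>w\<in>B. (\<phi> w \<bullet> x) *\<^sub>R w)"
      using assms D(1) by (simp add: sum.remove[of B b] sum.remove[of "B - {b}" a])
    also have "\<dots> = x" by (rule D(5))
    finally show "x = (\<Sum>w\<in>insert ?c (B - {b}). (?\<psi> w \<bullet> x) *\<^sub>R w)" by simp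
  qed
qed

lemma unimodular_subset: "unimodular S \<Longrightarrow> T \<subseteq> S \<Longrightarrow> unimodular T"
  unfolding unimodular_def by blast

lemma unimodular_finite: "unimodular S \<Longrightarrow> finite S"
  unfolding unimodular_def using dual_basisD(1) finite_subset by blast

lemma unimodular_integer: "unimodular S \<Longrightarrow> v \<in> S \<Longrightarrow> integer_point v"
  unfolding unimodular_def using dual_basisD(2) by blast

text \<open>Quantifying over all \<open>T \<subseteq> S\<close> lets the same forms read off
  coefficients on every face of the cone generated by \<open>S\<close>.\<close>

lemma unimodular_dual:
  assumes "unimodular S"
  shows "\<exists>\<phi>. (\<forall>w\<in>S. integer_point (\<phi> w)) \<and>
    (\<forall>w\<in>S. \<forall>T c. T \<subseteq> S \<longrightarrow> \<phi> w \<bullet> (\<Sum>v\<in>T. c v *\<^sub>R v) = (if w \<in> T then c w else 0))"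
proof -
  obtain B \<phi> where B: "S \<subseteq> B" "dual_basis B \<phi>" using assms unfolding unimodular_def by blast
  have "integer_point (\<phi> w)" if "w \<in> S" for w using that B dual_basisD by blast
  moreover have "\<phi> w \<bullet> (\<Sum>v\<in>T. c v *\<^sub>R v) = (if w \<in> T then c w else 0)" 
    if "w \<in> S" "T \<subseteq> S" for w T and c :: "real^'a \<Rightarrow> real"
    using dual_coeff[OF B(2), of T w c] that B(1) by blast
  ultimately show ?thesis by blast
qed

lemma unimodular_independent:
  assumes "unimodular S" shows "independent S"
proof -
  obtain \<phi> where \<phi>: "\<forall>w\<in>S. \<forall>T c. T \<subseteq> S \<longrightarrow> \<phi> w \<bullet> (\<Sum>v\<in>T. c v *\<^sub>R v) = (if w \<in> T then c w else 0)"
    using unimodular_dual[OF assms] by blast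
  have "c v = 0" if "(\<Sum>v\<in>S. c v *\<^sub>R v) = 0" "v \<in> S" for c v
    using \<phi>[rule_format, of v S c] that by simp
  then show ?thesis unfolding dependent_finite[OF unimodular_finite[OF assms]] by metis
qed

lemma unimodular_exchange:
  assumes "unimodular S" "a \<in> S" "b \<in> S" "a \<noteq> b" "k \<in> \<int>"
  shows "unimodular (insert (k *\<^sub>R a + b) (S - {b}))"
proof -
  obtain B \<phi> where B: "S \<subseteq> B" "dual_basis B \<phi>" using assms unfolding unimodular_def by blast
  have "insert (k *\<^sub>R a + b) (S - {b}) \<subseteq> insert (k *\<^sub>R a + b) (B - {b})" using B(1) by blast
  then show ?thesis unfolding unimodular_def
    using dual_basis_exchange(1)[OF B(2), of a b k] assms B(1) by (meson subsetD)
qed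

section \<open>Unimodular fans and Farey subdivision\<close>


text \<open>Summing over the support makes the value independent of any named set of generators, so
  that representations in different cones can be compared as functions.\<close>

definition lincomb :: "('a::real_vector \<Rightarrow> real) \<Rightarrow> 'a" where
  "lincomb c = (\<Sum>v\<in>{v. c v \<noteq> 0}. c v *\<^sub>R v)"

lemma lincomb_eq_sum:
  assumes "finite S" "\<And>v. v \<notin> S \<Longrightarrow> c v = 0"
  shows "lincomb c = (\<Sum>v\<in>S. c v *\<^sub>R v)"
  unfolding lincomb_def using assms by (intro sum.mono_neutral_left) auto

definition fan_rep :: "(real ^ 'm) set set \<Rightarrow> real ^ 'm \<Rightarrow> (real ^ 'm \<Rightarrow> real) \<Rightarrow> bool" where
  "fan_rep K x c \<longleftrightarrow> (\<forall>v. 0 \<le> c v) \<and> {v. c v \<noteq> 0} \<in> K \<and> lincomb c = x"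

text \<open>A cone is represented by its set of generators. Uniqueness of the representation \<open>c\<close> expresses that
  two cones meet in the cone of their common generators.\<close>

definition fan :: "(real ^ 'm) set set \<Rightarrow> bool" where
  "fan K \<longleftrightarrow> finite K \<and> (\<forall>S\<in>K. unimodular S) \<and> (\<forall>S\<in>K. \<forall>T. T \<subseteq> S \<longrightarrow> T \<in> K) \<and>
     (\<forall>x c d. fan_rep K x c \<longrightarrow> fan_rep K x d \<longrightarrow> c = d)"

text \<open>The second conjunct says by duality that the cone of \<open>S'\<close> lies in the cone
  of \<open>S\<close>: forms nonnegative on \<open>S\<close> are nonnegative on \<open>S'\<close>.
  In this shape it passes constancy of sign on to the refinement.\<close>

definition fan_refines :: "(real ^ 'm) set set \<Rightarrow> (real ^ 'm) set set \<Rightarrow> bool" where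
  "fan_refines K' K \<longleftrightarrow> (\<forall>x. (\<exists>c. fan_rep K x c) \<longrightarrow> (\<exists>c. fan_rep K' x c)) \<and>
     (\<forall>S'\<in>K'. \<exists>S\<in>K. \<forall>g. (\<forall>v\<in>S. 0 \<le> g \<bullet> v) \<longrightarrow> (\<forall>v\<in>S'. 0 \<le> g \<bullet> v))"

definition same_sign :: "real ^ 'm \<Rightarrow> (real ^ 'm) set \<Rightarrow> bool" where
  "same_sign f S \<longleftrightarrow> (\<forall>v\<in>S. 0 \<le> f \<bullet> v) \<or> (\<forall>v\<in>S. f \<bullet> v \<le> 0)"

lemma fan_refines_refl: "fan_refines K K"
  unfolding fan_refines_def by blast

lemma fan_refinesD:
  assumes "fan_refines K' K"
  shows "fan_rep K x c \<Longrightarrow> \<exists>c. fan_rep K' x c"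
    and "S' \<in> K' \<Longrightarrow> \<exists>S\<in>K. \<forall>g. (\<forall>v\<in>S. 0 \<le> g \<bullet> v) \<longrightarrow> (\<forall>v\<in>S'. 0 \<le> g \<bullet> v)"
  using assms unfolding fan_refines_def by (blast, elim conjE bspec)

lemma fan_refines_trans:
  assumes "fan_refines K'' K'" "fan_refines K' K"
  shows "fan_refines K'' K"
  unfolding fan_refines_def
proof (intro conjI allI impI ballI)
  fix x assume "\<exists>c. fan_rep K x c"
  then show "\<exists>c. fan_rep K'' x c" using fan_refinesD(1)[OF assms(1)] fan_refinesD(1)[OF assms(2)] by blast
next
  fix S'' assume "S'' \<in> K''"
  then obtain S' where S': "S' \<in> K'" "\<forall>g. (\<forall>v\<in>S'. 0 \<le> g \<bullet> v) \<longrightarrow> (\<forall>v\<in>S''. 0 \<le> g \<bullet> v)"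
    by (elim bexE[OF fan_refinesD(2)[OF assms(1)]])
  then obtain S where S: "S \<in> K" "\<forall>g. (\<forall>v\<in>S. 0 \<le> g \<bullet> v) \<longrightarrow> (\<forall>v\<in>S'. 0 \<le> g \<bullet> v)"
    by (elim bexE[OF fan_refinesD(2)[OF assms(2)]])
  show "\<exists>S\<in>K. \<forall>g. (\<forall>v\<in>S. 0 \<le> g \<bullet> v) \<longrightarrow> (\<forall>v\<in>S''. 0 \<le> g \<bullet> v)"
    by (intro bexI[OF _ S(1)] allI impI) (rule mp[OF spec[OF S'(2)] mp[OF spec[OF S(2)]]])
qed

lemma fan_refines_same_sign:
  assumes "fan_refines K' K" "\<forall>S\<in>K. same_sign f S" "S' \<in> K'"
  shows "same_sign f S'"
proof -
  obtain S where S: "S \<in> K" "\<forall>g. (\<forall>v\<in>S. 0 \<le> g \<bullet> v) \<longrightarrow> (\<forall>v\<in>S'. 0 \<le> g \<bullet> v)"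
    by (rule bexE[OF fan_refinesD(2)[OF assms(1,3)]])
  show ?thesis using bspec[OF assms(2) S(1)] S(2)[rule_format, of f] S(2)[rule_format, of "- f"]
    unfolding same_sign_def by auto
qed

lemma fanD:
  assumes "fan K"
  shows "finite K" "S \<in> K \<Longrightarrow> unimodular S" "S \<in> K \<Longrightarrow> finite S" "S \<in> K \<Longrightarrow> T \<subseteq> S \<Longrightarrow> T \<in> K"
    "fan_rep K x c \<Longrightarrow> fan_rep K x d \<Longrightarrow> c = d"
proof -
  note * = assms[unfolded fan_def]
  show "finite K" by (rule conjunct1[OF *])
  show "S \<in> K \<Longrightarrow> unimodular S" by (rule bspec[OF conjunct1[OF conjunct2[OF *]]])
  then show "S \<in> K \<Longrightarrow> finite S" by (rule unimodular_finite)
  show "S \<in> K \<Longrightarrow> T \<subseteq> S \<Longrightarrow> T \<in> K"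
    by (rule conjunct1[OF conjunct2[OF conjunct2[OF *]], rule_format])
  show "fan_rep K x c \<Longrightarrow> fan_rep K x d \<Longrightarrow> c = d"
    by (rule conjunct2[OF conjunct2[OF conjunct2[OF *]], rule_format])
qed

lemma fan_Pow:
  fixes B :: "(real ^ 'm) set"
  assumes "unimodular B"
  shows "fan (Pow B)"
proof -
  have fin: "finite B" by (rule unimodular_finite[OF assms])
  obtain \<phi> where \<phi>: "\<forall>w\<in>B. \<forall>T c. T \<subseteq> B \<longrightarrow> \<phi> w \<bullet> (\<Sum>v\<in>T. c v *\<^sub>R v) = (if w \<in> T then c w else 0)"
    using unimodular_dual[OF assms] by blast
  have "c = d" if "fan_rep (Pow B) x c" "fan_rep (Pow B) x d" for x c d
  proof
    fix v
    have c0: "c v = 0" "d v = 0" if "v \<notin> B" for v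
      using that \<open>fan_rep (Pow B) x c\<close> \<open>fan_rep (Pow B) x d\<close> by (auto simp: fan_rep_def)
    then have eq: "(\<Sum>v\<in>B. c v *\<^sub>R v) = (\<Sum>v\<in>B. d v *\<^sub>R v)"
      using that lincomb_eq_sum[OF fin, of c] lincomb_eq_sum[OF fin, of d] by (auto simp: fan_rep_def)
    show "c v = d v"
    proof (cases "v \<in> B")
      case True
      then show ?thesis using \<phi>[rule_format, OF True order_refl, of c] \<phi>[rule_format, OF True order_refl, of d] eq by simp
    qed (simp add: c0)
  qed
  then show ?thesis unfolding fan_def using fin unimodular_subset[OF assms] by auto
qed

lemma fan_rep_Pow:
  assumes "finite B" "\<And>v. v \<in> B \<Longrightarrow> 0 \<le> c v"
  shows "\<exists>d. fan_rep (Pow B) (\<Sum>v\<in>B. c v *\<^sub>R v) d"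
proof -
  let ?d = "\<lambda>v. if v \<in> B then c v else 0"
  have "lincomb ?d = (\<Sum>v\<in>B. c v *\<^sub>R v)" 
    by (subst lincomb_eq_sum[OF assms(1)]) auto
  then have "fan_rep (Pow B) (\<Sum>v\<in>B. c v *\<^sub>R v) ?d"
    using assms by (auto simp: fan_rep_def)
  then show ?thesis by blast
qed

text \<open>Stellar subdivision at the mediant of the edge \<open>a, b\<close>. The new cones are
  the joins of \<open>a + b\<close> with those faces of the star of the edge that miss
  \<open>a\<close> or \<open>b\<close>.\<close>

definition star_subdiv :: "(real ^ 'm) set set \<Rightarrow> real ^ 'm \<Rightarrow> real ^ 'm \<Rightarrow> (real ^ 'm) set set" where
  "star_subdiv K a b = {S \<in> K. \<not> {a, b} \<subseteq> S} \<union>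
     {insert (a + b) S | S. insert a (insert b S) \<in> K \<and> \<not> {a, b} \<subseteq> S}"

lemma star_subdivI:
  "insert a (insert b S) \<in> K \<Longrightarrow> \<not> {a, b} \<subseteq> S \<Longrightarrow> insert (a + b) S \<in> star_subdiv K a b"
  unfolding star_subdiv_def by (rule UnI2) blast

context
  fixes K :: "(real ^ 'm) set set" and a b c :: "real ^ 'm"
  assumes K: "fan K" and ab: "{a, b} \<in> K" "a \<noteq> b" and c_def: "c = a + b"
begin

text \<open>Otherwise the point \<open>a + b\<close> would have two representations in the fan, one
  as a single generator and one as the sum of \<open>a\<close> and \<open>b\<close>.\<close>

lemma star_subdiv_new_vertex: 
  assumes "S \<in> K" shows "c \<notin> S"
proof
  assume "c \<in> S"
  then have cK: "{c} \<in> K" using fanD(4)[OF K assms, of "{c}"] by blast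
  have "lincomb (\<lambda>v. if v = c then 1 else 0) = c" by (subst lincomb_eq_sum[of "{c}"]) auto
  then have "fan_rep K c (\<lambda>v. if v = c then 1 else 0)" using cK by (auto simp: fan_rep_def)
  moreover have "{v. (if v = a \<or> v = b then 1 else 0) \<noteq> (0::real)} = {a, b}" by auto
  moreover have "lincomb (\<lambda>v. if v = a \<or> v = b then 1 else 0) = c" 
    by (subst lincomb_eq_sum[of "{a, b}"]) (use ab(2) in \<open>auto simp: c_def\<close>)
  ultimately have "(\<lambda>v. if v = c then 1 else 0 :: real) = (\<lambda>v. if v = a \<or> v = b then 1 else 0)"
    using ab(1) by (intro fanD(5)[OF K]) (auto simp: fan_rep_def)
  then have *: "(if v = c then 1 else 0 :: real) = (if v = a \<or> v = b then 1 else 0)" for v by meson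
  show False using *[of a] *[of b] ab(2) by (simp split: if_splits)
qed

lemma star_subdiv_ne: "c \<noteq> a" "c \<noteq> b" 
  using star_subdiv_new_vertex[OF ab(1)] by auto

text \<open>Adds \<open>m\<close> times the relation \<open>c - a - b = 0\<close>. Old and new
  coefficients are converted into each other in this way, with \<open>m\<close> the smaller of the
  coefficients at \<open>a\<close> and \<open>b\<close> in one direction and minus the coefficient
  at \<open>c\<close> in the other.\<close>

lemma lincomb_shift:
  assumes "finite S" "a \<in> S" "b \<in> S" "c \<in> S" "\<And>v. v \<notin> S \<Longrightarrow> d v = 0"
    and d': "\<And>v. d' v = (if v = c then d c + m else if v = a then d a - m else if v = b then d b - m else d v)"
  shows "lincomb d' = lincomb d"
proof -
  have eq: "d' v = d v + ((if v = c then m else 0) - (if v = a then m else 0) - (if v = b then m else 0))" for v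
    using star_subdiv_ne ab(2) by (auto simp: d')
  have "lincomb d' = (\<Sum>v\<in>S. d' v *\<^sub>R v)"
    by (rule lincomb_eq_sum[OF assms(1)]) (use assms in \<open>auto simp: d'\<close>)
  also have "\<dots> = (\<Sum>v\<in>S. d v *\<^sub>R v) + ((\<Sum>v\<in>S. (if v = c then m else 0) *\<^sub>R v) - (\<Sum>v\<in>S. (if v = a then m else 0) *\<^sub>R v)
      - (\<Sum>v\<in>S. (if v = b then m else 0) *\<^sub>R v))"
    unfolding eq scaleR_left_distrib scaleR_left_diff_distrib sum.distrib sum_subtractf ..
  also have "\<dots> = (\<Sum>v\<in>S. d v *\<^sub>R v) + (m *\<^sub>R c - m *\<^sub>R a - m *\<^sub>R b)"
    using assms by (simp add: if_distrib[of "\<lambda>x. x *\<^sub>R _"] cong: if_cong)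
  also have "\<dots> = (\<Sum>v\<in>S. d v *\<^sub>R v)" by (simp add: c_def algebra_simps)
  also have "\<dots> = lincomb d" by (rule lincomb_eq_sum[symmetric]) (use assms in auto)
  finally show ?thesis .
qed

text \<open>As much of \<open>a + b\<close> as possible is traded for the new generator, which uses
  up \<open>a\<close> or \<open>b\<close>. If one of the two coefficients is zero already, nothing
  changes.\<close>

lemma star_subdiv_rep_forward:
  assumes "fan_rep K x d"
  defines "m \<equiv> min (d a) (d b)"
  shows "fan_rep (star_subdiv K a b) x
    (\<lambda>v. if v = c then d c + m else if v = a then d a - m else if v = b then d b - m else d v)" (is "fan_rep _ _ ?d")
proof -
  have d: "\<And>v. 0 \<le> d v" "{v. d v \<noteq> 0} \<in> K" "lincomb d = x" using assms by (auto simp: fan_rep_def)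
  have dc: "d c = 0" using star_subdiv_new_vertex[OF d(2)] by simp
  have nonneg: "0 \<le> ?d v" for v using d(1) by (auto simp: m_def)
  have "lincomb ?d = lincomb d"
    by (rule lincomb_shift[of "insert a (insert b (insert c {v. d v \<noteq> 0}))"]) (use fanD(3)[OF K d(2)] in auto)
  moreover have "{v. ?d v \<noteq> 0} \<in> star_subdiv K a b"
  proof (cases "m = 0")
    case True
    have "{v. ?d v \<noteq> 0} = {v. d v \<noteq> 0}" using True dc by auto
    moreover have "\<not> {a, b} \<subseteq> {v. d v \<noteq> 0}" using True by (auto simp: m_def min_def split: if_splits)
    ultimately show ?thesis using d(2) unfolding star_subdiv_def by auto
  next
    case False
    let ?S = "{v. ?d v \<noteq> 0} - {c}"
    have pos: "0 < m" "0 < d a" "0 < d b" using False d(1)[of a] d(1)[of b] by (auto simp: m_def min_def split: if_splits)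
    have "insert a (insert b ?S) = {v. d v \<noteq> 0}" using pos dc star_subdiv_ne by auto
    moreover have "\<not> {a, b} \<subseteq> ?S" using star_subdiv_ne by (auto simp: m_def min_def)
    moreover have "{v. ?d v \<noteq> 0} = insert c ?S" using pos dc by auto
    ultimately show ?thesis using star_subdivI[of a b ?S K] d(2) c_def by simp
  qed
  ultimately show ?thesis using d nonneg by (simp add: fan_rep_def)
qed

text \<open>Undoes the trade by handing the coefficient of \<open>c\<close> back to \<open>a\<close>
  and \<open>b\<close>. No new cone contains both \<open>a\<close> and \<open>b\<close>, so the
  amount handed back is recovered as \<open>min (d a) (d b)\<close>. Hence \<open>d\<close>
  determines \<open>d'\<close>, and uniqueness is inherited from \<open>K\<close>.\<close>

lemma star_subdiv_rep_backward:
  assumes "fan_rep (star_subdiv K a b) x d'"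
  obtains d where "fan_rep K x d" 
    "d' = (\<lambda>v. if v = c then d c + min (d a) (d b) else if v = a then d a - min (d a) (d b)
      else if v = b then d b - min (d a) (d b) else d v)"
proof -
  have d': "\<And>v. 0 \<le> d' v" "{v. d' v \<noteq> 0} \<in> star_subdiv K a b" "lincomb d' = x" using assms by (auto simp: fan_rep_def)
  define d where "d v = (if v = c then d' c + (- d' c) else if v = a then d' a - (- d' c) else if v = b then d' b - (- d' c) else d' v)" for v
  have fin: "finite {v. d' v \<noteq> 0}" 
  proof -
    obtain S where "S \<in> K" "{v. d' v \<noteq> 0} \<subseteq> insert c S"
      using d'(2) unfolding star_subdiv_def c_def by blast
    then show ?thesis using fanD(3)[OF K] by (meson finite_insert finite_subset)
  qed
  have ab0: "d' a = 0 \<or> d' b = 0"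
  proof (rule ccontr)
    assume "\<not> ?thesis"
    then have ab': "{a, b} \<subseteq> {v. d' v \<noteq> 0}" by simp
    then obtain S where "{v. d' v \<noteq> 0} = insert c S" "\<not> {a, b} \<subseteq> S"
      using d'(2) unfolding star_subdiv_def c_def by (elim UnE CollectE) blast+
    then have "{a, b} \<subseteq> S" using ab' star_subdiv_ne by simp
    then show False using \<open>\<not> {a, b} \<subseteq> S\<close> by simp
  qed
  have lin: "lincomb d = lincomb d'"
    by (rule lincomb_shift[of "insert a (insert b (insert c {v. d' v \<noteq> 0}))"]) (use fin in \<open>auto simp: d_def\<close>)
  have "{v. d v \<noteq> 0} \<in> K"
  proof (cases "d' c = 0")
    case True
    then have "{v. d v \<noteq> 0} = {v. d' v \<noteq> 0}" by (auto simp: d_def)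
    moreover have "{v. d' v \<noteq> 0} \<in> K" 
      using d'(2) True unfolding star_subdiv_def c_def by (auto simp: set_eq_iff)
    ultimately show ?thesis by simp
  next
    case False
    then have cpos: "d' c > 0" using d'(1)[of c] by simp
    have "{v. d' v \<noteq> 0} \<notin> K" using star_subdiv_new_vertex cpos by fastforce
    then obtain S where S: "{v. d' v \<noteq> 0} = insert c S" "insert a (insert b S) \<in> K"
      using d'(2) unfolding star_subdiv_def c_def by blast
    have "c \<notin> S" using star_subdiv_new_vertex[OF S(2)] by simp
    have "d v \<noteq> 0 \<longleftrightarrow> v \<in> insert a (insert b S)" for v
    proof -
      have "v \<in> S \<longleftrightarrow> d' v \<noteq> 0" if "v \<noteq> c" using S(1) that by auto
      then show ?thesis using cpos d'(1)[of a] d'(1)[of b] star_subdiv_ne \<open>c \<notin> S\<close> 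
        unfolding d_def by (cases "v = c"; cases "v = a"; cases "v = b") auto
    qed
    then have "{v. d v \<noteq> 0} = insert a (insert b S)" by blast
    then show ?thesis using S by simp
  qed
  moreover have "0 \<le> d v" for v using d'(1) by (auto simp: d_def)
  ultimately have 1: "fan_rep K x d" using lin d'(3) by (simp add: fan_rep_def)
  have mn: "min (d a) (d b) = d' c" using ab0 d'(1)[of a] d'(1)[of b] star_subdiv_ne by (auto simp: d_def min_def)
  have 2: "d' = (\<lambda>v. if v = c then d c + min (d a) (d b) else if v = a then d a - min (d a) (d b)
      else if v = b then d b - min (d a) (d b) else d v)"
    unfolding mn using ab(2) star_subdiv_ne by (auto simp: d_def fun_eq_iff)
  show ?thesis by (rule that[OF 1 2])
qed

text \<open>A new cone misses \<open>a\<close> or \<open>b\<close>, so it is a face of the cone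
  obtained by the transvection that replaces this generator by \<open>a + b\<close>; this gives
  unimodularity.\<close>

lemma fan_star_subdiv: "fan (star_subdiv K a b)"
  unfolding fan_def
proof (intro conjI ballI allI impI)
  have "star_subdiv K a b \<subseteq> Pow (insert c (\<Union>K))" unfolding star_subdiv_def c_def by auto
  moreover have "finite (\<Union>K)" using fanD[OF K] by auto
  ultimately show "finite (star_subdiv K a b)" by (meson finite_Pow_iff finite_insert finite_subset)
next
  fix S assume "S \<in> star_subdiv K a b"
  then consider "S \<in> K" | T where "S = insert c T" "insert a (insert b T) \<in> K" "\<not> {a, b} \<subseteq> T"
    unfolding star_subdiv_def c_def by blast
  then show "unimodular S"
  proof cases
    case 2
    let ?U = "insert a (insert b T)"
    have U: "unimodular ?U" using fanD(2)[OF K 2(2)] .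
    have "unimodular (insert (1 *\<^sub>R a + b) (?U - {b}))" "unimodular (insert (1 *\<^sub>R b + a) (?U - {a}))"
      using unimodular_exchange[OF U, of a b 1] unimodular_exchange[OF U, of b a 1] ab(2) by auto
    moreover have "S \<subseteq> insert (1 *\<^sub>R a + b) (?U - {b}) \<or> S \<subseteq> insert (1 *\<^sub>R b + a) (?U - {a})"
      using 2 by (auto simp: c_def add.commute)
    ultimately show ?thesis using unimodular_subset by blast
  qed (simp add: fanD[OF K])
next
  fix S T assume S: "S \<in> star_subdiv K a b" and T: "T \<subseteq> S"
  then consider "S \<in> K" "\<not> {a, b} \<subseteq> S" | U where "S = insert c U" "insert a (insert b U) \<in> K" "\<not> {a, b} \<subseteq> U"
    unfolding star_subdiv_def c_def by blast
  then show "T \<in> star_subdiv K a b"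
  proof cases
    case 1
    then show ?thesis using T fanD(4)[OF K] unfolding star_subdiv_def by blast
  next
    case 2
    show ?thesis
    proof (cases "c \<in> T")
      case True
      then have "T = insert c (T - {c})" "insert a (insert b (T - {c})) \<subseteq> insert a (insert b U)" "\<not> {a, b} \<subseteq> T - {c}"
        using T 2 by auto
      then show ?thesis using fanD(4)[OF K 2(2)] c_def by (metis star_subdivI)
    next
      case False
      then have "T \<subseteq> U" using T 2 by auto
      then have "T \<in> K" "\<not> {a, b} \<subseteq> T" using fanD(4)[OF K 2(2), of T] 2(3) by auto
      then show ?thesis unfolding star_subdiv_def by blast
    qed
  qed
next
  fix x d1 d2 assume "fan_rep (star_subdiv K a b) x d1" "fan_rep (star_subdiv K a b) x d2"
  then show "d1 = d2" using fanD(5)[OF K] by (elim star_subdiv_rep_backward) metis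
qed

lemma fan_refines_star_subdiv: "fan_refines (star_subdiv K a b) K"
proof -
  have "\<exists>S\<in>K. \<forall>g. (\<forall>v\<in>S. 0 \<le> g \<bullet> v) \<longrightarrow> (\<forall>v\<in>S'. 0 \<le> g \<bullet> v)" if "S' \<in> star_subdiv K a b" for S'
  proof -
    from that consider "S' \<in> K" | T where "S' = insert (a + b) T" "insert a (insert b T) \<in> K"
      unfolding star_subdiv_def by blast
    then show ?thesis 
    proof cases
      case 2
      then show ?thesis by (intro bexI[of _ "insert a (insert b T)"]) (auto simp: inner_add_right)
    qed blast
  qed
  then show ?thesis unfolding fan_refines_def using star_subdiv_rep_forward by blast
qed

end

text \<open>Subdividing an edge \<open>a, b\<close> of maximal weight \<open>f \<bullet> a - f \<bullet> b\<close> among those crossing the hyperplane of \<open>f\<close>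
  creates only crossing edges of smaller weight, so the multiset of weights decreases.\<close>

lemma fan_refine_same_sign:
  assumes "fan K" "integer_point f"
  shows "\<exists>K'. fan K' \<and> fan_refines K' K \<and> (\<forall>S\<in>K'. same_sign f S)"
proof -
  \<comment> \<open>The crossing edges, each oriented from the positive to the negative side. A cone
    without such an edge has constant sign.\<close>
  define E where "E K = {(u, v). {u, v} \<in> K \<and> f \<bullet> u > 0 \<and> f \<bullet> v < 0}" for K
  define w where "w = (\<lambda>(u, v). nat \<lfloor>f \<bullet> u - f \<bullet> v\<rfloor>)"
  define W where "W K = image_mset w (mset_set (E K))" for K
  have wf: "wf (inv_image (mult less_than) W)" by (intro wf_inv_image wf_mult wf_less_than)
  show ?thesis using assms(1)
  proof (induction K rule: wf_induct_rule[OF wf])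
    case (1 K)
    note K = \<open>fan K\<close>
    have finE: "finite (E K)" if "fan K" for K
    proof -
      have "E K \<subseteq> \<Union>K \<times> \<Union>K" unfolding E_def by auto
      moreover have "finite (\<Union>K)" using fanD[OF that] by auto
      ultimately show ?thesis by (meson finite_SigmaI finite_subset)
    qed
    show ?case
    proof (cases "E K = {}")
      case True
      have "same_sign f S" if "S \<in> K" for S
      proof (rule ccontr)
        assume "\<not> same_sign f S"
        then obtain u v where uv: "u \<in> S" "v \<in> S" "f \<bullet> v < 0" "f \<bullet> u > 0" by (auto simp: same_sign_def not_le)
        then have "{u, v} \<in> K" using fanD(4)[OF K that, of "{u, v}"] by blast
        then show False using True uv unfolding E_def by blast
      qed
      then show ?thesis using K fan_refines_refl by blast
    next
      case False
      define M where "M = Max (w ` E K)"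
      have "M \<in> w ` E K" unfolding M_def using False finE[OF K] by (intro Max_in) auto
      then obtain a b where ab: "(a, b) \<in> E K" "w (a, b) = M" by auto
      have le: "w e \<le> M" if "e \<in> E K" for e unfolding M_def using finE[OF K] that by simp
      have abK: "{a, b} \<in> K" "a \<noteq> b" and fab: "f \<bullet> a > 0" "f \<bullet> b < 0" using ab unfolding E_def by auto
      let ?K = "star_subdiv K a b"
      have fan': "fan ?K" by (rule fan_star_subdiv[OF K abK refl])
      have int: "f \<bullet> v \<in> \<int>" if "S \<in> K" "v \<in> S" for v S
        by (rule integer_point_inner[OF assms(2) unimodular_integer[OF fanD(2)[OF K that(1)] that(2)]])
      \<comment> \<open>A new edge has \<open>a + b\<close> as an endpoint. Replacing this endpoint
        by \<open>a\<close> on the positive side, or by \<open>b\<close> on the negative side, gives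
        an edge of \<open>K\<close> of strictly larger weight, and that weight is at most
        \<open>M\<close>.\<close>
      have new: "w e < M" if "e \<in> E ?K" "e \<notin> E K" for e
      proof -
        obtain u v where e: "e = (u, v)" by (cases e)
        have uv: "{u, v} \<in> ?K" "f \<bullet> u > 0" "f \<bullet> v < 0" and nK: "{u, v} \<notin> K" using that unfolding e E_def by auto
        then obtain S where S: "{u, v} = insert (a + b) S" "insert a (insert b S) \<in> K" unfolding star_subdiv_def by blast
        \<comment> \<open>Weights are rounded to natural numbers. Strict inequality survives because
          the values of \<open>f\<close> at generators are integers.\<close>
        have sm: "nat \<lfloor>p\<rfloor> < nat \<lfloor>q\<rfloor>" if "p < q" "p \<in> \<int>" "q \<in> \<int>" "0 < q" for p q :: real
          using that by (auto elim!: Ints_cases)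
        have ifa: "f \<bullet> a \<in> \<int>" "f \<bullet> b \<in> \<int>" using int[OF S(2)] by auto
        have "u \<noteq> v" using uv by auto
        then consider "u = a + b" "v \<in> S" | "v = a + b" "u \<in> S" using S(1) by (metis insert_iff singletonD insertCI)
        then show ?thesis
        proof cases
          case 1
          have "{a, v} \<in> K" using fanD(4)[OF K S(2), of "{a, v}"] 1 by auto
          then have "w (a, v) \<le> M" using le[of "(a, v)"] fab uv by (auto simp: E_def)
          moreover have "w e < w (a, v)" unfolding w_def e prod.case
            using ifa int[OF S(2), of v] 1 fab uv by (intro sm) (auto simp: inner_add_right)
          ultimately show ?thesis by simp
        next
          case 2
          have "{u, b} \<in> K" using fanD(4)[OF K S(2), of "{u, b}"] 2 by auto
          then have "w (u, b) \<le> M" using le[of "(u, b)"] fab uv by (auto simp: E_def)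
          moreover have "w e < w (u, b)" unfolding w_def e prod.case
            using ifa int[OF S(2), of u] 2 fab uv by (intro sm) (auto simp: inner_add_right)
          ultimately show ?thesis by simp
        qed
      qed
      have abn: "(a, b) \<notin> E ?K" 
        using star_subdiv_new_vertex[OF K abK refl abK(1)] unfolding E_def star_subdiv_def by auto
      \<comment> \<open>Without the common edges, the removed ones, among them \<open>a, b\<close>
        of weight \<open>M\<close>, stand against added ones of weight below \<open>M\<close>. This
        is a descent in the multiset order.\<close>
      have W1: "W ?K = image_mset w (mset_set (E K \<inter> E ?K)) + image_mset w (mset_set (E ?K - E K))"
        unfolding W_def using finE[OF fan'] finE[OF K]
        by (subst mset_set_Union[symmetric] image_mset_union[symmetric])+ (auto intro!: arg_cong[of _ _ mset_set] arg_cong[of _ _ "image_mset w"])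
      have W2: "W K = image_mset w (mset_set (E K \<inter> E ?K)) + image_mset w (mset_set (E K - E ?K))"
        unfolding W_def using finE[OF fan'] finE[OF K]
        by (subst mset_set_Union[symmetric] image_mset_union[symmetric])+ (auto intro!: arg_cong[of _ _ mset_set] arg_cong[of _ _ "image_mset w"])
      have "(W ?K, W K) \<in> mult less_than"
        unfolding W1 W2
      proof (rule one_step_implies_mult)
        show "image_mset w (mset_set (E K - E ?K)) \<noteq> {#}" using ab(1) abn finE[OF K] by (auto simp: mset_set_empty_iff)
        show "\<forall>k\<in>#image_mset w (mset_set (E ?K - E K)). \<exists>j\<in>#image_mset w (mset_set (E K - E ?K)). (k, j) \<in> less_than"
        proof
          fix k assume "k \<in># image_mset w (mset_set (E ?K - E K))"
          then obtain e where "e \<in> E ?K - E K" "k = w e" using finE[OF fan'] by auto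
          then have "k < M" using new by auto
          moreover have "M \<in># image_mset w (mset_set (E K - E ?K))" using ab abn finE[OF K] by force
          ultimately show "\<exists>j\<in>#image_mset w (mset_set (E K - E ?K)). (k, j) \<in> less_than" by auto
        qed
      qed
      then obtain K' where "fan K'" "fan_refines K' ?K" "\<forall>S\<in>K'. same_sign f S" using "1.IH"[of ?K] fan' by auto
      then show ?thesis using fan_refines_star_subdiv[OF K abK refl] fan_refines_trans by blast
    qed
  qed
qed

lemma fan_refine_same_sign_finite:
  assumes "finite F" "fan K" "\<forall>f\<in>F. integer_point f"
  shows "\<exists>K'. fan K' \<and> fan_refines K' K \<and> (\<forall>f\<in>F. \<forall>S\<in>K'. same_sign f S)"
  using assms
proof (induction F rule: finite_induct)
  case empty
  then show ?case using fan_refines_refl by blast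
next
  case (insert f F)
  then obtain K1 where K1: "fan K1" "fan_refines K1 K" "\<forall>f\<in>F. \<forall>S\<in>K1. same_sign f S" by auto
  obtain K2 where K2: "fan K2" "fan_refines K2 K1" "\<forall>S\<in>K2. same_sign f S"
    using fan_refine_same_sign[OF K1(1), of f] insert by auto
  have "\<forall>g\<in>insert f F. \<forall>S\<in>K2. same_sign g S" using K2(3) K1(3) fan_refines_same_sign[OF K2(2)] by blast
  then show ?case using K2(1) fan_refines_trans[OF K2(2) K1(2)] by blast
qed

section \<open>Regular triangulations from fans\<close>


abbreviation lift1 :: "real ^ 'n \<Rightarrow> real ^ 'n option" where
  "lift1 x \<equiv> append_coord x 1"

text \<open>Central projection to height one, meaningful for vectors with nonzero last
  coordinate.\<close>

definition dehomog :: "real ^ 'n option \<Rightarrow> real ^ 'n" where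
  "dehomog v = (\<chi> i. v $ Some i / v $ None)"

lemma append_coord_nth [simp]: "append_coord x c $ None = c" "append_coord x c $ Some i = x $ i"
  by (simp_all add: append_coord_def)

lemma vec_option_eq_iff: "x = y \<longleftrightarrow> x $ None = y $ None \<and> (\<forall>i. x $ Some i = y $ Some i)"
  unfolding vec_eq_iff by (metis not_None_eq)

lemma sum_UNIV_option: "(\<Sum>i\<in>UNIV. f i) = f None + (\<Sum>i\<in>UNIV. f (Some i))" 
  for f :: "'n::finite option \<Rightarrow> 'a::comm_monoid_add"
  unfolding UNIV_option_conv by (simp add: sum.reindex)

lemma axis_nth_if: "axis i c $ j = (if j = i then c else 0)"
  by (simp add: axis_def)

lemma lift1_dehomog: "v $ None \<noteq> 0 \<Longrightarrow> v $ None *\<^sub>R lift1 (dehomog v) = v"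
  by (simp add: vec_option_eq_iff dehomog_def)

lemma dehomog_lift1: "c \<noteq> 0 \<Longrightarrow> dehomog (c *\<^sub>R lift1 x) = x"
  by (simp add: vec_eq_iff dehomog_def)

lemma lift1_eq_iff [simp]: "lift1 x = lift1 y \<longleftrightarrow> x = y"
  by (auto simp: vec_option_eq_iff vec_eq_iff)

lemma lift1_convex_comb:
  assumes "sum u V = 1"
  shows "lift1 (\<Sum>x\<in>V. u x *\<^sub>R x) = (\<Sum>x\<in>V. u x *\<^sub>R lift1 x)"
  using assms by (simp add: vec_option_eq_iff)

lemma den_works: 
  assumes "rational_point x"
  shows "0 < den x" "real (den x) * x $ i \<in> \<int>"
proof -
  have "0 < den x \<and> (\<forall>i. real (den x) * x $ i \<in> \<int>)"
    unfolding den_def by (rule LeastI_ex) (rule rational_point_common_denominator[OF assms])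
  then show "0 < den x" "real (den x) * x $ i \<in> \<int>" by auto
qed

text \<open>A member of a unimodular set is primitive, since some integer form takes the value 1 on
  it. If \<open>k\<close> clears the denominators of \<open>dehomog v\<close>, this form maps
  \<open>k *\<^sub>R lift1 (dehomog v)\<close> to \<open>k / n\<close> with \<open>n\<close> the
  height of \<open>v\<close>, so \<open>n\<close> divides \<open>k\<close>.\<close>

lemma dehomog_primitive:
  fixes v :: "real ^ 'n::finite option"
  assumes v: "unimodular S" "v \<in> S" and pos: "v $ None > 0"
  shows "rational_point (dehomog v)" "real (den (dehomog v)) = v $ None"
    "of_int_vec (homog (dehomog v)) = v"
proof -
  let ?x = "dehomog v"
  have iv: "integer_point v" using unimodular_integer v by blast
  obtain \<phi> where \<phi>: "\<forall>w\<in>S. integer_point (\<phi> w)" "\<forall>w\<in>S. \<forall>T c. T \<subseteq> S \<longrightarrow> \<phi> w \<bullet> (\<Sum>v\<in>T. c v *\<^sub>R v) = (if w \<in> T then c w else 0)"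
    using unimodular_dual[OF v(1)] by blast
  have \<phi>v: "\<phi> v \<bullet> v = 1" using \<phi>(2)[rule_format, OF v(2), of "{v}" "\<lambda>_. 1"] v(2) by simp
  obtain n where n: "v $ None = of_int n" using iv by (auto simp: integer_point_def elim: Ints_cases)
  have npos: "n > 0" using pos n by simp
  have hv: "v $ None * ?x $ i \<in> \<int>" for i using iv pos by (simp add: dehomog_def integer_point_def)
  then show rat: "rational_point ?x"
    using iv pos by (auto simp: rational_point_def dehomog_def integer_point_def Ints_subset_Rats[THEN subsetD] intro!: Rats_divide)
  have "den ?x = nat n"
    unfolding den_def
  proof (rule Least_equality)
    show "0 < nat n \<and> (\<forall>i. real (nat n) * ?x $ i \<in> \<int>)" using npos hv n by simp
    fix k :: nat assume k: "0 < k \<and> (\<forall>i. real k * ?x $ i \<in> \<int>)"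
    have "(real k *\<^sub>R lift1 ?x) $ i \<in> \<int>" for i using k by (cases i) auto
    then have "integer_point (real k *\<^sub>R lift1 ?x)" by (simp add: integer_point_def)
    then have "\<phi> v \<bullet> (real k *\<^sub>R lift1 ?x) \<in> \<int>" using \<phi>(1) v(2) by (intro integer_point_inner) auto
    moreover have "real k *\<^sub>R lift1 ?x = (real k / n) *\<^sub>R v"
      using lift1_dehomog[of v] npos n by (metis (no_types, lifting) divide_eq_eq of_int_0_less_iff less_irrefl scaleR_scaleR times_divide_eq_left)
    ultimately have "real k / n \<in> \<int>" using \<phi>v by simp
    then obtain m where "real k / n = of_int m" by (auto elim: Ints_cases)
    then have "real_of_int (int k) = of_int (m * n)" using npos by (simp add: field_simps)
    then have km: "int k = m * n" by (simp only: of_int_eq_iff)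
    then have "m > 0" using k npos by (metis of_nat_0_less_iff zero_less_mult_pos2)
    then have "n \<le> int k" unfolding km using npos by (simp add: mult_le_cancel_right1)
    then show "nat n \<le> k" by simp
  qed
  then show d: "real (den ?x) = v $ None" using n npos by simp
  show "of_int_vec (homog ?x) = v" 
    unfolding of_int_vec_homog[OF rat] d using lift1_dehomog[of v] pos by simp
qed

text \<open>A coefficient \<open>c w\<close> of a generator becomes the weight
  \<open>c w * w $ None\<close> of its projection. The height \<open>h = 1\<close> gives affine
  combinations and \<open>h = 0\<close> gives affine dependences.\<close>

lemma lift1_eq_comb_iff:
  fixes W :: "(real ^ 'n::finite option) set"
  assumes "\<And>w. w \<in> W \<Longrightarrow> w $ None > 0"
  shows "append_coord y h = (\<Sum>w\<in>W. c w *\<^sub>R w) \<longleftrightarrow>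
    (\<Sum>w\<in>W. c w * w $ None) = h \<and> (\<Sum>w\<in>W. (c w * w $ None) *\<^sub>R dehomog w) = y"
proof -
  have "(\<Sum>w\<in>W. c w *\<^sub>R w) = (\<Sum>w\<in>W. (c w * w $ None) *\<^sub>R lift1 (dehomog w))"
  proof (rule sum.cong[OF refl])
    fix w assume "w \<in> W"
    then show "c w *\<^sub>R w = (c w * w $ None) *\<^sub>R lift1 (dehomog w)"
      using lift1_dehomog[of w] assms[of w] by (metis less_irrefl scaleR_scaleR)
  qed
  also have "\<dots> = append_coord (\<Sum>w\<in>W. (c w * w $ None) *\<^sub>R dehomog w) (\<Sum>w\<in>W. c w * w $ None)"
    by (simp add: vec_option_eq_iff)
  finally show ?thesis by (auto simp: vec_option_eq_iff vec_eq_iff)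
qed

text \<open>The condition \<open>R\<close> is invariant under positive scaling; one proof thus
  covers the closed simplex, with \<open>0 \<le> x\<close>, and its relative interior, with
  \<open>0 < x\<close>.\<close>

lemma dehomog_comb_iff:
  fixes W :: "(real ^ 'n::finite option) set"
  assumes pos: "\<And>w. w \<in> W \<Longrightarrow> w $ None > 0" and inj: "inj_on dehomog W"
    and R: "\<And>x h :: real. 0 < h \<Longrightarrow> R (x * h) \<longleftrightarrow> R x"
  shows "(\<exists>u. (\<forall>x\<in>dehomog ` W. R (u x)) \<and> sum u (dehomog ` W) = 1 \<and> (\<Sum>x\<in>dehomog ` W. u x *\<^sub>R x) = y) \<longleftrightarrow>
    (\<exists>c. (\<forall>w\<in>W. R (c w)) \<and> lift1 y = (\<Sum>w\<in>W. c w *\<^sub>R w))"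
proof -
  have iff: "lift1 y = (\<Sum>w\<in>W. c w *\<^sub>R w) \<longleftrightarrow>
    (\<Sum>w\<in>W. c w * w $ None) = 1 \<and> (\<Sum>w\<in>W. (c w * w $ None) *\<^sub>R dehomog w) = y" for c
    by (rule lift1_eq_comb_iff) (rule pos)
  show ?thesis unfolding iff
  proof
    assume "\<exists>u. (\<forall>x\<in>dehomog ` W. R (u x)) \<and> sum u (dehomog ` W) = 1 \<and> (\<Sum>x\<in>dehomog ` W. u x *\<^sub>R x) = y"
    then obtain u where u: "\<forall>x\<in>dehomog ` W. R (u x)" "sum u (dehomog ` W) = 1" "(\<Sum>x\<in>dehomog ` W. u x *\<^sub>R x) = y" by blast
    let ?c = "\<lambda>w. u (dehomog w) / w $ None"
    have c: "?c w * w $ None = u (dehomog w)" if "w \<in> W" for w using pos[OF that] by simp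
    have "R (?c w)" if "w \<in> W" for w using R[OF pos[OF that], of "?c w"] c[OF that] u(1) that by simp
    then show "\<exists>c. (\<forall>w\<in>W. R (c w)) \<and> (\<Sum>w\<in>W. c w * w $ None) = 1 \<and> (\<Sum>w\<in>W. (c w * w $ None) *\<^sub>R dehomog w) = y"
      using u(2,3) c by (intro exI[of _ ?c]) (simp add: sum.reindex[OF inj])
  next
    assume "\<exists>c. (\<forall>w\<in>W. R (c w)) \<and> (\<Sum>w\<in>W. c w * w $ None) = 1 \<and> (\<Sum>w\<in>W. (c w * w $ None) *\<^sub>R dehomog w) = y"
    then obtain c where c: "\<forall>w\<in>W. R (c w)" "(\<Sum>w\<in>W. c w * w $ None) = 1" "(\<Sum>w\<in>W. (c w * w $ None) *\<^sub>R dehomog w) = y" by blast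
    let ?u = "\<lambda>x. c (the_inv_into W dehomog x) * (the_inv_into W dehomog x) $ None"
    have "?u (dehomog w) = c w * w $ None" if "w \<in> W" for w using that inj by (simp add: the_inv_into_f_f)
    then show "\<exists>u. (\<forall>x\<in>dehomog ` W. R (u x)) \<and> sum u (dehomog ` W) = 1 \<and> (\<Sum>x\<in>dehomog ` W. u x *\<^sub>R x) = y"
      using c R pos by (intro exI[of _ ?u]) (simp add: sum.reindex[OF inj])
  qed
qed

lemma in_convex_hull_dehomog:
  fixes W :: "(real ^ 'n::finite option) set"
  assumes "finite W" and pos: "\<And>w. w \<in> W \<Longrightarrow> w $ None > 0" and inj: "inj_on dehomog W"
  shows "y \<in> convex hull (dehomog ` W) \<longleftrightarrow> (\<exists>c. (\<forall>w\<in>W. 0 \<le> c w) \<and> lift1 y = (\<Sum>w\<in>W. c w *\<^sub>R w))"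
  using dehomog_comb_iff[OF pos inj, of "\<lambda>x. 0 \<le> x" y] assms(1)
  by (simp add: convex_hull_finite zero_le_mult_iff)

lemma dehomog_independent:
  fixes W :: "(real ^ 'n::finite option) set"
  assumes ind: "independent W" and pos: "\<And>w. w \<in> W \<Longrightarrow> w $ None > 0"
  shows "inj_on dehomog W" "\<not> affine_dependent (dehomog ` W)"
proof -
  have fin: "finite W" using ind independent_imp_finite by blast
  show inj: "inj_on dehomog W"
  proof (rule inj_onI, rule ccontr)
    fix v w assume vw: "v \<in> W" "w \<in> W" "dehomog v = dehomog w" "v \<noteq> w"
    have "v = (v $ None / w $ None) *\<^sub>R w" 
      using lift1_dehomog[of v] lift1_dehomog[of w] pos vw
      by (metis divide_eq_eq less_irrefl scaleR_scaleR)
    then have "v \<in> span (W - {v})" using vw by (metis Diff_iff empty_iff insert_iff span_base span_scale)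
    then show False using ind vw(1) unfolding dependent_def by blast
  qed
  show "\<not> affine_dependent (dehomog ` W)"
  proof
    assume "affine_dependent (dehomog ` W)"
    then obtain u x where u: "sum u (dehomog ` W) = 0" "x \<in> dehomog ` W" "u x \<noteq> 0" "(\<Sum>v\<in>dehomog ` W. u v *\<^sub>R v) = 0"
      using affine_dependent_explicit_finite[of "dehomog ` W"] fin by auto
    have "append_coord 0 0 = (\<Sum>w\<in>W. (u (dehomog w) / w $ None) *\<^sub>R w)"
    proof (subst lift1_eq_comb_iff[OF pos])
      have "u (dehomog w) / w $ None * w $ None = u (dehomog w)" if "w \<in> W" for w using pos[OF that] by simp
      then show "(\<Sum>w\<in>W. u (dehomog w) / w $ None * w $ None) = 0 \<and>
        (\<Sum>w\<in>W. (u (dehomog w) / w $ None * w $ None) *\<^sub>R dehomog w) = 0"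
        using u(1,4) by (simp add: sum.reindex[OF inj])
    qed
    moreover have "append_coord 0 0 = (0 :: real ^ 'n option)" by (simp add: vec_option_eq_iff)
    ultimately have "(\<Sum>w\<in>W. (u (dehomog w) / w $ None) *\<^sub>R w) = 0" by simp
    then have "\<not> (\<exists>w\<in>W. u (dehomog w) / w $ None \<noteq> 0)"
      using ind dependent_finite[OF fin] by meson
    then show False using u(2,3) pos by force
  qed
qed

lemma in_rel_interior_dehomog:
  fixes W :: "(real ^ 'n::finite option) set"
  assumes ind: "independent W" and pos: "\<And>w. w \<in> W \<Longrightarrow> w $ None > 0"
  shows "y \<in> rel_interior (convex hull (dehomog ` W)) \<longleftrightarrow> (\<exists>c. (\<forall>w\<in>W. 0 < c w) \<and> lift1 y = (\<Sum>w\<in>W. c w *\<^sub>R w))"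
  using dehomog_comb_iff[OF pos dehomog_independent(1)[OF ind pos], of "\<lambda>x. 0 < x" y]
  by (simp add: rel_interior_convex_hull_explicit[OF dehomog_independent(2)[OF ind pos]] zero_less_mult_iff)

text \<open>No two terms have opposite signs, so the sum vanishes exactly when \<open>f\<close>
  vanishes on all of \<open>S\<close>, whatever the positive coefficients are. Hence
  \<open>f\<close> has one sign on a whole relatively open cone.\<close>

lemma sgn_positive_comb:
  fixes f :: "'a::real_inner"
  assumes "finite S" "\<And>w. w \<in> S \<Longrightarrow> 0 < c w" "\<And>w. w \<in> S \<Longrightarrow> 0 < d w"
    and sgn: "(\<forall>v\<in>S. 0 \<le> f \<bullet> v) \<or> (\<forall>v\<in>S. f \<bullet> v \<le> 0)"
  shows "sgn (f \<bullet> (\<Sum>w\<in>S. c w *\<^sub>R w)) = sgn (f \<bullet> (\<Sum>w\<in>S. d w *\<^sub>R w))"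
proof -
  have pos: "sgn (\<Sum>w\<in>S. e w * (g \<bullet> w)) = (if \<forall>w\<in>S. g \<bullet> w = 0 then 0 else 1)"
    if e: "\<And>w. w \<in> S \<Longrightarrow> 0 < e w" and g: "\<forall>v\<in>S. 0 \<le> g \<bullet> v" for e :: "'a \<Rightarrow> real" and g
  proof (cases "\<forall>w\<in>S. g \<bullet> w = 0")
    case False
    then obtain w where w: "w \<in> S" "g \<bullet> w \<noteq> 0" by blast
    then have "0 < e w * (g \<bullet> w)" using e[of w] g by (simp add: order_less_le)
    then have "0 < (\<Sum>w\<in>S. e w * (g \<bullet> w))"
      using w(1) e g assms(1) by (intro sum_pos2[of _ w]) (auto simp: less_imp_le)
    then show ?thesis using False by simp
  qed simp
  show ?thesis
  proof (cases "\<forall>v\<in>S. 0 \<le> f \<bullet> v")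
    case True
    then show ?thesis using pos[of c f] pos[of d f] assms by (simp add: inner_sum_right)
  next
    case False
    then have "\<forall>v\<in>S. 0 \<le> (- f) \<bullet> v" using sgn by auto
    then have "sgn (\<Sum>w\<in>S. c w * ((- f) \<bullet> w)) = sgn (\<Sum>w\<in>S. d w * ((- f) \<bullet> w))"
      using pos[of c "- f"] pos[of d "- f"] assms by simp
    then have "sgn (- (\<Sum>w\<in>S. c w * (f \<bullet> w))) = sgn (- (\<Sum>w\<in>S. d w * (f \<bullet> w)))"
      by (simp add: sum_negf)
    then show ?thesis by (simp add: inner_sum_right sgn_minus)
  qed
qed

lemma unimodular_family:
  fixes g \<psi> :: "'i::finite \<Rightarrow> real ^ 'm"
  assumes "\<And>i. integer_point (g i)" "\<And>i. integer_point (\<psi> i)"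
    and \<delta>: "\<And>i j. \<psi> i \<bullet> g j = (if j = i then 1 else 0)"
    and ex: "\<And>x. x = (\<Sum>i\<in>UNIV. (\<psi> i \<bullet> x) *\<^sub>R g i)"
  shows "inj g" "unimodular (range g)"
proof -
  show inj: "inj g"
  proof
    fix i j assume "g i = g j"
    then have "\<psi> i \<bullet> g j = 1" using \<delta>[of i i] by simp
    then show "i = j" using \<delta>[of i j] by (auto split: if_splits)
  qed
  have "dual_basis (range g) (\<lambda>w. \<psi> (inv g w))"
    unfolding dual_basis_def
    using assms(1,2) \<delta> ex by (auto simp: sum.reindex[OF inj] inv_f_f[OF inj] inj_eq[OF inj])
  then show "unimodular (range g)" unfolding unimodular_def by blast
qed

text \<open>The cone generated by \<open>(e\<^sub>i, 0)\<close> and \<open>(- N, \<dots>, - N, 1)\<close> consists of the points with \<open>x\<^sub>i \<ge> - N h\<close> and \<open>h \<ge> 0\<close>,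
  where \<open>h\<close> is the last coordinate.\<close>

lemma bounded_in_unimodular_cone:
  fixes P :: "(real ^ 'n) set"
  assumes "bounded P"
  obtains B where "unimodular B" "\<And>x. x \<in> P \<Longrightarrow> \<exists>c. fan_rep (Pow B) (lift1 x) c"
proof -
  obtain M where M: "\<And>x. x \<in> P \<Longrightarrow> norm x \<le> M" using assms unfolding bounded_iff by blast
  define N :: nat where "N = nat \<lceil>M\<rceil>"
  have N: "- real N \<le> x $ i" if "x \<in> P" for x i
  proof -
    have "\<bar>x $ i\<bar> \<le> M" using component_le_norm_cart[of x i] M[OF that] by simp
    also have "M \<le> real N" unfolding N_def by linarith
    finally show ?thesis by simp
  qed
  define g :: "'n option \<Rightarrow> real ^ 'n option" where
    "g j = (case j of None \<Rightarrow> append_coord (\<chi> i. - real N) 1 | Some i \<Rightarrow> axis (Some i) 1)" for j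
  define \<psi> :: "'n option \<Rightarrow> real ^ 'n option" where
    "\<psi> j = (case j of None \<Rightarrow> axis None 1 | Some i \<Rightarrow> axis (Some i) 1 + real N *\<^sub>R axis None 1)" for j
  have ax: "axis (Some i) 1 \<bullet> (x::real^'n option) = x $ Some i" "axis None 1 \<bullet> x = x $ None" for i x
    by (simp_all add: inner_axis')
  have ex: "x = (\<Sum>i\<in>UNIV. (\<psi> i \<bullet> x) *\<^sub>R g i)" for x
    unfolding vec_option_eq_iff
    by (auto simp: sum_UNIV_option \<psi>_def g_def ax axis_nth_if inner_add_left sum.distrib if_distrib[of "\<lambda>x. _ * x"] algebra_simps cong: if_cong)
  have "integer_point (g j)" "integer_point (\<psi> j)" for j
  proof -
    have "integer_point (append_coord (\<chi> i. - real N) 1 :: real ^ 'n option)"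
      unfolding integer_point_def by (metis (no_types) append_coord_nth Ints_1 Ints_minus Ints_of_nat not_None_eq vec_lambda_beta)
    then show "integer_point (g j)" "integer_point (\<psi> j)" by (auto simp: g_def \<psi>_def split: option.split)
  qed
  moreover have "\<psi> i \<bullet> g j = (if j = i then 1 else 0)" for i j
    by (auto simp: \<psi>_def g_def ax inner_add_left axis_nth_if split: option.split)
  ultimately have inj: "inj g" and uni: "unimodular (range g)" using unimodular_family[of g \<psi>] ex by auto
  show thesis
  proof (rule that[OF uni])
    fix x assume "x \<in> P"
    then have "0 \<le> \<psi> i \<bullet> lift1 x" for i
      using N[of x] by (auto simp: \<psi>_def ax inner_add_left split: option.split) (metis add.commute le_add_same_cancel1 neg_le_iff_le minus_le_iff diff_ge_0_iff_ge add.inverse_inverse diff_minus_eq_add)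
    then have "\<exists>d. fan_rep (Pow (range g)) (\<Sum>v\<in>range g. (\<psi> (inv g v) \<bullet> lift1 x) *\<^sub>R v) d"
      by (intro fan_rep_Pow) auto
    moreover have "(\<Sum>v\<in>range g. (\<psi> (inv g v) \<bullet> lift1 x) *\<^sub>R v) = lift1 x"
      using ex[of "lift1 x"] by (simp add: sum.reindex[OF inj] inv_f_f[OF inj])
    ultimately show "\<exists>c. fan_rep (Pow (range g)) (lift1 x) c" by simp
  qed
qed

text \<open>The set is a union of cells of the hyperplane arrangement given by \<open>F\<close>.
  This covers nonconvex sets, and for a fixed \<open>F\<close> these sets are closed under union and
  intersection.\<close>

definition sign_determined :: "(real ^ 'n option) set \<Rightarrow> (real ^ 'n) set \<Rightarrow> bool" where
  "sign_determined F P \<longleftrightarrow> finite F \<and> (\<forall>f\<in>F. integer_point f) \<and>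
     (\<forall>x\<in>P. \<forall>y. (\<forall>f\<in>F. sgn (f \<bullet> lift1 x) = sgn (f \<bullet> lift1 y)) \<longrightarrow> y \<in> P)"

text \<open>A point common to two simplexes has only one representation in the fan, and its support
  lies in both generator sets; so the simplexes meet in the simplex of their common generators.
  Keeping only simplexes inside \<open>P\<close> preserves closure under faces.\<close>

lemma fan_simplexes:
  fixes K :: "(real ^ 'n::finite option) set set"
  assumes K: "fan K" and P: "\<And>x. x \<in> P \<Longrightarrow> \<exists>S\<in>K. (\<forall>v\<in>S. v $ None > 0) \<and> convex hull (dehomog ` S) \<subseteq> P \<and> x \<in> convex hull (dehomog ` S)"
  shows "regular_triangulation {convex hull (dehomog ` S) | S. S \<in> K \<and> (\<forall>v\<in>S. v $ None > 0) \<and> convex hull (dehomog ` S) \<subseteq> P} P"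
    (is "regular_triangulation ?T P")
proof -
  have facts: "finite S" "independent S" "inj_on dehomog S" "\<not> affine_dependent (dehomog ` S)"
    if "S \<in> K" "\<forall>v\<in>S. v $ None > 0" for S
    using fanD(2,3)[OF K that(1)] unimodular_independent dehomog_independent[of S] that(2) by blast+
  have simp: "(int (card S) - 1) simplex (convex hull (dehomog ` S))" if "S \<in> K" "\<forall>v\<in>S. v $ None > 0" for S
    unfolding simplex_def using facts[OF that] by (intro exI[of _ "dehomog ` S"]) (auto simp: card_image)
  have vert: "vertices (convex hull (dehomog ` S)) = dehomog ` S" if "S \<in> K" "\<forall>v\<in>S. v $ None > 0" for S
    unfolding vertices_def using extreme_point_of_convex_hull_affine_independent[OF facts(4)[OF that]] by auto
  have "finite K" using fanD(1)[OF K] .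
  have int: "convex hull (dehomog ` S1) \<inter> convex hull (dehomog ` S2) = convex hull (dehomog ` (S1 \<inter> S2))"
    if S1: "S1 \<in> K" "\<forall>v\<in>S1. v $ None > 0" and S2: "S2 \<in> K" "\<forall>v\<in>S2. v $ None > 0" for S1 S2
  proof (intro equalityI subsetI)
    fix x assume "x \<in> convex hull (dehomog ` (S1 \<inter> S2))"
    then show "x \<in> convex hull (dehomog ` S1) \<inter> convex hull (dehomog ` S2)"
      by (meson IntI hull_mono image_mono inf.cobounded1 inf.cobounded2 subsetD)
  next
    have rep: "\<exists>c. fan_rep K (lift1 x) c \<and> {v. c v \<noteq> 0} \<subseteq> S" if x: "x \<in> convex hull (dehomog ` S)" and S: "S \<in> K" "\<forall>v\<in>S. v $ None > 0" for x S
    proof -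
      obtain c where c: "\<forall>w\<in>S. 0 \<le> c w" "lift1 x = (\<Sum>w\<in>S. c w *\<^sub>R w)"
        using x in_convex_hull_dehomog[of S x] facts[OF S] S(2) by blast
      let ?c = "\<lambda>v. if v \<in> S then c v else 0"
      have "lincomb ?c = lift1 x" unfolding c(2) by (subst lincomb_eq_sum[of S]) (use facts[OF S] in auto)
      moreover have "{v. ?c v \<noteq> 0} \<subseteq> S" by auto
      ultimately have "fan_rep K (lift1 x) ?c" "{v. ?c v \<noteq> 0} \<subseteq> S" 
        using c(1) fanD(4)[OF K S(1), of "{v. ?c v \<noteq> 0}"] by (auto simp: fan_rep_def)
      then show ?thesis by blast
    qed
    fix x assume "x \<in> convex hull (dehomog ` S1) \<inter> convex hull (dehomog ` S2)"
    then obtain c d where "fan_rep K (lift1 x) c" "{v. c v \<noteq> 0} \<subseteq> S1" "fan_rep K (lift1 x) d" "{v. d v \<noteq> 0} \<subseteq> S2"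
      using rep[of x S1] rep[of x S2] S1 S2 by blast
    then have c: "fan_rep K (lift1 x) c" "{v. c v \<noteq> 0} \<subseteq> S1 \<inter> S2" using fanD(5)[OF K] by blast+
    have S: "S1 \<inter> S2 \<in> K" "\<forall>v\<in>S1 \<inter> S2. v $ None > 0" using fanD(4)[OF K S1(1)] S1(2) by auto
    have "lift1 x = (\<Sum>v\<in>S1 \<inter> S2. c v *\<^sub>R v)"
      using c facts(1)[OF S] lincomb_eq_sum[of "S1 \<inter> S2" c] by (auto simp: fan_rep_def)
    then show "x \<in> convex hull (dehomog ` (S1 \<inter> S2))"
      using in_convex_hull_dehomog[of "S1 \<inter> S2" x] facts[OF S] S(2) c(1) by (auto simp: fan_rep_def)
  qed
  have "simplicial_complex ?T"
    unfolding simplicial_complex_def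
  proof (intro conjI ballI allI impI)
    show "finite ?T" using \<open>finite K\<close> by auto
    show "\<exists>n. n simplex S" if "S \<in> ?T" for S using that simp by blast
    show "F \<in> ?T" if SF: "S \<in> ?T \<and> F face_of S" for F S
    proof -
      obtain W where W: "S = convex hull (dehomog ` W)" "W \<in> K" "\<forall>v\<in>W. v $ None > 0" "S \<subseteq> P" using SF by blast
      then obtain c where "c \<subseteq> dehomog ` W" "F = convex hull c"
        using face_of_convex_hull_affine_independent[OF facts(4)[OF W(2,3)], of F] SF by blast
      then obtain W' where W': "W' \<subseteq> W" "F = convex hull (dehomog ` W')" by (metis subset_image_iff)
      moreover have "F \<subseteq> P" using SF W(4) face_of_imp_subset by blast
      moreover have "W' \<in> K" using fanD(4)[OF K W(2) W'(1)] .
      ultimately show ?thesis using W(3) by blast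
    qed
    show "S \<inter> S' face_of S" if SS: "S \<in> ?T \<and> S' \<in> ?T" for S S'
    proof -
      obtain W W' where W: "S = convex hull (dehomog ` W)" "W \<in> K" "\<forall>v\<in>W. v $ None > 0"
        and W': "S' = convex hull (dehomog ` W')" "W' \<in> K" "\<forall>v\<in>W'. v $ None > 0" using SS by blast
      show ?thesis unfolding W(1) W'(1) int[OF W(2,3) W'(2,3)]
        unfolding face_of_convex_hull_affine_independent[OF facts(4)[OF W(2,3)]]
        by (intro exI[of _ "dehomog ` (W \<inter> W')"]) auto
    qed
  qed
  moreover have "\<Union>?T = P" 
  proof (intro equalityI subsetI)
    fix x assume "x \<in> P"
    then show "x \<in> \<Union>?T" using P[of x] by blast
  qed blast
  moreover have "regular_simplex S" if ST: "S \<in> ?T" for S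
  proof -
    obtain W where W: "S = convex hull (dehomog ` W)" "W \<in> K" "\<forall>v\<in>W. v $ None > 0" using ST by blast
    note uni = fanD(2)[OF K W(2)]
    have "of_int_vec ` homog ` dehomog ` W = W"
      unfolding image_image using dehomog_primitive(3)[OF uni] W(3) by simp
    then have "part_of_int_basis (homog ` dehomog ` W)"
      using uni by (simp add: part_of_int_basis_iff_unimodular)
    then show ?thesis unfolding regular_simplex_def rational_simplex_def W(1) vert[OF W(2,3)]
      using simp[OF W(2,3)] dehomog_primitive(1)[OF uni] W(3) by blast
  qed
  ultimately show ?thesis unfolding regular_triangulation_def triangulates_def by blast
qed

text \<open>Once every \<open>f \<in> F\<close> has constant sign on each cone, the relatively open
  cone through \<open>lift1 x\<close> projects to points with the sign vector of \<open>x\<close>,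
  hence into \<open>P\<close>; closedness of \<open>P\<close> adds the boundary. The second
  conclusion records the constancy of signs, by which a simplex can be tested against further sets
  determined by \<open>F\<close>.\<close>

lemma regular_triangulation_exists:
  fixes P :: "(real ^ 'n) set"
  assumes "closed P" "bounded P" and F: "sign_determined F P"
  obtains T where "regular_triangulation T P"
    "\<And>S f x y. S \<in> T \<Longrightarrow> f \<in> F \<Longrightarrow> x \<in> rel_interior S \<Longrightarrow> y \<in> rel_interior S \<Longrightarrow>
       sgn (f \<bullet> lift1 x) = sgn (f \<bullet> lift1 y)"
proof -
  have finF: "finite F" "\<forall>f\<in>F. integer_point f" 
    and det: "\<And>x y. x \<in> P \<Longrightarrow> \<forall>f\<in>F. sgn (f \<bullet> lift1 x) = sgn (f \<bullet> lift1 y) \<Longrightarrow> y \<in> P"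
    using F unfolding sign_determined_def by blast+
  obtain B where B: "unimodular B" "\<And>x. x \<in> P \<Longrightarrow> \<exists>c. fan_rep (Pow B) (lift1 x) c"
    using bounded_in_unimodular_cone[OF assms(2)] by blast
  \<comment> \<open>The height form \<open>axis None 1\<close> is added to \<open>F\<close> so that
    no cone crosses height zero.\<close>
  obtain K where K: "fan K" "fan_refines K (Pow B)" and sgn: "\<forall>f\<in>insert (axis None 1) F. \<forall>S\<in>K. same_sign f S"
    using fan_refine_same_sign_finite[of "insert (axis None 1) F", OF _ fan_Pow[OF B(1)]] finF by auto
  have rep: "\<exists>c. fan_rep K (lift1 x) c" if "x \<in> P" for x
    using B(2)[OF that] fan_refinesD(1)[OF K(2)] by blast
  have ind: "independent S" "finite S" if "S \<in> K" for S
    using fanD(2,3)[OF K(1) that] unimodular_independent by auto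
  let ?T = "{convex hull (dehomog ` S) | S. S \<in> K \<and> (\<forall>v\<in>S. v $ None > 0) \<and> convex hull (dehomog ` S) \<subseteq> P}"
  have "\<exists>S\<in>K. (\<forall>v\<in>S. v $ None > 0) \<and> convex hull (dehomog ` S) \<subseteq> P \<and> x \<in> convex hull (dehomog ` S)" if x: "x \<in> P" for x
  proof -
    obtain c where c: "fan_rep K (lift1 x) c" using rep[OF x] by blast
    define S where "S = {v. c v \<noteq> 0}"
    have S: "S \<in> K" and cpos: "\<And>v. v \<in> S \<Longrightarrow> c v > 0" and lx: "lift1 x = (\<Sum>v\<in>S. c v *\<^sub>R v)"
      using c by (auto simp: fan_rep_def S_def lincomb_def order_less_le)
    have sg: "sgn (f \<bullet> lift1 x) = sgn (f \<bullet> (\<Sum>w\<in>S. d w *\<^sub>R w))"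
      if "f \<in> insert (axis None 1) F" "\<And>w. w \<in> S \<Longrightarrow> 0 < d w" for f d
    proof -
      have "same_sign f S" using sgn S that(1) by blast
      then show ?thesis
        unfolding lx using that(2) ind(2)[OF S] cpos by (intro sgn_positive_comb) (simp_all add: same_sign_def)
    qed
    have h1: "(\<Sum>v\<in>S. c v * v $ None) = 1"
    proof -
      have "(\<Sum>v\<in>S. c v * v $ None) = lift1 x $ None" unfolding lx by simp
      then show ?thesis by simp
    qed
    have hge: "0 \<le> v $ None" if "v \<in> S" for v
    proof (rule ccontr)
      assume "\<not> 0 \<le> v $ None"
      then have "\<forall>v\<in>S. v $ None \<le> 0" using sgn S that unfolding same_sign_def by (force simp: inner_axis')
      then have "(\<Sum>v\<in>S. c v * v $ None) \<le> 0" using cpos by (intro sum_nonpos) (auto simp: mult_nonneg_nonpos less_imp_le)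
      then show False using h1 by simp
    qed
    \<comment> \<open>A generator \<open>v\<close> at height zero would be a direction
      \<open>u\<close> in which \<open>x\<close> moves arbitrarily far without changing a sign,
      since only the coefficient of \<open>v\<close> grows. This contradicts boundedness of
      \<open>P\<close>.\<close>
    have hpos: "0 < v $ None" if v: "v \<in> S" for v
    proof (rule ccontr)
      assume "\<not> 0 < v $ None"
      then have v0: "v $ None = 0" using hge[OF v] by simp
      define u where "u = (\<chi> i. v $ Some i)"
      have "v \<noteq> 0" using ind(1)[OF S] v dependent_zero by blast
      then have "u \<noteq> 0" using v0 by (auto simp: u_def vec_option_eq_iff vec_eq_iff)
      have inP: "x + s *\<^sub>R u \<in> P" if "0 \<le> s" for s
      proof (rule det[OF x ballI])
        fix f assume f: "f \<in> F"
        have "lift1 (x + s *\<^sub>R u) = lift1 x + s *\<^sub>R v" using v0 by (simp add: vec_option_eq_iff u_def)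
        also have "\<dots> = (\<Sum>w\<in>S. (c w + (if w = v then s else 0)) *\<^sub>R w)"
          unfolding lx scaleR_left_distrib sum.distrib using v ind(2)[OF S]
          by (simp add: if_distrib[of "\<lambda>x. x *\<^sub>R _"] cong: if_cong)
        finally show "sgn (f \<bullet> lift1 x) = sgn (f \<bullet> lift1 (x + s *\<^sub>R u))"
          using sg[of f "\<lambda>w. c w + (if w = v then s else 0)"] f cpos that by (auto simp: add_pos_nonneg)
      qed
      obtain M where M: "\<And>y. y \<in> P \<Longrightarrow> norm y \<le> M" using assms(2) unfolding bounded_iff by blast
      \<comment> \<open>Chosen so that the moved point has norm at least
        \<open>M + 1\<close>.\<close>
      define s where "s = (M + norm x + 1) / norm u"
      have "0 \<le> M" using M[OF x] norm_ge_zero order_trans by blast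
      then have "0 \<le> s" by (simp add: s_def)
      have "norm (s *\<^sub>R u) \<le> norm (x + s *\<^sub>R u) + norm x" by (metis add.commute add_diff_cancel_left' norm_triangle_ineq4)
      moreover have "norm (s *\<^sub>R u) = M + norm x + 1" using \<open>u \<noteq> 0\<close> \<open>0 \<le> M\<close> by (simp add: s_def)
      ultimately show False using M[OF inP[OF \<open>0 \<le> s\<close>]] by simp
    qed
    have "rel_interior (convex hull (dehomog ` S)) \<subseteq> P"
    proof
      fix y assume "y \<in> rel_interior (convex hull (dehomog ` S))"
      then obtain d where d: "\<forall>w\<in>S. 0 < d w" "lift1 y = (\<Sum>w\<in>S. d w *\<^sub>R w)"
        using in_rel_interior_dehomog[OF ind(1)[OF S] hpos] by auto
      show "y \<in> P" by (rule det[OF x ballI]) (use sg d in auto)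
    qed
    then have "closure (rel_interior (convex hull (dehomog ` S))) \<subseteq> P" using assms(1) by (simp add: closure_minimal)
    then have "convex hull (dehomog ` S) \<subseteq> P"
      using closure_subset[of "convex hull (dehomog ` S)"]
      by (simp only: convex_closure_rel_interior[OF convex_convex_hull])
    moreover have "x \<in> rel_interior (convex hull (dehomog ` S))"
      using in_rel_interior_dehomog[OF ind(1)[OF S] hpos, of x] lx cpos by auto
    then have "x \<in> convex hull (dehomog ` S)" using rel_interior_subset by (rule rev_subsetD)
    ultimately show ?thesis using S hpos by blast
  qed
  then have T: "regular_triangulation ?T P" by (rule fan_simplexes[OF K(1)])
  show thesis
  proof (rule that[OF T])
    fix S f x y assume S: "S \<in> ?T" and f: "f \<in> F" and xy: "x \<in> rel_interior S" "y \<in> rel_interior S"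
    obtain W where W: "S = convex hull (dehomog ` W)" "W \<in> K" "\<forall>v\<in>W. v $ None > 0" using S by blast
    obtain c where "\<forall>w\<in>W. 0 < c w" "lift1 x = (\<Sum>w\<in>W. c w *\<^sub>R w)"
      using xy(1) in_rel_interior_dehomog[OF ind(1)[OF W(2)], of x] W(1,3) by auto
    moreover obtain d where "\<forall>w\<in>W. 0 < d w" "lift1 y = (\<Sum>w\<in>W. d w *\<^sub>R w)"
      using xy(2) in_rel_interior_dehomog[OF ind(1)[OF W(2)], of y] W(1,3) by auto
    moreover have "same_sign f W" using sgn f W(2) by blast
    ultimately show "sgn (f \<bullet> lift1 x) = sgn (f \<bullet> lift1 y)"
      using sgn_positive_comb[OF ind(2)[OF W(2)], of c d f] unfolding same_sign_def by simp
  qed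
qed

section \<open>Sets determined by signs of integer forms\<close>


text \<open>By the Leibniz formula. Taken with the rationals and with the integers, it serves
  Cramer's rule.\<close>

lemma det_closed:
  assumes S: "0 \<in> S" "\<And>x y. x \<in> S \<Longrightarrow> y \<in> S \<Longrightarrow> x + y \<in> S" "\<And>x y. x \<in> S \<Longrightarrow> y \<in> S \<Longrightarrow> x * y \<in> S" "1 \<in> S" "- 1 \<in> S"
    and A: "\<And>i j. A $ i $ j \<in> S"
  shows "det A \<in> S"
proof -
  have prod: "prod f X \<in> S" if "\<And>x. x \<in> X \<Longrightarrow> f x \<in> S" for f and X :: "'b set"
    using that by (induction X rule: infinite_finite_induct) (auto intro: S)
  have sum: "sum f X \<in> S" if "\<And>x. x \<in> X \<Longrightarrow> f x \<in> S" for f and X :: "('b \<Rightarrow> 'b) set"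
    using that by (induction X rule: infinite_finite_induct) (auto intro: S)
  have "of_int (sign p) \<in> S" for p :: "'b \<Rightarrow> 'b" using S by (simp add: sign_def)
  then show ?thesis unfolding det_def by (intro sum S(3) prod A)
qed

text \<open>Standard unit vectors complete \<open>W\<close> to a basis of rational vectors. The dual
  forms are the rows of the inverse matrix, which is rational by Cramer's rule.\<close>

lemma rational_dual_family:
  fixes W :: "(real ^ 'm) set"
  assumes ind: "independent W" and rat: "\<And>w. w \<in> W \<Longrightarrow> rational_point w"
  obtains g \<psi> :: "'m \<Rightarrow> real ^ 'm" where "inj g" "W \<subseteq> range g" "\<And>i. rational_point (\<psi> i)"
    "\<And>i j. \<psi> i \<bullet> g j = (if j = i then 1 else 0)" "\<And>x. x = (\<Sum>i\<in>UNIV. (\<psi> i \<bullet> x) *\<^sub>R g i)"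
proof -
  obtain B where B: "W \<subseteq> B" "B \<subseteq> W \<union> Basis" "independent B" "W \<union> Basis \<subseteq> span B"
    by (rule maximal_independent_subset_extend[of W "W \<union> Basis"]) (use ind in auto)
  have ratB: "rational_point w" if wB: "w \<in> B" for w
  proof (cases "w \<in> W")
    case False
    then obtain i where "w = axis i 1" using subsetD[OF B(2) wB] False by (auto simp: Basis_vec_def)
    then show ?thesis by (auto simp: rational_point_def axis_def)
  qed (rule rat)
  have "span B = UNIV" using B(4) by (metis span_Basis span_mono span_span sup.boundedE top.extremum_unique)
  then have "card B = CARD('m)" using basis_card_eq_dim[of B UNIV] B(3) by (simp add: dim_UNIV)
  moreover have "finite B" using B(3) independent_imp_finite by blast
  ultimately obtain g :: "'m \<Rightarrow> real ^ 'm" where g: "bij_betw g UNIV B"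
    using finite_same_card_bij[of "UNIV :: 'm set" B] by auto
  then have inj: "inj g" and rg: "range g = B" by (auto simp: bij_betw_def)
  define A :: "real ^ 'm ^ 'm" where "A = (\<chi> i j. g j $ i)"
  have col: "column j A = g j" for j by (simp add: column_def A_def vec_eq_iff)
  have "c i = 0" if "(\<Sum>i\<in>UNIV. c i *s column i A) = 0" for c i
  proof -
    have "(\<Sum>w\<in>B. c (inv g w) *\<^sub>R w) = 0"
      using that unfolding rg[symmetric] by (simp add: sum.reindex[OF inj] inv_f_f[OF inj] col scalar_mult_eq_scaleR)
    moreover have "\<not> (\<exists>u. (\<exists>v\<in>B. u v \<noteq> 0) \<and> (\<Sum>v\<in>B. u v *\<^sub>R v) = 0)"
      using B(3) dependent_finite[OF \<open>finite B\<close>] by simp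
    moreover have "g i \<in> B" using rg by blast
    ultimately have "c (inv g (g i)) = 0" by meson
    then show ?thesis by (simp add: inv_f_f[OF inj])
  qed
  then obtain R where RA: "R ** A = mat 1" using matrix_left_invertible_independent_columns[of A] by blast
  then have AR: "A ** R = mat 1" by (simp add: matrix_left_right_inverse)
  have detA: "det A \<noteq> 0" using RA invertible_left_inverse invertible_det_nz by blast
  have ratA: "A $ i $ j \<in> \<rat>" for i j using ratB[of "g j"] rg by (auto simp: A_def rational_point_def)
  have ratR: "R $ j $ k \<in> \<rat>" for j k
  proof -
    have "A *v (R *v axis k 1) = axis k 1" by (simp add: matrix_vector_mul_assoc AR)
    then have "R *v axis k 1 = (\<chi> j. det (\<chi> i l. if l = j then axis k 1 $ i else A $ i $ l) / det A)"
      by (simp add: cramer[OF detA])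
    then have "R $ j $ k = det (\<chi> i l. if l = j then axis k 1 $ i else A $ i $ l) / det A"
      by (metis (no_types, lifting) column_def matrix_vector_mult_basis vec_lambda_beta)
    moreover have "det A \<in> \<rat>" by (rule det_closed) (use ratA in auto)
    moreover have "det (\<chi> i l. if l = j then axis k 1 $ i else A $ i $ l) \<in> \<rat>"
      by (rule det_closed) (use ratA in \<open>auto simp: axis_def\<close>)
    ultimately show ?thesis by simp
  qed
  show thesis
  proof (rule that[of g "\<lambda>j. R $ j"])
    show "inj g" "W \<subseteq> range g" using inj rg B by auto
    show "rational_point (R $ i)" for i using ratR by (simp add: rational_point_def)
    have Rx: "R $ i \<bullet> x = (R *v x) $ i" for i x by (simp add: matrix_vector_mul_component)
    show "R $ i \<bullet> g j = (if j = i then 1 else 0)" for i j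
    proof -
      have "R *v (A *v axis j 1) = axis j 1" by (simp add: matrix_vector_mul_assoc RA)
      then have "R *v g j = axis j 1" by (simp add: matrix_vector_mult_basis col)
      then show ?thesis by (simp add: Rx axis_def)
    qed
    show "x = (\<Sum>i\<in>UNIV. (R $ i \<bullet> x) *\<^sub>R g i)" for x
    proof -
      have "x = A *v (R *v x)" by (simp add: matrix_vector_mul_assoc AR)
      also have "\<dots> = (\<Sum>i\<in>UNIV. (R $ i \<bullet> x) *\<^sub>R g i)"
        by (simp add: matrix_mult_sum[of A] col scalar_mult_eq_scaleR Rx)
      finally show ?thesis .
    qed
  qed
qed

text \<open>Multiplying a form by its common denominator, a positive number, makes it integral and
  keeps its signs.\<close>

lemma sign_determined_scale:
  assumes "finite I" "\<And>i. i \<in> I \<Longrightarrow> rational_point (f i)"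
    and "\<And>x y. x \<in> P \<Longrightarrow> (\<And>i. i \<in> I \<Longrightarrow> sgn (f i \<bullet> lift1 x) = sgn (f i \<bullet> lift1 y)) \<Longrightarrow> y \<in> P"
  shows "sign_determined ((\<lambda>i. real (den (f i)) *\<^sub>R f i) ` I) P"
  unfolding sign_determined_def
proof (intro conjI ballI allI impI)
  show "finite ((\<lambda>i. real (den (f i)) *\<^sub>R f i) ` I)" using assms by simp
  show "integer_point g" if "g \<in> (\<lambda>i. real (den (f i)) *\<^sub>R f i) ` I" for g
    using that assms(2) by (auto simp: integer_point_def intro!: den_works(2))
  fix x y assume x: "x \<in> P"
    and eq: "\<forall>f\<in>(\<lambda>i. real (den (f i)) *\<^sub>R f i) ` I. sgn (f \<bullet> lift1 x) = sgn (f \<bullet> lift1 y)"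
  show "y \<in> P"
  proof (rule assms(3)[OF x])
    fix i assume i: "i \<in> I"
    then have "0 < den (f i)" using den_works assms(2) by blast
    then show "sgn (f i \<bullet> lift1 x) = sgn (f i \<bullet> lift1 y)" using eq i by (auto simp: sgn_mult)
  qed
qed

lemma sign_determined_mono: 
  assumes "sign_determined F P" "finite G" "F \<subseteq> G" "\<forall>f\<in>G. integer_point f" shows "sign_determined G P"
  using assms unfolding sign_determined_def by blast

lemma sign_determinedD: "sign_determined F P \<Longrightarrow> finite F" "sign_determined F P \<Longrightarrow> f \<in> F \<Longrightarrow> integer_point f"
  unfolding sign_determined_def by blast+

lemma sign_determined_Un_left:
  "sign_determined F P \<Longrightarrow> sign_determined G Q \<Longrightarrow> sign_determined (F \<union> G) P"
  by (rule sign_determined_mono) (auto dest: sign_determinedD)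

text \<open>More forms mean a stronger hypothesis of equal signs, so the forms of all members can be
  pooled.\<close>

lemma sign_determined_Union:
  assumes "finite A" "\<And>S. S \<in> A \<Longrightarrow> \<exists>F. sign_determined F S"
  shows "\<exists>F. sign_determined F (\<Union>A)"
proof -
  obtain F where F: "\<And>S. S \<in> A \<Longrightarrow> sign_determined (F S) S" using assms(2) by metis
  let ?G = "\<Union>S\<in>A. F S"
  have fin: "finite ?G" "\<forall>f\<in>?G. integer_point f" using F assms(1) sign_determinedD by blast+
  have "sign_determined ?G S" if "S \<in> A" for S
    by (rule sign_determined_mono[OF F[OF that]]) (use fin that in auto)
  then have "sign_determined ?G (\<Union>A)" using fin unfolding sign_determined_def by blast
  then show ?thesis by blast
qed

lemma sign_determined_Int:
  assumes "sign_determined F P" "sign_determined F Q" 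
  shows "sign_determined F (P \<inter> Q)"
  using assms unfolding sign_determined_def by blast

lemma sign_determined_Un:
  assumes "sign_determined F P" "sign_determined F Q" 
  shows "sign_determined F (P \<union> Q)"
  using assms unfolding sign_determined_def by blast

section \<open>Rational simplexes through barycentric coordinates\<close>

lemma simplex_vertices:
  assumes "k simplex S"
  shows "\<not> affine_dependent (vertices S)" "int (card (vertices S)) = k + 1" "S = convex hull vertices S"
    "finite (vertices S)"
proof -
  obtain C where C: "\<not> affine_dependent C" "int (card C) = k + 1" "S = convex hull C"
    using assms unfolding simplex_def by blast
  then have "vertices S = C" unfolding vertices_def using extreme_point_of_convex_hull_affine_independent by blast
  then show "\<not> affine_dependent (vertices S)" "int (card (vertices S)) = k + 1" "S = convex hull vertices S"
    "finite (vertices S)"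
    using C aff_independent_finite by auto
qed

lemma vertices_convex_hull: "\<not> affine_dependent C \<Longrightarrow> vertices (convex hull C) = C"
  unfolding vertices_def using extreme_point_of_convex_hull_affine_independent by blast

lemma dehomog_lift1_simp [simp]: "dehomog (lift1 x) = x"
  using dehomog_lift1[of 1 x] by simp

lemma independent_lift1:
  assumes "\<not> affine_dependent C"
  shows "independent (lift1 ` C)"
proof -
  have fin: "finite C" using assms aff_independent_finite by blast
  have inj: "inj_on lift1 C" by (auto simp: inj_on_def)
  have "u v = 0" if "(\<Sum>v\<in>lift1 ` C. u v *\<^sub>R v) = 0" "v \<in> lift1 ` C" for u v
  proof -
    have z: "(\<Sum>x\<in>C. u (lift1 x) *\<^sub>R lift1 x) = 0" using that(1) by (simp add: sum.reindex[OF inj])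
    then have "(\<Sum>x\<in>C. u (lift1 x)) = 0" "(\<Sum>x\<in>C. u (lift1 x) *\<^sub>R x) = 0"
      by (simp_all add: vec_option_eq_iff) (simp add: vec_eq_iff)
    then show ?thesis using assms that(2) unfolding affine_dependent_explicit_finite[OF fin] by auto
  qed
  then show ?thesis using fin by (subst dependent_finite) auto
qed

text \<open>Once the lifted vertices are completed to a basis, the dual forms are barycentric
  coordinates. A point lies in the simplex when those of the vertices are nonnegative and the others
  vanish, which depends on signs only.\<close>

lemma rational_simplex_sign_determined:
  assumes "rational_simplex S"
  shows "\<exists>F. sign_determined F S"
proof -
  define C where "C = vertices S"
  obtain k where k: "k simplex S" and rat: "\<forall>v\<in>C. rational_point v" using assms unfolding rational_simplex_def C_def by blast
  note C = simplex_vertices[OF k, folded C_def]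
  define W where "W = lift1 ` C"
  have ind: "independent W" by (rule independent_lift1[OF C(1), folded W_def])
  have ratW: "rational_point w" if wW: "w \<in> W" for w
  proof -
    obtain x where "w = lift1 x" "x \<in> C" using wW unfolding W_def by blast
    then show ?thesis using rat unfolding rational_point_def by (auto simp: append_coord_def split: option.split)
  qed
  obtain g \<psi> :: "'a option \<Rightarrow> real ^ 'a option" where g: "inj g" "W \<subseteq> range g" and rat\<psi>: "\<And>i. rational_point (\<psi> i)"
    and \<delta>: "\<And>i j. \<psi> i \<bullet> g j = (if j = i then 1 else 0)" and ex: "\<And>x. x = (\<Sum>i\<in>UNIV. (\<psi> i \<bullet> x) *\<^sub>R g i)"
    by (rule rational_dual_family[OF ind ratW]) (assumption, rule that, assumption+)
  have finW: "finite W" using C(4) by (simp add: W_def)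
  have coeff: "\<psi> i \<bullet> (\<Sum>w\<in>W. c w *\<^sub>R w) = (if g i \<in> W then c (g i) else 0)" for c i
  proof -
    have "\<psi> i \<bullet> (\<Sum>w\<in>W. c w *\<^sub>R w) = (\<Sum>w\<in>W. if w = g i then c w else 0)"
      unfolding inner_sum_right by (intro sum.cong[OF refl]) (use g \<delta> inj_eq[OF g(1)] in auto)
    then show ?thesis using finW by simp
  qed
  have mem: "y \<in> S \<longleftrightarrow> (\<forall>i. if g i \<in> W then 0 \<le> \<psi> i \<bullet> lift1 y else \<psi> i \<bullet> lift1 y = 0)" for y
  proof -
    have S: "S = convex hull (dehomog ` W)" using C(3) by (simp add: image_image W_def)
    have "y \<in> S \<longleftrightarrow> (\<exists>c. (\<forall>w\<in>W. 0 \<le> c w) \<and> lift1 y = (\<Sum>w\<in>W. c w *\<^sub>R w))"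
      unfolding S by (rule in_convex_hull_dehomog) (use C(4) in \<open>auto simp: inj_on_def W_def\<close>)
    also have "\<dots> \<longleftrightarrow> (\<forall>i. if g i \<in> W then 0 \<le> \<psi> i \<bullet> lift1 y else \<psi> i \<bullet> lift1 y = 0)"
    proof
      assume R: "\<forall>i. if g i \<in> W then 0 \<le> \<psi> i \<bullet> lift1 y else \<psi> i \<bullet> lift1 y = 0"
      have "lift1 y = (\<Sum>i\<in>UNIV. (\<psi> i \<bullet> lift1 y) *\<^sub>R g i)" by (rule ex)
      also have "\<dots> = (\<Sum>i\<in>{i. g i \<in> W}. (\<psi> i \<bullet> lift1 y) *\<^sub>R g i)"
        using R by (intro sum.mono_neutral_right) auto
      also have "\<dots> = (\<Sum>w\<in>g ` {i. g i \<in> W}. (\<psi> (inv g w) \<bullet> lift1 y) *\<^sub>R w)"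
        by (simp add: sum.reindex[OF inj_on_subset[OF g(1)]] inv_f_f[OF g(1)])
      also have "g ` {i. g i \<in> W} = W" using g(2) by auto
      finally have "lift1 y = (\<Sum>w\<in>W. (\<psi> (inv g w) \<bullet> lift1 y) *\<^sub>R w)" .
      moreover have "0 \<le> \<psi> (inv g w) \<bullet> lift1 y" if "w \<in> W" for w
        using R[rule_format, of "inv g w"] that g(2) f_inv_into_f[of w g UNIV] by auto
      ultimately show "\<exists>c. (\<forall>w\<in>W. 0 \<le> c w) \<and> lift1 y = (\<Sum>w\<in>W. c w *\<^sub>R w)"
        by (intro exI[of _ "\<lambda>w. \<psi> (inv g w) \<bullet> lift1 y"] conjI ballI)
    next
      assume "\<exists>c. (\<forall>w\<in>W. 0 \<le> c w) \<and> lift1 y = (\<Sum>w\<in>W. c w *\<^sub>R w)"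
      then obtain c where c: "\<forall>w\<in>W. 0 \<le> c w" "lift1 y = (\<Sum>w\<in>W. c w *\<^sub>R w)" by blast
      show "\<forall>i. if g i \<in> W then 0 \<le> \<psi> i \<bullet> lift1 y else \<psi> i \<bullet> lift1 y = 0"
        unfolding c(2) coeff using c(1) by simp
    qed
    finally show ?thesis .
  qed
  have "sign_determined ((\<lambda>i. real (den (\<psi> i)) *\<^sub>R \<psi> i) ` UNIV) S"
  proof (rule sign_determined_scale)
    fix x y assume "x \<in> S" and eq: "\<And>i. i \<in> UNIV \<Longrightarrow> sgn (\<psi> i \<bullet> lift1 x) = sgn (\<psi> i \<bullet> lift1 y)"
    have sgnD: "0 \<le> r \<longleftrightarrow> 0 \<le> s" "r = 0 \<longleftrightarrow> s = 0" if "sgn r = sgn s" for r s :: real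
      using that by (auto simp: sgn_if split: if_splits)
    have "if g i \<in> W then 0 \<le> \<psi> i \<bullet> lift1 y else \<psi> i \<bullet> lift1 y = 0" for i
      using \<open>x \<in> S\<close>[unfolded mem, rule_format, of i] sgnD[OF eq[of i, OF UNIV_I]] by (cases "g i \<in> W") simp_all
    then show "y \<in> S" unfolding mem by (rule allI)
  qed (use rat\<psi> in auto)
  then show ?thesis by blast
qed

lemma rational_polyhedronD:
  assumes "rational_polyhedron P"
  shows "closed P" "bounded P" "\<exists>F. sign_determined F P"
proof -
  obtain A where A: "finite A" "\<forall>S\<in>A. rational_simplex S" "P = \<Union>A" using assms unfolding rational_polyhedron_def by blast
  have "compact S" if "S \<in> A" for S using A(2) that compact_simplex unfolding rational_simplex_def by blast
  then have "compact P" unfolding A(3) using A(1) by (intro compact_Union) auto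
  then show "closed P" "bounded P" by (auto simp: compact_eq_bounded_closed)
  show "\<exists>F. sign_determined F P"
    unfolding A(3) using A(1,2) by (intro sign_determined_Union rational_simplex_sign_determined) auto
qed

section \<open>Counting lattice points\<close>


text \<open>Multiplicities are positive, not just nonnegative, because they describe a relatively
  open cone; \<open>a v\<close> plays the role of the height of the generator
  \<open>v\<close>.\<close>

definition weighted_tuples :: "'a set \<Rightarrow> ('a \<Rightarrow> nat) \<Rightarrow> nat \<Rightarrow> ('a \<Rightarrow> nat) set" where
  "weighted_tuples V a t = {k \<in> V \<rightarrow>\<^sub>E {1..}. (\<Sum>v\<in>V. k v * a v) \<le> t}"

lemma finite_weighted_tuples:
  assumes "finite V" "\<And>v. v \<in> V \<Longrightarrow> 0 < a v"
  shows "finite (weighted_tuples V a t)"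
proof (rule finite_subset)
  show "weighted_tuples V a t \<subseteq> V \<rightarrow>\<^sub>E {..t}"
  proof
    fix k assume k: "k \<in> weighted_tuples V a t"
    have "k v \<le> t" if "v \<in> V" for v
    proof -
      have "k v \<le> k v * a v" using assms(2)[OF that] by simp
      also have "\<dots> \<le> (\<Sum>v\<in>V. k v * a v)" using that assms(1) by (intro member_le_sum) auto
      finally show ?thesis using k by (simp add: weighted_tuples_def)
    qed
    then show "k \<in> V \<rightarrow>\<^sub>E {..t}" using k by (auto simp: weighted_tuples_def PiE_iff)
  qed
  show "finite (V \<rightarrow>\<^sub>E {..t})" using assms(1) by (intro finite_PiE) auto
qed

text \<open>Tuples with \<open>k w = 1\<close> correspond to tuples on \<open>V\<close>, and from
  the others one copy of \<open>w\<close> is removed. Either way \<open>a w\<close> is taken off the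
  bound.\<close>

lemma card_weighted_tuples_insert:
  assumes V: "finite V" "w \<notin> V" "\<And>v. v \<in> insert w V \<Longrightarrow> 0 < a v"
  shows "t < a w \<Longrightarrow> weighted_tuples (insert w V) a t = {}"
    and "a w \<le> t \<Longrightarrow> card (weighted_tuples (insert w V) a t) =
      card (weighted_tuples V a (t - a w)) + card (weighted_tuples (insert w V) a (t - a w))"
proof -
  have sum: "(\<Sum>v\<in>insert w V. k v * a v) = k w * a w + (\<Sum>v\<in>V. k v * a v)" for k
    using V by simp
  have sumw: "(\<Sum>v\<in>V. (k(w := n)) v * a v) = (\<Sum>v\<in>V. k v * a v)" for k n
    using V(2) by (intro sum.cong) auto
  show "weighted_tuples (insert w V) a t = {}" if "t < a w"
  proof -
    have False if k: "k \<in> weighted_tuples (insert w V) a t" for k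
    proof -
      have "1 \<le> k w" using k by (auto simp: weighted_tuples_def PiE_iff)
      then have "1 * a w \<le> k w * a w" by (rule mult_right_mono) simp
      moreover have "k w * a w + (\<Sum>v\<in>V. k v * a v) \<le> t" using k by (simp add: weighted_tuples_def sum)
      ultimately show False using \<open>t < a w\<close> by linarith
    qed
    then show ?thesis by blast
  qed
  assume t: "a w \<le> t"
  let ?A = "{k \<in> weighted_tuples (insert w V) a t. k w = 1}"
  let ?B = "{k \<in> weighted_tuples (insert w V) a t. k w \<noteq> 1}"
  have "bij_betw (\<lambda>k. k(w := undefined)) ?A (weighted_tuples V a (t - a w))"
  proof (rule bij_betwI[where g = "\<lambda>k. k(w := 1)"])
    show "(\<lambda>k. k(w := undefined)) \<in> ?A \<rightarrow> weighted_tuples V a (t - a w)"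
      using V t by (auto simp: weighted_tuples_def sum PiE_iff extensional_def) (subst sumw[unfolded fun_upd_def], simp)
    show "(\<lambda>k. k(w := 1)) \<in> weighted_tuples V a (t - a w) \<rightarrow> ?A"
      using V t sumw by (auto simp: weighted_tuples_def sum PiE_iff extensional_def)
  qed (use V(2) in \<open>auto simp: weighted_tuples_def PiE_iff extensional_def fun_eq_iff\<close>)
  then have A: "card ?A = card (weighted_tuples V a (t - a w))" by (rule bij_betw_same_card)
  have "bij_betw (\<lambda>k. k(w := k w - 1)) ?B (weighted_tuples (insert w V) a (t - a w))"
  proof (rule bij_betwI[where g = "\<lambda>k. k(w := k w + 1)"])
    show "(\<lambda>k. k(w := k w - 1)) \<in> ?B \<rightarrow> weighted_tuples (insert w V) a (t - a w)"
    proof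
      fix k assume k: "k \<in> ?B"
      then have "k w \<ge> 2" by (auto simp: weighted_tuples_def PiE_iff)
      then obtain m where m: "k w = Suc m" "1 \<le> m" by (metis Suc_le_D Suc_le_mono One_nat_def numeral_2_eq_2)
      then show "k(w := k w - 1) \<in> weighted_tuples (insert w V) a (t - a w)"
        using k V t sumw[of k "k w - 1"] by (auto simp: weighted_tuples_def sum PiE_iff extensional_def)
    qed
    show "(\<lambda>k. k(w := k w + 1)) \<in> weighted_tuples (insert w V) a (t - a w) \<rightarrow> ?B"
    proof
      fix k assume k: "k \<in> weighted_tuples (insert w V) a (t - a w)"
      then show "k(w := k w + 1) \<in> ?B"
        using V t sumw[of k "k w + 1"] by (auto simp: weighted_tuples_def sum PiE_iff extensional_def)
    qed
  qed (auto simp: weighted_tuples_def PiE_iff fun_eq_iff)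
  then have B: "card ?B = card (weighted_tuples (insert w V) a (t - a w))" by (rule bij_betw_same_card)
  have "weighted_tuples (insert w V) a t = ?A \<union> ?B" by auto
  moreover have "finite ?A" "finite ?B" using finite_weighted_tuples[of "insert w V" a t] V by auto
  ultimately show "card (weighted_tuples (insert w V) a t) =
      card (weighted_tuples V a (t - a w)) + card (weighted_tuples (insert w V) a (t - a w))"
    using A B card_Un_disjoint[of ?A ?B] by auto
qed

text \<open>Together with the next lemma this bounds the increment of \<open>x ^ Suc r\<close> by
  its derivative at the two ends of the interval, which replaces integration in the counts.\<close>

lemma power_Suc_add_ge:
  fixes x a :: real assumes "0 \<le> x" "0 \<le> a"
  shows "x ^ Suc r + real (Suc r) * a * x ^ r \<le> (x + a) ^ Suc r"
proof (induction r)
  case (Suc r)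
  have "x ^ Suc (Suc r) + real (Suc (Suc r)) * a * x ^ Suc r
      \<le> x ^ Suc (Suc r) + real (Suc (Suc r)) * a * x ^ Suc r + real (Suc r) * a\<^sup>2 * x ^ r"
    using assms by simp
  also have "\<dots> = (x ^ Suc r + real (Suc r) * a * x ^ r) * (x + a)"
    by (simp add: algebra_simps power2_eq_square)
  also have "\<dots> \<le> (x + a) ^ Suc r * (x + a)" using Suc assms by (intro mult_right_mono) auto
  finally show ?case by (simp add: mult.commute)
qed simp

lemma power_Suc_add_le:
  fixes x a :: real assumes "0 \<le> x" "0 \<le> a"
  shows "(x + a) ^ Suc r \<le> x ^ Suc r + real (Suc r) * a * (x + a) ^ r"
proof (induction r)
  case (Suc r)
  have "(x + a) ^ Suc (Suc r) = (x + a) ^ Suc r * (x + a)" by simp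
  also have "\<dots> \<le> (x ^ Suc r + real (Suc r) * a * (x + a) ^ r) * (x + a)"
    using Suc assms by (intro mult_right_mono) auto
  also have "\<dots> = x ^ Suc (Suc r) + a * x ^ Suc r + real (Suc r) * a * (x + a) ^ Suc r"
    by (simp add: algebra_simps)
  also have "\<dots> \<le> x ^ Suc (Suc r) + a * (x + a) ^ Suc r + real (Suc r) * a * (x + a) ^ Suc r"
    using assms by (intro add_mono mult_left_mono power_mono) auto
  finally show ?case by (simp add: algebra_simps)
qed simp

text \<open>The bounds are volumes: the unit cubes with upper corners at the tuples lie in the
  simplex of nonnegative points of weighted sum at most \<open>t\<close>, and cover the one where
  \<open>t\<close> is lowered by the sum of all weights. The proof uses the recurrence, by induction
  on \<open>V\<close> and then on \<open>t\<close> in steps of \<open>a w\<close>. The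
  \<open>max\<close> cuts off negative numbers, whose even powers would be positive.\<close>

lemma card_weighted_tuples_bounds:
  assumes "finite V" "\<And>v. v \<in> V \<Longrightarrow> 0 < a v"
  shows "real (card (weighted_tuples V a t)) \<le> real t ^ card V / (fact (card V) * real (\<Prod>v\<in>V. a v))"
    and "max 0 (real t - real (\<Sum>v\<in>V. a v)) ^ card V / (fact (card V) * real (\<Prod>v\<in>V. a v)) \<le> real (card (weighted_tuples V a t))"
proof -
  have "real (card (weighted_tuples V a t)) \<le> real t ^ card V / (fact (card V) * real (\<Prod>v\<in>V. a v)) \<and>
     max 0 (real t - real (\<Sum>v\<in>V. a v)) ^ card V / (fact (card V) * real (\<Prod>v\<in>V. a v)) \<le> real (card (weighted_tuples V a t))"
    using assms
  proof (induction V arbitrary: t rule: finite_induct)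
    case empty
    have "weighted_tuples {} a t = {\<lambda>_. undefined}" by (simp add: weighted_tuples_def)
    then show ?case by simp
  next
    case (insert w V)
    define r p s where "r = card V" and "p = real (\<Prod>v\<in>V. a v)" and "s = real (\<Sum>v\<in>V. a v)"
    have aw: "0 < a w" and p: "0 < p" using insert.prems by (auto simp: p_def intro!: prod_pos)
    have IH: "real (card (weighted_tuples V a t)) \<le> real t ^ r / (fact r * p)"
      "max 0 (real t - s) ^ r / (fact r * p) \<le> real (card (weighted_tuples V a t))" for t
      unfolding r_def p_def s_def using insert.IH[of t] insert.prems by auto
    have eqs: "card (insert w V) = Suc r" "real (\<Prod>v\<in>insert w V. a v) = real (a w) * p" "real (\<Sum>v\<in>insert w V. a v) = real (a w) + s"
      using insert by (auto simp: r_def p_def s_def)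
    have den: "x ^ r / (fact r * p) = real (Suc r) * real (a w) * x ^ r / (fact (Suc r) * (real (a w) * p))" for x
      using aw p by (simp add: fact_Suc mult.assoc del: of_nat_Suc)
    have nn: "0 < fact (Suc r) * (real (a w) * p)" using aw p by simp
    show ?case unfolding eqs
    proof (induction t rule: less_induct)
      case (less t)
      show ?case
      proof (cases "t < a w")
        case True
        have "0 \<le> s" unfolding s_def by (rule of_nat_0_le_iff)
        then have "max 0 (real t - (real (a w) + s)) = 0" using True by simp
        moreover have "weighted_tuples (insert w V) a t = {}"
          using card_weighted_tuples_insert(1)[of V w a t] insert True by simp
        ultimately show ?thesis using p by simp
      next
        case False
        then have t: "a w \<le> t" by simp
        define u where "u = t - a w"
        have tu: "t = u + a w" "u < t" using t aw by (auto simp: u_def)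
        have rec: "card (weighted_tuples (insert w V) a t) = card (weighted_tuples V a u) + card (weighted_tuples (insert w V) a u)"
          using card_weighted_tuples_insert(2)[of V w a t] insert t by (simp add: u_def)
        note IHu = less.IH[OF tu(2)]
        have "real (card (weighted_tuples (insert w V) a t)) \<le> real u ^ r / (fact r * p) + real u ^ Suc r / (fact (Suc r) * (real (a w) * p))"
          unfolding rec using IH(1)[of u] IHu by simp
        also have "\<dots> = (real u ^ Suc r + real (Suc r) * real (a w) * real u ^ r) / (fact (Suc r) * (real (a w) * p))"
          unfolding den by (simp only: add_divide_distrib add.commute)
        also have "\<dots> \<le> real t ^ Suc r / (fact (Suc r) * (real (a w) * p))"
          using power_Suc_add_ge[of "real u" "real (a w)" r] nn unfolding tu(1) by (intro divide_right_mono) auto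
        finally have U: "real (card (weighted_tuples (insert w V) a t)) \<le> real t ^ Suc r / (fact (Suc r) * (real (a w) * p))" .
        define y where "y = max 0 (real u - s)"
        have y0: "0 \<le> y" by (simp add: y_def)
        have y: "max 0 (real t - (real (a w) + s)) = y" "max 0 (real u - (real (a w) + s)) = max 0 (y - real (a w))"
          using aw by (auto simp: y_def tu(1))
        \<comment> \<open>For \<open>y\<close> below \<open>a w\<close> the last term vanishes, and
          \<open>y ^ Suc r\<close> is at most \<open>a w * y ^ r\<close>.\<close>
        have "y ^ Suc r \<le> real (Suc r) * real (a w) * y ^ r + max 0 (y - real (a w)) ^ Suc r"
        proof (cases "y \<ge> real (a w)")
          case True
          then show ?thesis using power_Suc_add_le[of "y - real (a w)" "real (a w)" r] by simp
        next
          case False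
          have "y ^ Suc r \<le> real (a w) * y ^ r" using False y0 by (simp add: mult_right_mono)
          also have "\<dots> \<le> real (Suc r) * (real (a w) * y ^ r)" using mult_right_mono[of 1 "real (Suc r)" "real (a w) * y ^ r"] y0 by simp
          finally show ?thesis using False by simp
        qed
        then have "y ^ Suc r / (fact (Suc r) * (real (a w) * p)) \<le> y ^ r / (fact r * p) + max 0 (y - real (a w)) ^ Suc r / (fact (Suc r) * (real (a w) * p))"
          unfolding den add_divide_distrib[symmetric] using nn by (intro divide_right_mono) auto
        also have "\<dots> \<le> real (card (weighted_tuples (insert w V) a t))"
          unfolding rec using IH(2)[of u] IHu y by (simp add: y_def)
        finally show ?thesis using U y by simp
      qed
    qed
  qed
  then show "real (card (weighted_tuples V a t)) \<le> real t ^ card V / (fact (card V) * real (\<Prod>v\<in>V. a v))"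
    "max 0 (real t - real (\<Sum>v\<in>V. a v)) ^ card V / (fact (card V) * real (\<Prod>v\<in>V. a v)) \<le> real (card (weighted_tuples V a t))"
    by blast+
qed

lemma card_weighted_tuples_asymp:
  assumes "finite V" "\<And>v. v \<in> V \<Longrightarrow> 0 < a v"
  shows "(\<lambda>t. real (card (weighted_tuples V a t)) / real t ^ card V) \<longlonglongrightarrow> 1 / (fact (card V) * real (\<Prod>v\<in>V. a v))"
proof (rule tendsto_sandwich)
  define r s C where "r = card V" and "s = real (\<Sum>v\<in>V. a v)" and "C = 1 / (fact (card V) * real (\<Prod>v\<in>V. a v))"
  have C: "x / (fact (card V) * real (\<Prod>v\<in>V. a v)) = C * x" for x by (simp add: C_def)
  show "eventually (\<lambda>t. C * (max 0 (1 - s / real t)) ^ r \<le> real (card (weighted_tuples V a t)) / real t ^ card V) sequentially"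
    using eventually_gt_at_top[of 0]
  proof eventually_elim
    case (elim t)
    have "max 0 (1 - s / real t) = max 0 (real t - s) / real t" using elim by (auto simp: max_def field_simps)
    then have "C * (max 0 (1 - s / real t)) ^ r = C * max 0 (real t - s) ^ r / real t ^ r" by (simp add: power_divide)
    also have "\<dots> \<le> real (card (weighted_tuples V a t)) / real t ^ r"
      using card_weighted_tuples_bounds(2)[OF assms(1), of a t, OF assms(2)] unfolding C s_def r_def by (intro divide_right_mono) auto
    finally show ?case by (simp add: r_def)
  qed
  show "eventually (\<lambda>t. real (card (weighted_tuples V a t)) / real t ^ card V \<le> C) sequentially"
    using eventually_gt_at_top[of 0]
  proof eventually_elim
    case (elim t)
    then show ?case using card_weighted_tuples_bounds(1)[OF assms(1), of a t, OF assms(2)] unfolding C by (simp add: divide_le_eq)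
  qed
  have "(\<lambda>t. C * (max 0 (1 - s / real t)) ^ r) \<longlonglongrightarrow> C * (max 0 (1 - 0)) ^ r"
    by (intro tendsto_intros lim_const_over_n)
  then show "(\<lambda>t. C * (max 0 (1 - s / real t)) ^ r) \<longlonglongrightarrow> C" by simp
qed simp

text \<open>Fractions need not be reduced: every positive multiple of a homogeneous correspondent up
  to height \<open>t\<close> is counted.\<close>

definition lattice_points :: "(real ^ 'n) set \<Rightarrow> nat \<Rightarrow> (real ^ 'n option) set" where
  "lattice_points P t = {z. integer_point z \<and> 0 < z $ None \<and> z $ None \<le> real t \<and> dehomog z \<in> P}"

lemma finite_integer_points:
  fixes S :: "(real ^ 'm) set"
  assumes "bounded S" shows "finite {z \<in> S. integer_point z}"
proof -
  obtain M where M: "\<And>x. x \<in> S \<Longrightarrow> norm x \<le> M" using assms unfolding bounded_iff by blast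
  let ?f = "\<lambda>z :: real ^ 'm. \<lambda>i. \<lfloor>z $ i\<rfloor>"
  have "?f ` {z \<in> S. integer_point z} \<subseteq> UNIV \<rightarrow>\<^sub>E {- \<lceil>M\<rceil>..\<lceil>M\<rceil>}"
  proof (rule image_subsetI)
    fix z assume z: "z \<in> {z \<in> S. integer_point z}"
    have "\<lfloor>z $ i\<rfloor> \<in> {- \<lceil>M\<rceil>..\<lceil>M\<rceil>}" for i
    proof -
      have "\<bar>z $ i\<bar> \<le> M" using component_le_norm_cart[of z i] M[of z] z by simp
      then have "- \<lceil>M\<rceil> \<le> \<lfloor>z $ i\<rfloor>" "\<lfloor>z $ i\<rfloor> \<le> \<lceil>M\<rceil>" by linarith+
      then show ?thesis by simp
    qed
    then show "?f z \<in> UNIV \<rightarrow>\<^sub>E {- \<lceil>M\<rceil>..\<lceil>M\<rceil>}" by blast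
  qed
  moreover have "finite (UNIV \<rightarrow>\<^sub>E {- \<lceil>M\<rceil>..\<lceil>M\<rceil>} :: ('m \<Rightarrow> int) set)" by (intro finite_PiE) auto
  ultimately have "finite (?f ` {z \<in> S. integer_point z})" by (rule finite_subset)
  moreover have "inj_on ?f {z \<in> S. integer_point z}"
  proof (rule inj_onI)
    fix x y assume "x \<in> {z \<in> S. integer_point z}" "y \<in> {z \<in> S. integer_point z}" "?f x = ?f y"
    then have "x $ i = y $ i" for i unfolding fun_eq_iff by (metis (mono_tags) integer_point_def of_int_floor mem_Collect_eq)
    then show "x = y" by (simp add: vec_eq_iff)
  qed
  ultimately show ?thesis by (rule finite_imageD)
qed

lemma finite_lattice_points:
  fixes P :: "(real ^ 'n) set"
  assumes "bounded P" shows "finite (lattice_points P t)"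
proof -
  obtain M where M: "\<And>x. x \<in> P \<Longrightarrow> norm x \<le> M" using assms unfolding bounded_iff by blast
  have "norm z \<le> (\<Sum>i\<in>(UNIV :: 'n option set). real t * (\<bar>M\<bar> + 1))" if z: "z \<in> lattice_points P t" for z
  proof -
    have pos: "0 < z $ None" "z $ None \<le> real t" and P: "dehomog z \<in> P" using z by (auto simp: lattice_points_def)
    have "norm (z $ i) \<le> real t * (\<bar>M\<bar> + 1)" for i
    proof (cases i)
      case None
      have "z $ None * 1 \<le> real t * (\<bar>M\<bar> + 1)" using pos by (intro mult_mono) auto
      then show ?thesis using None pos by simp
    next
      case (Some j)
      have "\<bar>dehomog z $ j\<bar> \<le> \<bar>M\<bar> + 1" using component_le_norm_cart[of "dehomog z" j] M[OF P] by simp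
      then have "z $ None * \<bar>dehomog z $ j\<bar> \<le> real t * (\<bar>M\<bar> + 1)" using pos by (intro mult_mono) auto
      moreover have "\<bar>z $ Some j\<bar> = z $ None * \<bar>dehomog z $ j\<bar>" using pos by (simp add: dehomog_def)
      ultimately show ?thesis using Some by simp
    qed
    then have "\<bar>z $ i\<bar> \<le> real t * (\<bar>M\<bar> + 1)" for i by simp
    from order_trans[OF norm_le_l1_cart sum_mono[OF this]] show ?thesis .
  qed
  then have "bounded (lattice_points P t)" unfolding bounded_iff by blast
  from finite_integer_points[OF this] show ?thesis
    by (rule rev_finite_subset) (auto simp: lattice_points_def)
qed

text \<open>The dual forms turn integrality of a lattice point into integrality of its coefficients,
  and relative interior means that these are positive. For \<open>W = {}\<close> the empty tuple
  would be counted although there is no point.\<close>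

lemma card_lattice_points_rel_interior:
  fixes W :: "(real ^ 'n::finite option) set"
  assumes W: "unimodular W" "W \<noteq> {}" and pos: "\<And>w. w \<in> W \<Longrightarrow> w $ None > 0"
  defines "a \<equiv> \<lambda>w. nat \<lfloor>w $ None\<rfloor>"
  shows "card (lattice_points (rel_interior (convex hull (dehomog ` W))) t) = card (weighted_tuples W a t)"
    and "\<And>w. w \<in> W \<Longrightarrow> real (a w) = w $ None"
proof -
  have fin: "finite W" and ind: "independent W" using W unimodular_finite unimodular_independent by auto
  show a: "real (a w) = w $ None" if "w \<in> W" for w
    using unimodular_integer[OF W(1) that] pos[OF that] by (simp add: a_def integer_point_def)
  obtain \<phi> where \<phi>: "\<forall>w\<in>W. integer_point (\<phi> w)" 
    "\<forall>w\<in>W. \<forall>T c. T \<subseteq> W \<longrightarrow> \<phi> w \<bullet> (\<Sum>v\<in>T. c v *\<^sub>R v) = (if w \<in> T then c w else 0)"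
    using unimodular_dual[OF W(1)] by blast
  have \<phi>': "\<phi> w \<bullet> (\<Sum>v\<in>W. c v *\<^sub>R v) = c w" if "w \<in> W" for w c
    using \<phi>(2)[rule_format, OF that order_refl] that by simp
  have mem: "dehomog z \<in> rel_interior (convex hull (dehomog ` W)) \<longleftrightarrow> (\<exists>c. (\<forall>w\<in>W. 0 < c w) \<and> z = (\<Sum>w\<in>W. c w *\<^sub>R w))"
    if z: "0 < z $ None" for z
  proof -
    have lz: "lift1 (dehomog z) = (1 / z $ None) *\<^sub>R z" using lift1_dehomog[of z] z
      by (metis (no_types, lifting) less_irrefl nonzero_eq_divide_eq scaleR_one scaleR_scaleR)
    show ?thesis unfolding in_rel_interior_dehomog[OF ind pos, simplified] lz
    proof
      assume "\<exists>c. (\<forall>w\<in>W. 0 < c w) \<and> (1 / z $ None) *\<^sub>R z = (\<Sum>w\<in>W. c w *\<^sub>R w)"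
      then obtain c where c: "\<forall>w\<in>W. 0 < c w" "(1 / z $ None) *\<^sub>R z = (\<Sum>w\<in>W. c w *\<^sub>R w)" by blast
      have "z = z $ None *\<^sub>R ((1 / z $ None) *\<^sub>R z)" using z by simp
      also have "\<dots> = (\<Sum>w\<in>W. (z $ None * c w) *\<^sub>R w)" unfolding c(2) by (simp add: scaleR_sum_right)
      finally show "\<exists>c. (\<forall>w\<in>W. 0 < c w) \<and> z = (\<Sum>w\<in>W. c w *\<^sub>R w)" using c(1) z by (intro exI[of _ "\<lambda>w. z $ None * c w"]) simp
    next
      assume "\<exists>c. (\<forall>w\<in>W. 0 < c w) \<and> z = (\<Sum>w\<in>W. c w *\<^sub>R w)"
      then obtain c where c: "\<forall>w\<in>W. 0 < c w" "z = (\<Sum>w\<in>W. c w *\<^sub>R w)" by blast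
      have "(1 / z $ None) *\<^sub>R z = (\<Sum>w\<in>W. (1 / z $ None * c w) *\<^sub>R w)" 
        by (subst (2) c(2)) (simp add: scaleR_sum_right)
      then show "\<exists>c. (\<forall>w\<in>W. 0 < c w) \<and> (1 / z $ None) *\<^sub>R z = (\<Sum>w\<in>W. c w *\<^sub>R w)" 
        using c(1) z by (intro exI[of _ "\<lambda>w. 1 / z $ None * c w"]) simp
    qed
  qed
  have "bij_betw (\<lambda>k. \<Sum>w\<in>W. real (k w) *\<^sub>R w) (weighted_tuples W a t) (lattice_points (rel_interior (convex hull (dehomog ` W))) t)"
  proof (rule bij_betw_imageI)
    show "inj_on (\<lambda>k. \<Sum>w\<in>W. real (k w) *\<^sub>R w) (weighted_tuples W a t)"
    proof (rule inj_onI)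
      fix k l assume kl: "k \<in> weighted_tuples W a t" "l \<in> weighted_tuples W a t" "(\<Sum>w\<in>W. real (k w) *\<^sub>R w) = (\<Sum>w\<in>W. real (l w) *\<^sub>R w)"
      have "k w = l w" if "w \<in> W" for w
        using \<phi>'[OF that, of "\<lambda>w. real (k w)"] \<phi>'[OF that, of "\<lambda>w. real (l w)"] kl(3) by simp
      then show "k = l" using kl(1,2) by (auto simp: weighted_tuples_def intro: PiE_ext)
    qed
    have height: "(\<Sum>w\<in>W. real (k w) *\<^sub>R w) $ None = real (\<Sum>w\<in>W. k w * a w)" for k
      using a by (simp)
    show "(\<lambda>k. \<Sum>w\<in>W. real (k w) *\<^sub>R w) ` weighted_tuples W a t = lattice_points (rel_interior (convex hull (dehomog ` W))) t"
    proof (intro equalityI subsetI)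
      fix z assume "z \<in> (\<lambda>k. \<Sum>w\<in>W. real (k w) *\<^sub>R w) ` weighted_tuples W a t"
      then obtain k where k: "k \<in> weighted_tuples W a t" "z = (\<Sum>w\<in>W. real (k w) *\<^sub>R w)" by blast
      have k1: "1 \<le> k w" if "w \<in> W" for w using k(1) that by (auto simp: weighted_tuples_def PiE_iff)
      have h: "z $ None = (\<Sum>w\<in>W. real (k w) * w $ None)" unfolding k(2) by simp
      have h0: "0 < z $ None" unfolding h using fin W(2) k1 pos by (intro sum_pos mult_pos_pos) (auto simp: Suc_le_eq)
      moreover have "z $ None \<le> real t" unfolding k(2) height using k(1) unfolding weighted_tuples_def of_nat_le_iff by blast
      moreover have "integer_point z" unfolding k(2) using unimodular_integer[OF W(1)] by (intro integer_point_sum) auto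
      moreover have "dehomog z \<in> rel_interior (convex hull (dehomog ` W))"
        unfolding mem[OF h0] using k1 k(2) by (intro exI[of _ "\<lambda>w. real (k w)"]) (auto simp: Suc_le_eq)
      ultimately show "z \<in> lattice_points (rel_interior (convex hull (dehomog ` W))) t" by (simp add: lattice_points_def)
    next
      fix z assume z: "z \<in> lattice_points (rel_interior (convex hull (dehomog ` W))) t"
      then have h0: "0 < z $ None" and ht: "z $ None \<le> real t" and iz: "integer_point z" by (auto simp: lattice_points_def)
      obtain c where c: "\<forall>w\<in>W. 0 < c w" "z = (\<Sum>w\<in>W. c w *\<^sub>R w)" 
        using z mem[OF h0] by (auto simp: lattice_points_def)
      define k where "k = restrict (\<lambda>w. nat \<lfloor>c w\<rfloor>) W"
      have ck: "c w = real (k w)" "1 \<le> k w" if w: "w \<in> W" for w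
      proof -
        have "c w \<in> \<int>" using \<phi>'[OF w, of c] \<phi>(1) w iz integer_point_inner unfolding c(2) by metis
        then obtain m where "c w = of_int m" by (auto elim: Ints_cases)
        then show "c w = real (k w)" "1 \<le> k w" using c(1) w by (auto simp: k_def)
      qed
      have z': "z = (\<Sum>w\<in>W. real (k w) *\<^sub>R w)" unfolding c(2) using ck by (intro sum.cong) auto
      have "real (\<Sum>w\<in>W. k w * a w) \<le> real t" using ht unfolding z' height .
      then have "(\<Sum>w\<in>W. k w * a w) \<le> t" unfolding of_nat_le_iff .
      moreover have "k \<in> extensional W" unfolding k_def by (rule restrict_extensional)
      then have "k \<in> W \<rightarrow>\<^sub>E {1..}" using ck(2) unfolding PiE_iff by simp
      ultimately have "k \<in> weighted_tuples W a t" unfolding weighted_tuples_def by simp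
      then show "z \<in> (\<lambda>k. \<Sum>w\<in>W. real (k w) *\<^sub>R w) ` weighted_tuples W a t" using z' by blast
    qed
  qed
  then show "card (lattice_points (rel_interior (convex hull (dehomog ` W))) t) = card (weighted_tuples W a t)"
    by (rule bij_betw_same_card[symmetric])
qed

lemma regular_simplex_cone:
  assumes "regular_simplex S"
  obtains W where "unimodular W" "\<And>w. w \<in> W \<Longrightarrow> w $ None > 0" "dehomog ` W = vertices S" "inj_on dehomog W"
    "\<And>w. w \<in> W \<Longrightarrow> w $ None = real (den (dehomog w))"
proof -
  let ?W = "of_int_vec ` homog ` vertices S"
  have W: "unimodular ?W" and rat: "\<And>v. v \<in> vertices S \<Longrightarrow> rational_point v"
    using assms unfolding regular_simplex_def rational_simplex_def part_of_int_basis_iff_unimodular by auto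
  have h: "of_int_vec (homog v) = real (den v) *\<^sub>R lift1 v" "0 < den v" if "v \<in> vertices S" for v
    using of_int_vec_homog[OF rat[OF that]] den_works[OF rat[OF that]] by auto
  have d: "dehomog (of_int_vec (homog v)) = v" if "v \<in> vertices S" for v
    using dehomog_lift1[of "real (den v)" v] h[OF that] by simp
  show thesis
  proof (rule that[OF W])
    show "w $ None > 0" if "w \<in> ?W" for w using that h by auto
    show "dehomog ` ?W = vertices S" using d by (auto simp: image_iff)
    show "inj_on dehomog ?W" using d by (auto simp: inj_on_def)
    show "w $ None = real (den (dehomog w))" if "w \<in> ?W" for w using that d h by auto
  qed
qed

lemma card_lattice_points_regular_simplex:
  assumes S: "regular_simplex S" "int e simplex S"
  shows "(\<lambda>t. real (card (lattice_points (rel_interior S) t)) / real t ^ Suc e) \<longlonglongrightarrow> 1 / (fact (Suc e) * real (simplex_den S))"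
proof -
  obtain W where W: "unimodular W" "\<And>w. w \<in> W \<Longrightarrow> w $ None > 0" "dehomog ` W = vertices S" "inj_on dehomog W"
    and den: "\<And>w. w \<in> W \<Longrightarrow> w $ None = real (den (dehomog w))" using regular_simplex_cone[OF S(1)] by blast
  note V = simplex_vertices[OF S(2)]
  have cW: "card W = Suc e" using V(2) W(3,4) card_image by fastforce
  then have "W \<noteq> {}" by auto
  note c = card_lattice_points_rel_interior[OF W(1) this W(2), simplified]
  let ?a = "\<lambda>w. nat \<lfloor>w $ None\<rfloor>"
  have "simplex_den S = (\<Prod>w\<in>W. den (dehomog w))" unfolding simplex_den_def W(3)[symmetric] by (simp add: prod.reindex[OF W(4)])
  then have d: "real (simplex_den S) = real (\<Prod>w\<in>W. ?a w)" using den by simp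
  have "0 < ?a w" if "w \<in> W" for w using c(2)[OF that] W(2)[OF that] by linarith
  from card_weighted_tuples_asymp[OF unimodular_finite[OF W(1)] this]
  have "(\<lambda>t. real (card (weighted_tuples W ?a t)) / real t ^ Suc e) \<longlonglongrightarrow> 1 / (fact (Suc e) * real (simplex_den S))"
    unfolding cW d .
  then show ?thesis unfolding c(1)[symmetric] W(3) V(3)[symmetric] .
qed

text \<open>A point outside the relative interior lies in a proper face, of smaller dimension. If
  two relative interiors meet, the common face contains an interior point of each simplex and is
  therefore all of both.\<close>

lemma simplicial_complex_rel_interior_partition:
  assumes T: "simplicial_complex T"
  shows "\<Union>T = \<Union>(rel_interior ` T)" "disjoint_family_on rel_interior T"
proof -
  have T': "finite T" "\<And>S. S \<in> T \<Longrightarrow> \<exists>n. n simplex S" "\<And>F S. S \<in> T \<Longrightarrow> F face_of S \<Longrightarrow> F \<in> T"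
    "\<And>S S'. S \<in> T \<Longrightarrow> S' \<in> T \<Longrightarrow> S \<inter> S' face_of S"
    using T unfolding simplicial_complex_def by blast+
  have "x \<in> \<Union>(rel_interior ` T)" if x: "x \<in> S" "S \<in> T" for x S
    using x
  \<comment> \<open>Shifted by one because the empty simplex has dimension
    \<open>-1\<close>.\<close>
  proof (induction "nat (aff_dim S + 1)" arbitrary: S rule: less_induct)
    case less
    show ?case
    proof (cases "x \<in> rel_interior S")
      case False
      have "convex S" "closed S" "polyhedron S"
        using T'(2)[OF less.prems(2)] convex_simplex closed_simplex simplex_imp_polyhedron by blast+
      then have "x \<in> \<Union>{F. F face_of S \<and> F \<noteq> S}"
        using False less.prems(1) rel_frontier_of_polyhedron_alt[OF \<open>polyhedron S\<close>] \<open>closed S\<close>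
        by (auto simp: rel_frontier_def)
      then obtain F where F: "F face_of S" "F \<noteq> S" "x \<in> F" by blast
      have "aff_dim F < aff_dim S" by (rule face_of_aff_dim_lt[OF \<open>convex S\<close> F(1,2)])
      moreover have "-1 \<le> aff_dim F" by (simp add: aff_dim_geq)
      ultimately show ?thesis using less.hyps[of F] F T'(3)[OF less.prems(2) F(1)] by simp
    qed (use less in blast)
  qed
  then show "\<Union>T = \<Union>(rel_interior ` T)" using rel_interior_subset by blast
  show "disjoint_family_on rel_interior T"
    unfolding disjoint_family_on_def
  proof (intro ballI impI, rule ccontr)
    fix S S' assume S: "S \<in> T" "S' \<in> T" "S \<noteq> S'" "rel_interior S \<inter> rel_interior S' \<noteq> {}"
    have sub: "U \<subseteq> U'" if "U \<in> T" "U' \<in> T" "rel_interior U \<inter> rel_interior U' \<noteq> {}" for U U'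
    proof -
      have "U \<inter> U' \<inter> rel_interior U \<noteq> {}" using that(3) rel_interior_subset by fastforce
      then show ?thesis using subset_of_face_of[OF T'(4)[OF that(1,2)] order_refl] by blast
    qed
    then show False using S sub[of S S'] sub[of S' S] by blast
  qed
qed

lemma power_ratio_tendsto_0:
  assumes "(\<lambda>t. f t / real t ^ a) \<longlonglongrightarrow> L" "a < b"
  shows "(\<lambda>t. f t / real t ^ b) \<longlonglongrightarrow> 0"
proof -
  have "(\<lambda>t. 1 / real t ^ (b - a)) \<longlonglongrightarrow> 0"
    using assms(2) LIMSEQ_inverse_realpow_zero tendsto_power[OF lim_inverse_n, of "b - a"]
    by (simp add: power_0_left inverse_eq_divide power_one_over)
  from tendsto_mult[OF assms(1) this] have "(\<lambda>t. f t / real t ^ a * (1 / real t ^ (b - a))) \<longlonglongrightarrow> 0" by simp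
  moreover have "f t / real t ^ a * (1 / real t ^ (b - a)) = f t / real t ^ b" for t
  proof -
    have "real t ^ b = real t ^ a * real t ^ (b - a)" using assms(2) by (simp flip: power_add)
    then show ?thesis by simp
  qed
  ultimately show ?thesis by (simp only:)
qed

text \<open>The relatively open simplexes partition \<open>P\<close>. Those of dimension below
  \<open>d\<close> are counted by a smaller power of \<open>t\<close> and vanish in the
  limit.\<close>

lemma lattice_points_regular_triangulation:
  assumes T: "regular_triangulation T P" and dim: "\<And>S. S \<in> T \<Longrightarrow> aff_dim S \<le> int d"
  shows "(\<lambda>t. real (card (lattice_points P t)) / real t ^ Suc d) \<longlonglongrightarrow>
    (\<Sum>S | S \<in> T \<and> int d simplex S. 1 / (fact (Suc d) * real (simplex_den S)))"
proof -
  have sc: "simplicial_complex T" and UT: "\<Union>T = P" and reg: "\<And>S. S \<in> T \<Longrightarrow> regular_simplex S"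
    using T unfolding regular_triangulation_def triangulates_def by auto
  have fin: "finite T" and simp: "\<And>S. S \<in> T \<Longrightarrow> \<exists>n. n simplex S" using sc unfolding simplicial_complex_def by blast+
  note part = simplicial_complex_rel_interior_partition[OF sc]
  have bdd: "bounded (rel_interior S)" if "S \<in> T" for S
    using simp[OF that] compact_simplex rel_interior_subset bounded_subset compact_imp_bounded by metis
  have card: "card (lattice_points P t) = (\<Sum>S\<in>T. card (lattice_points (rel_interior S) t))" for t
  proof -
    have "lattice_points P t = (\<Union>S\<in>T. lattice_points (rel_interior S) t)"
      unfolding UT[symmetric] part(1) lattice_points_def by blast
    then show ?thesis using fin finite_lattice_points[OF bdd] part(2)
      by (simp add: card_UN_disjoint disjoint_family_on_def lattice_points_def disjoint_iff)
  qed
  have lim: "(\<lambda>t. real (card (lattice_points (rel_interior S) t)) / real t ^ Suc d) \<longlonglongrightarrow>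
     (if int d simplex S then 1 / (fact (Suc d) * real (simplex_den S)) else 0)" if S: "S \<in> T" for S
  proof -
    obtain n where n: "n simplex S" using simp[OF S] by blast
    have nd: "n \<le> int d" "-1 \<le> n" using dim[OF S] aff_dim_simplex[OF n] simplex_dim_ge[OF n] by auto
    show ?thesis
    proof (cases "n = -1")
      case True
      then have "S = {}" using n by simp
      then show ?thesis by (simp add: lattice_points_def)
    next
      case False
      then obtain e where e: "n = int e" using nd(2) by (metis add.commute add_0 int_nat_eq nat_0_le not_le zle_add1_eq_le dual_order.antisym uminus_add_conv_diff diff_add_cancel zless_add1_eq)
      note L = card_lattice_points_regular_simplex[OF reg[OF S] n[unfolded e]]
      show ?thesis
      proof (cases "e = d")
        case True then show ?thesis using L n e by simp
      next
        case False
        then have "e < d" using nd e by simp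
        moreover have "\<not> int d simplex S" using False e aff_dim_simplex[OF n] aff_dim_simplex[of "int d" S] by auto
        ultimately show ?thesis using power_ratio_tendsto_0[OF L, of "Suc d"] by simp
      qed
    qed
  qed
  have "(\<lambda>t. \<Sum>S\<in>T. real (card (lattice_points (rel_interior S) t)) / real t ^ Suc d) \<longlonglongrightarrow>
     (\<Sum>S\<in>T. if int d simplex S then 1 / (fact (Suc d) * real (simplex_den S)) else 0)"
    by (intro tendsto_sum lim)
  moreover have "(\<Sum>S\<in>T. real (card (lattice_points (rel_interior S) t)) / real t ^ Suc d) = real (card (lattice_points P t)) / real t ^ Suc d" for t
    by (simp add: card sum_divide_distrib)
  moreover have "(\<Sum>S\<in>T. if int d simplex S then 1 / (fact (Suc d) * real (simplex_den S)) else 0) = (\<Sum>S | S \<in> T \<and> int d simplex S. 1 / (fact (Suc d) * real (simplex_den S)))"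
    using fin by (simp add: sum.inter_filter del: fact_Suc)
  ultimately show ?thesis by (simp only:)
qed

section \<open>The rational measure as a counting limit\<close>


text \<open>Removing a closed set of smaller dimension from a relatively open set leaves a dense
  relatively open set with the same affine hull. So finitely many such sets can be removed in turn
  without emptying it.\<close>

lemma open_not_covered_by_lower_dim:
  fixes R :: "'a::euclidean_space set"
  assumes "finite M" "R \<noteq> {}" "openin (top_of_set (affine hull R)) R"
    "\<And>S. S \<in> M \<Longrightarrow> closed S" "\<And>S. S \<in> M \<Longrightarrow> aff_dim S < aff_dim R"
  shows "\<not> R \<subseteq> \<Union>M"
  using assms
proof (induction M arbitrary: R rule: finite_induct)
  case (insert S M)
  have cl: "closure (R - S) = closure R"
    by (rule dense_complement_openin_affine_hull) (use insert.prems in auto)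
  then have ne: "R - S \<noteq> {}" using insert.prems(1) closure_eq_empty by metis
  have "openin (top_of_set (affine hull R)) (R - S)"
    using insert.prems(2,3) by (simp add: Diff_eq openin_Int_open open_Compl)
  moreover from this have h: "affine hull (R - S) = affine hull R" by (rule affine_hull_openin) (rule ne)
  then have "aff_dim (R - S) = aff_dim R" by (metis aff_dim_affine_hull)
  ultimately have "\<not> R - S \<subseteq> \<Union>M" using insert.IH[of "R - S"] ne h insert.prems by auto
  then show ?case by blast
qed simp

lemma simplicial_complexD:
  assumes "simplicial_complex T"
  shows "finite T" "S \<in> T \<Longrightarrow> \<exists>n. n simplex S" "S \<in> T \<Longrightarrow> F face_of S \<Longrightarrow> F \<in> T"
    "S \<in> T \<Longrightarrow> S' \<in> T \<Longrightarrow> S \<inter> S' face_of S" "S \<in> T \<Longrightarrow> convex S" "S \<in> T \<Longrightarrow> closed S" "S \<in> T \<Longrightarrow> aff_dim S simplex S"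
proof -
  show "finite T" "S \<in> T \<Longrightarrow> F face_of S \<Longrightarrow> F \<in> T"
    "S \<in> T \<Longrightarrow> S' \<in> T \<Longrightarrow> S \<inter> S' face_of S" and *: "S \<in> T \<Longrightarrow> \<exists>n. n simplex S"
    using assms unfolding simplicial_complex_def by blast+
  show "S \<in> T \<Longrightarrow> convex S" "S \<in> T \<Longrightarrow> closed S" using * convex_simplex closed_simplex by blast+
  show "S \<in> T \<Longrightarrow> aff_dim S simplex S" using * aff_dim_simplex by metis
qed

lemma simplicial_complex_rel_interior_subset:
  assumes "simplicial_complex T" "S \<in> T" "S' \<in> T" "x \<in> rel_interior S" "x \<in> S'"
  shows "S \<subseteq> S'"
proof -
  have "(S \<inter> S') \<inter> rel_interior S \<noteq> {}" using assms rel_interior_subset by blast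
  from subset_of_face_of[OF simplicial_complexD(4)[OF assms(1-3)] order_refl this] show ?thesis by blast
qed

lemma simplicial_complex_subset_dim:
  assumes T: "simplicial_complex T" "S \<in> T" "S' \<in> T" and "S \<subseteq> S'" "aff_dim S' \<le> aff_dim S"
  shows "S = S'"
proof (rule ccontr)
  assume "S \<noteq> S'"
  have "S' \<inter> S face_of S'" by (rule simplicial_complexD(4)[OF T(1,3,2)])
  moreover have "S' \<inter> S = S" using assms(4) by blast
  ultimately have "aff_dim S < aff_dim S'"
    using face_of_aff_dim_lt[of S' S] simplicial_complexD(5)[OF T(1,3)] \<open>S \<noteq> S'\<close> by simp
  then show False using assms(5) by simp
qed

text \<open>Near a point \<open>x\<close> in the relative interior of a maximal simplex
  \<open>S\<close>, the polyhedron coincides with \<open>S\<close>. So the simplexes of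
  \<open>T'\<close> through \<open>x\<close> have dimension at most \<open>d\<close>. They cover a
  relatively open part of \<open>S\<close>, hence one of them has dimension \<open>d\<close>, and it
  is maximal since any simplex above it contains \<open>x\<close> as well.\<close>

lemma maximal_simplexes_subset:
  assumes T: "triangulates T P" and T': "triangulates T' P"
  shows "\<Union>(maximal_simplexes T d) \<subseteq> \<Union>(maximal_simplexes T' d)"
proof -
  have sT: "simplicial_complex T" "\<Union>T = P" and sT': "simplicial_complex T'" "\<Union>T' = P"
    using T T' by (auto simp: triangulates_def)
  let ?D = "\<Union>(maximal_simplexes T' d)"
  have "closed ?D" using simplicial_complexD(1,6)[OF sT'(1)]
    by (intro closed_Union) (auto simp: maximal_simplexes_def)
  have "S \<subseteq> ?D" if S: "S \<in> maximal_simplexes T d" for S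
  proof -
    have ST: "S \<in> T" "int d simplex S" and Smax: "\<And>S'. S' \<in> T \<Longrightarrow> S \<subseteq> S' \<Longrightarrow> S' = S"
      using S by (auto simp: maximal_simplexes_def)
    note dimS = aff_dim_simplex[OF ST(2)]
    have "rel_interior S \<subseteq> ?D"
    proof
      fix x assume x: "x \<in> rel_interior S"
      \<comment> \<open>The complement of \<open>C\<close> is an open neighbourhood of
        \<open>x\<close> that meets only those simplexes, of either triangulation, that contain
        \<open>x\<close>.\<close>
      define C where "C = \<Union>{S' \<in> T \<union> T'. x \<notin> S'}"
      have "closed C" unfolding C_def
        using simplicial_complexD(1,6)[OF sT(1)] simplicial_complexD(1,6)[OF sT'(1)] by (intro closed_Union) auto
      then have opU: "open (- C)" by (rule open_Compl)
      have xU: "x \<in> - C" by (auto simp: C_def)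
      have inS: "y \<in> S" if y: "y \<in> P" "y \<in> - C" for y
      proof -
        obtain S1 where S1: "S1 \<in> T" "y \<in> S1" using y(1) sT(2) by blast
        then have "x \<in> S1" using y(2) by (auto simp: C_def)
        then have "S \<subseteq> S1" by (rule simplicial_complex_rel_interior_subset[OF sT(1) ST(1) S1(1) x])
        then show ?thesis using Smax[OF S1(1)] S1(2) by simp
      qed
      define M where "M = {S' \<in> T'. x \<in> S'}"
      \<comment> \<open>The part of \<open>S'\<close> in the neighbourhood has the same affine hull
        as \<open>S'\<close> and lies in \<open>S\<close>.\<close>
      have dimM: "aff_dim S' \<le> int d" if S': "S' \<in> M" for S'
      proof -
        have "affine hull (S' \<inter> - C) = affine hull S'"
          by (rule affine_hull_convex_Int_open[OF _ opU]) (use S' xU simplicial_complexD(5)[OF sT'(1)] in \<open>auto simp: M_def\<close>)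
        then have "aff_dim S' = aff_dim (S' \<inter> - C)" by (metis aff_dim_affine_hull)
        also have "\<dots> \<le> aff_dim S" using S' inS sT'(2) by (intro aff_dim_subset) (auto simp: M_def)
        finally show ?thesis using dimS by simp
      qed
      define R where "R = rel_interior S \<inter> - C"
      have R0: "R \<noteq> {}" using x xU by (auto simp: R_def)
      have opR: "openin (top_of_set (affine hull S)) R" unfolding R_def by (intro openin_Int_open openin_rel_interior opU)
      have hR: "affine hull R = affine hull S" by (rule affine_hull_openin[OF opR R0])
      have dimR: "aff_dim R = int d" using hR dimS by (metis aff_dim_affine_hull)
      have "R \<subseteq> \<Union>M"
      proof
        fix y assume y: "y \<in> R"
        then have "y \<in> P" using rel_interior_subset ST(1) sT(2) by (auto simp: R_def)
        then obtain S' where S': "S' \<in> T'" "y \<in> S'" using sT'(2) by blast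
        then have "x \<in> S'" using y by (auto simp: R_def C_def)
        then show "y \<in> \<Union>M" using S' by (auto simp: M_def)
      qed
      moreover have "finite M" using simplicial_complexD(1)[OF sT'(1)] by (simp add: M_def)
      ultimately obtain S' where S': "S' \<in> M" "\<not> aff_dim S' < aff_dim R"
        using open_not_covered_by_lower_dim[of M R] R0 opR hR simplicial_complexD(6)[OF sT'(1)] by (auto simp: M_def)
      then have d': "aff_dim S' = int d" using dimM[OF S'(1)] dimR by simp
      have S'T: "S' \<in> T'" "x \<in> S'" using S'(1) by (auto simp: M_def)
      have "S'' = S'" if S'': "S'' \<in> T'" "S' \<subseteq> S''" for S''
      proof -
        have "S'' \<in> M" using S'' S'T by (auto simp: M_def)
        then have "aff_dim S'' \<le> aff_dim S'" using dimM d' by simp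
        then show ?thesis using simplicial_complex_subset_dim[OF sT'(1) S'T(1) S''(1,2)] by simp
      qed
      moreover have "int d simplex S'" using simplicial_complexD(7)[OF sT'(1) S'T(1)] d' by simp
      ultimately have "S' \<in> maximal_simplexes T' d" using S'T by (simp add: maximal_simplexes_def)
      then show "x \<in> ?D" using S'T by blast
    qed
    then have "closure (rel_interior S) \<subseteq> ?D" using \<open>closed ?D\<close> by (simp add: closure_minimal)
    then show ?thesis using convex_closure_rel_interior[OF convex_simplex[OF ST(2)]] closure_subset[of S] by simp
  qed
  then show ?thesis by blast
qed

lemma dim_part_eq:
  assumes "triangulates T P"
  shows "dim_part d P = \<Union>(maximal_simplexes T d)"
proof -
  have "triangulates (SOME T. triangulates T P) P" using assms by (rule someI)
  then show ?thesis unfolding dim_part_def using maximal_simplexes_subset assms by blast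
qed

text \<open>All faces of the maximal \<open>d\<close>-simplexes are taken. Proper faces have smaller
  dimension, so no further \<open>d\<close>-simplexes appear. This reduces the general case to
  dimension at most \<open>d\<close>.\<close>

lemma regular_triangulation_dim_part:
  assumes T: "regular_triangulation T P"
  obtains T' where "regular_triangulation T' (\<Union>(maximal_simplexes T d))" "\<And>S. S \<in> T' \<Longrightarrow> aff_dim S \<le> int d"
    "maximal_simplexes T' d = maximal_simplexes T d" "{S \<in> T'. int d simplex S} = maximal_simplexes T d"
proof -
  have sc: "simplicial_complex T" and reg: "\<And>S. S \<in> T \<Longrightarrow> regular_simplex S"
    using T unfolding regular_triangulation_def triangulates_def by auto
  let ?M = "maximal_simplexes T d"
  have M: "S \<in> T" "int d simplex S" "convex S" "aff_dim S = int d" if "S \<in> ?M" for S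
    using that convex_simplex aff_dim_simplex unfolding maximal_simplexes_def by blast+
  let ?T = "{F. \<exists>S\<in>?M. F face_of S}"
  have sub: "?T \<subseteq> T" using M simplicial_complexD(3)[OF sc] by blast
  have "simplicial_complex ?T" unfolding simplicial_complex_def
  proof (intro conjI allI impI ballI)
    show "finite ?T" using sub simplicial_complexD(1)[OF sc] by (rule finite_subset)
    show "\<exists>n. n simplex S" if "S \<in> ?T" for S using simplicial_complexD(2)[OF sc] sub that by blast
    show "F \<in> ?T" if SF: "S \<in> ?T \<and> F face_of S" for F S
    proof -
      obtain S0 where "S0 \<in> ?M" "S face_of S0" using SF by auto
      then show ?thesis using SF face_of_trans[of F S S0] by auto
    qed
    show "S \<inter> S' face_of S" if "S \<in> ?T \<and> S' \<in> ?T" for S S'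
      by (rule simplicial_complexD(4)[OF sc subsetD[OF sub conjunct1[OF that]] subsetD[OF sub conjunct2[OF that]]])
  qed
  moreover have "\<Union>?T = \<Union>?M" using M(3) face_of_refl face_of_imp_subset by blast
  ultimately have 1: "regular_triangulation ?T (\<Union>?M)"
    unfolding regular_triangulation_def triangulates_def using reg sub by blast
  have 2: "aff_dim S \<le> int d" if ST: "S \<in> ?T" for S
  proof -
    obtain S0 where "S0 \<in> ?M" "S face_of S0" using ST by auto
    then show ?thesis using M(4)[of S0] aff_dim_subset[OF face_of_imp_subset[of S S0]] by simp
  qed
  have 3: "{S \<in> ?T. int d simplex S} = ?M"
  proof (intro equalityI subsetI)
    fix F assume "F \<in> {S \<in> ?T. int d simplex S}"
    then obtain S where S: "S \<in> ?M" "F face_of S" "int d simplex F" by auto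
    then have "\<not> aff_dim F < aff_dim S" using M(4)[OF S(1)] aff_dim_simplex[OF S(3)] by simp
    then have "F = S" using face_of_aff_dim_lt[OF M(3)[OF S(1)] S(2)] by auto
    then show "F \<in> ?M" using S by simp
  next
    fix S assume S: "S \<in> ?M"
    then show "S \<in> {S \<in> ?T. int d simplex S}" using M(2)[OF S] face_of_refl[OF M(3)[OF S]] by auto
  qed
  have 4: "maximal_simplexes ?T d = ?M"
  proof (intro equalityI subsetI)
    fix S assume "S \<in> maximal_simplexes ?T d"
    then have "S \<in> {S \<in> ?T. int d simplex S}" unfolding maximal_simplexes_def by simp
    then show "S \<in> ?M" unfolding 3 .
  next
    fix S assume S: "S \<in> ?M"
    then have "S \<in> {S \<in> ?T. int d simplex S}" unfolding 3 .
    moreover have "S' = S" if S': "S' \<in> ?T" "S \<subseteq> S'" for S'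
      using S subsetD[OF sub S'(1)] S'(2) unfolding maximal_simplexes_def by simp
    ultimately show "S \<in> maximal_simplexes ?T d" unfolding maximal_simplexes_def by simp
  qed
  show thesis by (rule that[OF 1 2 4 3])
qed

section \<open>Independence of the triangulation\<close>

lemma lattice_points_maximal_simplexes:
  assumes T: "regular_triangulation T P"
  shows "(\<lambda>t. real (Suc d) * real (card (lattice_points (dim_part d P) t)) / real t ^ Suc d) \<longlonglongrightarrow>
    (\<Sum>S\<in>maximal_simplexes T d. 1 / (fact d * real (simplex_den S)))"
proof -
  obtain T' where T': "regular_triangulation T' (\<Union>(maximal_simplexes T d))" "\<And>S. S \<in> T' \<Longrightarrow> aff_dim S \<le> int d"
    "{S \<in> T'. int d simplex S} = maximal_simplexes T d"
    using regular_triangulation_dim_part[OF T, of d] by metis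
  have dp: "dim_part d P = \<Union>(maximal_simplexes T d)" 
    using T dim_part_eq unfolding regular_triangulation_def by blast
  have "(\<lambda>t. real (Suc d) * (real (card (lattice_points (dim_part d P) t)) / real t ^ Suc d)) \<longlonglongrightarrow>
    real (Suc d) * (\<Sum>S\<in>maximal_simplexes T d. 1 / (fact (Suc d) * real (simplex_den S)))"
    using lattice_points_regular_triangulation[OF T'(1,2)] unfolding T'(3) dp by (intro tendsto_mult_left)
  moreover have "real (Suc d) * (\<Sum>S\<in>maximal_simplexes T d. 1 / (fact (Suc d) * real (simplex_den S))) =
    (\<Sum>S\<in>maximal_simplexes T d. 1 / (fact d * real (simplex_den S)))"
    unfolding sum_distrib_left by (intro sum.cong refl) (simp add: fact_Suc del: of_nat_Suc)
  ultimately show ?thesis by simp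
qed

text \<open>The sequence that converges to the sum depends on \<open>P\<close> and \<open>d\<close>
  only, so uniqueness of limits compares \<open>T\<close> with the triangulation chosen in the
  definition.\<close>

lemma rational_measure_eq:
  assumes "regular_triangulation T P"
  shows "rational_measure d P = (\<Sum>S\<in>maximal_simplexes T d. 1 / (fact d * real (simplex_den S)))"
proof -
  have "regular_triangulation (SOME T. regular_triangulation T P) P" using assms by (rule someI)
  from LIMSEQ_unique[OF lattice_points_maximal_simplexes[OF this] lattice_points_maximal_simplexes[OF assms]]
  show ?thesis unfolding rational_measure_def .
qed

lemma rational_measure_limit:
  assumes "regular_triangulation T P"
  shows "(\<lambda>t. real (Suc d) * real (card (lattice_points (dim_part d P) t)) / real t ^ Suc d) \<longlonglongrightarrow> rational_measure d P"
  unfolding rational_measure_eq[OF assms] by (rule lattice_points_maximal_simplexes[OF assms])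

text \<open>In dimension at most \<open>d\<close> the points outside the
  \<open>d\<close>-dimensional part are negligible. Counting \<open>P\<close> itself has the
  advantage of obeying inclusion-exclusion.\<close>

lemma rational_measure_limit_low_dim:
  assumes T: "regular_triangulation T P" and dim: "\<And>S. S \<in> T \<Longrightarrow> aff_dim S \<le> int d"
  shows "(\<lambda>t. real (Suc d) * real (card (lattice_points P t)) / real t ^ Suc d) \<longlonglongrightarrow> rational_measure d P"
proof -
  have sc: "simplicial_complex T" using T by (simp add: regular_triangulation_def triangulates_def)
  have "maximal_simplexes T d = {S \<in> T. int d simplex S}"
    unfolding maximal_simplexes_def
    using simplicial_complex_subset_dim[OF sc] dim aff_dim_simplex by (metis (no_types, lifting))
  then have "(\<lambda>t. real (Suc d) * (real (card (lattice_points P t)) / real t ^ Suc d)) \<longlonglongrightarrow>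
    real (Suc d) * (\<Sum>S\<in>maximal_simplexes T d. 1 / (fact (Suc d) * real (simplex_den S)))"
    using lattice_points_regular_triangulation[OF T dim] by (intro tendsto_mult_left) simp
  moreover have "real (Suc d) * (\<Sum>S\<in>maximal_simplexes T d. 1 / (fact (Suc d) * real (simplex_den S))) =
    rational_measure d P"
    unfolding rational_measure_eq[OF T] sum_distrib_left by (intro sum.cong refl) (simp add: fact_Suc del: of_nat_Suc)
  ultimately show ?thesis by simp
qed

lemma rational_measure_dim_part:
  assumes T: "regular_triangulation T P"
  shows "rational_measure d P = rational_measure d (dim_part d P)"
proof -
  obtain T' where T': "regular_triangulation T' (\<Union>(maximal_simplexes T d))" "maximal_simplexes T' d = maximal_simplexes T d"
    using regular_triangulation_dim_part[OF T, of d] by metis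
  have dp: "dim_part d P = \<Union>(maximal_simplexes T d)" 
    using T dim_part_eq unfolding regular_triangulation_def by blast
  show ?thesis unfolding dp rational_measure_eq[OF T] rational_measure_eq[OF T'(1)] T'(2) ..
qed

section \<open>Affine images\<close>

lemma simplex_affine_image:
  fixes L :: "'a::euclidean_space \<Rightarrow> 'b::euclidean_space"
  assumes L: "linear L" "inj L"
  shows "n simplex S \<Longrightarrow> n simplex ((+) c ` L ` S)"
proof -
  assume "n simplex S"
  then obtain C where C: "\<not> affine_dependent C" "int (card C) = n + 1" "S = convex hull C" unfolding simplex_def by blast
  have "(+) c ` L ` S = convex hull ((+) c ` L ` C)"
    unfolding C(3) by (simp add: convex_hull_linear_image[OF L(1)] convex_hull_translation)
  moreover have card: "card ((+) c ` L ` C) = card C"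
    by (simp add: card_image inj_on_subset[OF L(2)])
  moreover have "\<not> affine_dependent ((+) c ` L ` C)"
    using C(1) L unfolding affine_independent_iff_card card by (simp add: aff_dim_translation_eq)
  ultimately show ?thesis unfolding simplex_def using C(2) by metis
qed

lemma face_of_affine_image:
  fixes L :: "'a::euclidean_space \<Rightarrow> 'b::euclidean_space"
  assumes L: "linear L" "inj L"
  shows "(+) c ` L ` F face_of (+) c ` L ` S \<longleftrightarrow> F face_of S"
  using face_of_linear_image[OF L] by simp

lemma simplicial_complex_affine_image:
  fixes L :: "'a::euclidean_space \<Rightarrow> 'b::euclidean_space"
  assumes L: "linear L" "inj L" and T: "simplicial_complex T"
  shows "simplicial_complex ((\<lambda>S. (+) c ` L ` S) ` T)"
  unfolding simplicial_complex_def
proof (intro conjI allI impI ballI)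
  let ?f = "\<lambda>S. (+) c ` L ` S"
  have inj: "inj (\<lambda>x. c + L x)" using L(2) by (auto simp: inj_on_def)
  show "finite (?f ` T)" using simplicial_complexD(1)[OF T] by simp
  show "\<exists>n. n simplex S" if "S \<in> ?f ` T" for S using that simplicial_complexD(2)[OF T] simplex_affine_image[OF L] by blast
  show "F \<in> ?f ` T" if SF: "S \<in> ?f ` T \<and> F face_of S" for F S
  proof -
    obtain S0 where S0: "S0 \<in> T" "S = ?f S0" using SF by blast
    have "F \<subseteq> S" using SF face_of_imp_subset by blast
    then have "F \<subseteq> (\<lambda>x. c + L x) ` S0" unfolding S0(2) image_image .
    then obtain F0 where "F = (\<lambda>x. c + L x) ` F0" unfolding subset_image_iff by blast
    then have "F = ?f F0" by (simp add: image_image)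
    then have "F0 face_of S0" using SF S0 face_of_affine_image[OF L] by simp
    then show ?thesis using simplicial_complexD(3)[OF T S0(1)] \<open>F = ?f F0\<close> by blast
  qed
  show "S \<inter> S' face_of S" if SS: "S \<in> ?f ` T \<and> S' \<in> ?f ` T" for S S'
  proof -
    obtain S0 S1 where S0: "S0 \<in> T" "S = ?f S0" and S1: "S1 \<in> T" "S' = ?f S1" using SS by blast
    have "?f S0 \<inter> ?f S1 = ?f (S0 \<inter> S1)" using image_Int[OF inj, of S0 S1] by (simp add: image_image)
    then show ?thesis using S0(2) S1(2) face_of_affine_image[OF L] simplicial_complexD(4)[OF T S0(1) S1(1)] by simp
  qed
qed

text \<open>An injective affine map carries triangulations to triangulations and preserves inclusion
  both ways, hence maximality. Regularity is not involved, so any triangulation of \<open>P\<close>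
  serves.\<close>

lemma dim_part_affine_image:
  fixes L :: "real ^ 'n \<Rightarrow> real ^ 'm"
  assumes L: "linear L" "inj L" and T: "triangulates T P"
  shows "dim_part d ((+) c ` L ` P) = (+) c ` L ` dim_part d P"
proof -
  let ?f = "\<lambda>S. (+) c ` L ` S"
  have inj: "inj (\<lambda>x. c + L x)" using L(2) by (auto simp: inj_on_def)
  have sub: "?f S \<subseteq> ?f S' \<longleftrightarrow> S \<subseteq> S'" and eq: "?f S = ?f S' \<longleftrightarrow> S = S'" for S S'
    using inj_image_subset_iff[OF inj, of S S'] inj_image_eq_iff[OF inj, of S S'] by (simp_all add: image_image)
  have sT: "simplicial_complex T" "\<Union>T = P" using T by (auto simp: triangulates_def)
  have T': "triangulates (?f ` T) (?f P)"
    unfolding triangulates_def using simplicial_complex_affine_image[OF L sT(1)] sT(2) by blast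
  have simp: "int d simplex ?f S \<longleftrightarrow> int d simplex S" if "S \<in> T" for S
  proof
    assume "int d simplex ?f S"
    then have "aff_dim (?f S) = int d" by (rule aff_dim_simplex)
    then have "aff_dim S = int d" by (simp add: aff_dim_translation_eq aff_dim_injective_linear_image[OF L])
    then show "int d simplex S" using simplicial_complexD(7)[OF sT(1) that] by simp
  qed (rule simplex_affine_image[OF L])
  have "maximal_simplexes (?f ` T) d = ?f ` maximal_simplexes T d"
  proof (intro equalityI subsetI)
    fix U assume U: "U \<in> maximal_simplexes (?f ` T) d"
    then obtain S where S: "S \<in> T" "U = ?f S" unfolding maximal_simplexes_def by auto
    have "S' = S" if "S' \<in> T" "S \<subseteq> S'" for S'
    proof -
      have "?f S' = ?f S" using U S(2) that(1) sub[of S S'] that(2) unfolding maximal_simplexes_def by simp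
      then show ?thesis unfolding eq .
    qed
    moreover have "int d simplex U" using U unfolding maximal_simplexes_def by simp
    then have "int d simplex S" unfolding S(2) simp[OF S(1)] .
    ultimately show "U \<in> ?f ` maximal_simplexes T d" using S unfolding maximal_simplexes_def by simp
  next
    fix U assume "U \<in> ?f ` maximal_simplexes T d"
    then obtain S where SU: "S \<in> maximal_simplexes T d" "U = ?f S" by (rule imageE)
    then have S: "S \<in> T" "U = ?f S" "int d simplex S" "\<And>S'. S' \<in> T \<Longrightarrow> S \<subseteq> S' \<Longrightarrow> S' = S"
      unfolding maximal_simplexes_def by simp_all
    have "U' = U" if U': "U' \<in> ?f ` T" "U \<subseteq> U'" for U'
    proof -
      obtain S' where S': "S' \<in> T" "U' = ?f S'" using U'(1) by auto
      then have "S \<subseteq> S'" using U'(2) S(2) sub[of S S'] by simp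
      then show ?thesis using S(4)[OF S'(1)] S(2) S'(2) by simp
    qed
    then show "U \<in> maximal_simplexes (?f ` T) d"
      using S(1-3) simp[OF S(1)] unfolding maximal_simplexes_def by simp
  qed
  then show ?thesis unfolding dim_part_eq[OF T] dim_part_eq[OF T'] by (simp add: image_Union image_image)
qed

text \<open>\<open>\<Gamma>\<close> extends \<open>f\<close> to the cone over \<open>D\<close> and
  keeps heights. By \<open>int\<close>, a point and its image have the same denominators, so
  \<open>\<Gamma>\<close> maps lattice points to lattice points in both directions.\<close>

lemma card_lattice_points_image:
  fixes f :: "real ^ 'n \<Rightarrow> real ^ 'm"
  assumes inj: "inj f" and int: "\<And>h p. 0 < h \<Longrightarrow> integer_point (h *\<^sub>R lift1 p) \<longleftrightarrow> integer_point (h *\<^sub>R lift1 (f p))"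
  shows "card (lattice_points (f ` D) t) = card (lattice_points D t)"
proof -
  define \<Gamma> where "\<Gamma> z = z $ None *\<^sub>R lift1 (f (dehomog z))" for z
  have \<Gamma>: "\<Gamma> z $ None = z $ None" "z $ None \<noteq> 0 \<Longrightarrow> dehomog (\<Gamma> z) = f (dehomog z)" for z
    by (simp_all add: \<Gamma>_def dehomog_lift1)
  have "bij_betw \<Gamma> (lattice_points D t) (lattice_points (f ` D) t)"
  proof (rule bij_betw_imageI)
    show "inj_on \<Gamma> (lattice_points D t)"
    proof (rule inj_onI)
      fix y z assume yz: "y \<in> lattice_points D t" "z \<in> lattice_points D t" "\<Gamma> y = \<Gamma> z"
      then have n: "y $ None \<noteq> 0" "z $ None \<noteq> 0" by (auto simp: lattice_points_def)
      have "y $ None = z $ None" "f (dehomog y) = f (dehomog z)" using yz(3) \<Gamma> n by metis+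
      then show "y = z" using lift1_dehomog n injD[OF inj] by metis
    qed
    show "\<Gamma> ` lattice_points D t = lattice_points (f ` D) t"
    proof (intro equalityI subsetI)
      fix y assume "y \<in> \<Gamma> ` lattice_points D t"
      then obtain z where z: "z \<in> lattice_points D t" "y = \<Gamma> z" by blast
      then have h: "0 < z $ None" and "integer_point (z $ None *\<^sub>R lift1 (dehomog z))"
        using lift1_dehomog[of z] by (auto simp: lattice_points_def)
      then have "integer_point y" using int[OF h] z(2) \<Gamma>_def by simp
      then show "y \<in> lattice_points (f ` D) t" using z \<Gamma> by (auto simp: lattice_points_def)
    next
      fix y assume y: "y \<in> lattice_points (f ` D) t"
      then obtain p where p: "p \<in> D" "dehomog y = f p" and h: "0 < y $ None" "y $ None \<le> real t" "integer_point y"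
        by (auto simp: lattice_points_def)
      let ?z = "y $ None *\<^sub>R lift1 p"
      have "y = y $ None *\<^sub>R lift1 (f p)" using lift1_dehomog[of y] h p by simp
      then have "integer_point ?z" using int[OF h(1)] h(3) by metis
      then have "?z \<in> lattice_points D t" using h p by (simp add: lattice_points_def dehomog_lift1)
      moreover have "\<Gamma> ?z = y" using \<open>y = _\<close> h(1) by (simp add: \<Gamma>_def dehomog_lift1)
      ultimately show "y \<in> \<Gamma> ` lattice_points D t" by (metis imageI)
    qed
  qed
  then show ?thesis by (rule bij_betw_same_card[symmetric])
qed

text \<open>The triangulation \<open>T'\<close> of the image may be unrelated to the image of
  \<open>T\<close>: both measures are limits of the same counts.\<close>

lemma rational_measure_affine_image:
  fixes L :: "real ^ 'n \<Rightarrow> real ^ 'm"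
  assumes L: "linear L" "inj L" and T: "regular_triangulation T P" "regular_triangulation T' ((+) c ` L ` P)"
    and int: "\<And>h p. 0 < h \<Longrightarrow> integer_point (h *\<^sub>R lift1 p) \<longleftrightarrow> integer_point (h *\<^sub>R lift1 (c + L p))"
  shows "rational_measure d ((+) c ` L ` P) = rational_measure d P"
proof -
  have inj: "inj (\<lambda>x. c + L x)" using L(2) by (auto simp: inj_on_def)
  have "dim_part d ((+) c ` L ` P) = (\<lambda>x. c + L x) ` dim_part d P"
    using dim_part_affine_image[OF L, of T P d c] T(1) unfolding regular_triangulation_def image_image by simp
  then have "card (lattice_points (dim_part d ((+) c ` L ` P)) t) = card (lattice_points (dim_part d P) t)" for t
    using card_lattice_points_image[OF inj int] by simp
  then show ?thesis using LIMSEQ_unique[OF rational_measure_limit[OF T(2)]] rational_measure_limit[OF T(1)] by simp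
qed

section \<open>Invariance, valuation, pyramids and parallelepipeds\<close>


lemma rational_polyhedron_triangulation:
  assumes "rational_polyhedron P"
  shows "\<exists>T. regular_triangulation T P"
  using rational_polyhedronD[OF assms] regular_triangulation_exists[of P] by metis

lemma rational_measure_nonneg: "0 \<le> rational_measure d P"
  unfolding rational_measure_def by (intro sum_nonneg) simp

lemma det_map_matrix_of_int: "det (map_matrix real_of_int A) = of_int (det A)"
  by (simp add: det_def)

text \<open>In Cramer's rule the denominator is a determinant of absolute value 1, so the solution
  stays integral.\<close>

lemma integer_point_unimodular_matrix:
  fixes A :: "int ^ 'n ^ 'n"
  assumes "det A = 1 \<or> det A = - 1"
  shows "integer_point (map_matrix real_of_int A *v x) \<longleftrightarrow> integer_point x"
proof
  let ?M = "map_matrix real_of_int A"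
  assume y: "integer_point (?M *v x)"
  have d: "det ?M = 1 \<or> det ?M = - 1" using assms by (auto simp: det_map_matrix_of_int)
  then have d0: "det ?M \<noteq> 0" by auto
  have "x = (\<chi> k. det (\<chi> i j. if j = k then (?M *v x) $ i else ?M $ i $ j) / det ?M)"
    using cramer[OF d0, of x "?M *v x"] by simp
  moreover have "det (\<chi> i j. if j = k then (?M *v x) $ i else ?M $ i $ j) \<in> \<int>" for k
    by (rule det_closed) (use y in \<open>auto simp: integer_point_def\<close>)
  then have "integer_point (\<chi> k. det (\<chi> i j. if j = k then (?M *v x) $ i else ?M $ i $ j) / det ?M)"
    using d by (auto simp: integer_point_def)
  ultimately show "integer_point x" by simp
next
  assume "integer_point x"
  then show "integer_point (map_matrix real_of_int A *v x)"
    by (auto simp: integer_point_def matrix_vector_mult_def intro!: Ints_sum Ints_mult)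
qed

lemma integer_point_lift1: "integer_point (h *\<^sub>R lift1 p) \<longleftrightarrow> h \<in> \<int> \<and> integer_point (h *\<^sub>R p)"
proof -
  have "(\<forall>i :: 'a option. Q i) \<longleftrightarrow> Q None \<and> (\<forall>i. Q (Some i))" for Q by (metis not_None_eq)
  then show ?thesis unfolding integer_point_def by simp
qed

lemma rational_measure_invariant:
  fixes P Q :: "(real ^ 'n) set"
  assumes \<gamma>: "\<gamma> \<in> integral_affine_group" and P: "rational_polyhedron P" and Q: "rational_polyhedron Q" and "P = \<gamma> ` Q"
  shows "rational_measure d P = rational_measure d Q"
proof -
  obtain A :: "int ^ 'n ^ 'n" and t :: "int ^ 'n" where A: "det A = 1 \<or> det A = - 1"
    and \<gamma>_eq: "\<gamma> = (\<lambda>x. map_matrix real_of_int A *v x + of_int_vec t)"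
    using \<gamma> unfolding integral_affine_group_def by blast
  define L where "L = (\<lambda>x. map_matrix real_of_int A *v x)"
  have L: "linear L" unfolding L_def by simp
  have "det (map_matrix real_of_int A) \<noteq> 0" using A by (auto simp: det_map_matrix_of_int)
  then have "inj L" unfolding L_def using inj_matrix_vector_mult[of "map_matrix real_of_int A"] invertible_det_nz by blast
  have PQ: "P = (+) (of_int_vec t) ` L ` Q" unfolding assms(4) \<gamma>_eq L_def by (auto simp: image_image add.commute)
  obtain T T' where T: "regular_triangulation T Q" "regular_triangulation T' P" 
    using rational_polyhedron_triangulation P Q by metis
  show ?thesis unfolding PQ
  proof (rule rational_measure_affine_image[OF L \<open>inj L\<close> T(1) T(2)[unfolded PQ]])
    fix h :: real and p :: "real ^ 'n" assume "0 < h"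
    have "integer_point (h *\<^sub>R (of_int_vec t + L p)) \<longleftrightarrow> integer_point (h *\<^sub>R p)" if h: "h \<in> \<int>"
    proof -
      have it: "integer_point (h *\<^sub>R of_int_vec t)" using h by (simp add: of_int_vec_simps)
      have "h *\<^sub>R (of_int_vec t + L p) = h *\<^sub>R of_int_vec t + L (h *\<^sub>R p)"
        by (simp add: scaleR_right_distrib linear_cmul[OF L])
      moreover have "integer_point (h *\<^sub>R of_int_vec t + L (h *\<^sub>R p)) \<longleftrightarrow> integer_point (L (h *\<^sub>R p))"
        using it integer_point_simps(2,3)[of _ "h *\<^sub>R of_int_vec t"] by (metis add.commute add_diff_cancel_left')
      ultimately show ?thesis using integer_point_unimodular_matrix[OF A] by (simp add: L_def)
    qed
    then show "integer_point (h *\<^sub>R lift1 p) \<longleftrightarrow> integer_point (h *\<^sub>R lift1 (of_int_vec t + L p))"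
      unfolding integer_point_lift1 by blast
  qed
qed

text \<open>The image is described by the forms of \<open>P\<close>, which ignore the new
  coordinate, together with that coordinate itself, whose sign must be zero.\<close>

lemma rational_measure_conservative:
  fixes P :: "(real ^ 'n) set"
  assumes P: "rational_polyhedron P"
  shows "rational_measure d P = rational_measure d ((\<lambda>x. append_coord x 0) ` P)"
proof -
  define L :: "real ^ 'n \<Rightarrow> real ^ 'n option" where "L x = append_coord x 0" for x
  have L: "linear L" unfolding L_def by (rule linearI) (simp_all add: vec_option_eq_iff)
  have inj: "inj L" unfolding L_def by (rule injI) (simp add: vec_option_eq_iff vec_eq_iff)
  let ?P = "(+) 0 ` L ` P"
  have PL: "?P = L ` P" by (simp add: image_image)
  obtain T F where T: "regular_triangulation T P" and F: "sign_determined F P"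
    using rational_polyhedron_triangulation rational_polyhedronD(3) P by metis
  have "compact P" using rational_polyhedronD(1,2)[OF P] compact_eq_bounded_closed by blast
  then have "compact ?P" unfolding PL using L linear_continuous_on linear_conv_bounded_linear compact_continuous_image by blast
  then have cb: "closed ?P" "bounded ?P" by (auto simp: compact_eq_bounded_closed)
  \<comment> \<open>Coordinates have been appended twice. In \<open>lift1 (L x)\<close> the index
    \<open>None\<close> carries the 1, \<open>Some None\<close> the 0 appended by \<open>L\<close>,
    and \<open>Some (Some j)\<close> the original coordinate.\<close>
  define e where "e f = (\<chi> i. case i of None \<Rightarrow> f $ None | Some None \<Rightarrow> 0 | Some (Some j) \<Rightarrow> f $ Some j)" for f :: "real ^ 'n option"
  have e: "e f \<bullet> lift1 (L x) = f \<bullet> lift1 x" for f x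
    by (simp add: inner_vec_def sum_UNIV_option e_def L_def)
  have eI: "integer_point (e f)" if "integer_point f" for f
    using that unfolding integer_point_def by (auto simp: e_def split: option.split)
  have "sign_determined (insert (axis (Some None) 1) (e ` F)) ?P"
    unfolding sign_determined_def
  proof (intro conjI ballI allI impI)
    show "finite (insert (axis (Some None) 1) (e ` F))" using sign_determinedD(1)[OF F] by simp
    show "integer_point g" if "g \<in> insert (axis (Some None) 1) (e ` F)" for g
      using that eI sign_determinedD(2)[OF F] by auto
    fix x y assume "x \<in> ?P" and sg: "\<forall>f\<in>insert (axis (Some None) 1) (e ` F). sgn (f \<bullet> lift1 x) = sgn (f \<bullet> lift1 y)"
    then obtain p where p: "p \<in> P" "x = L p" by auto
    have "sgn (y $ None) = sgn (x $ None)" using sg by (simp add: inner_axis')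
    then have "y $ None = 0" using p by (simp add: L_def sgn_0_0)
    then have y: "y = L (\<chi> i. y $ Some i)" by (simp add: L_def vec_option_eq_iff)
    have "(\<chi> i. y $ Some i) \<in> P"
      using F p(1) sg e p(2) y unfolding sign_determined_def by (metis imageI insertCI)
    then show "y \<in> ?P" using y PL by blast
  qed
  then obtain T' where T': "regular_triangulation T' ?P" using regular_triangulation_exists[OF cb] by metis
  have "rational_measure d ?P = rational_measure d P"
  proof (rule rational_measure_affine_image[OF L inj T T'])
    fix h :: real and p :: "real ^ 'n"
    have "integer_point (h *\<^sub>R L p) \<longleftrightarrow> integer_point (h *\<^sub>R p)"
    proof -
      have "(\<forall>i :: 'n option. R i) \<longleftrightarrow> R None \<and> (\<forall>i. R (Some i))" for R by (metis not_None_eq)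
      then show ?thesis unfolding integer_point_def by (simp add: L_def)
    qed
    then show "integer_point (h *\<^sub>R lift1 p) \<longleftrightarrow> integer_point (h *\<^sub>R lift1 (0 + L p))"
      unfolding integer_point_lift1 by simp
  qed
  then show ?thesis by (simp add: PL L_def)
qed

lemma simplex_le_polyhedron_dim:
  fixes P :: "(real ^ 'n) set"
  assumes "n simplex S" "S \<subseteq> P"
  shows "n \<le> polyhedron_dim P"
proof -
  have "k \<in> {-1..int DIM(real ^ 'n)}" if "k simplex S" for k and S :: "(real ^ 'n) set"
    using simplex_dim_ge[OF that] aff_dim_simplex[OF that] aff_dim_le_DIM[of S] by simp
  then have "{k. \<exists>S :: (real ^ 'n) set. k simplex S \<and> S \<subseteq> P} \<subseteq> {-1..int DIM(real ^ 'n)}" by blast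
  then have "finite {k. \<exists>S :: (real ^ 'n) set. k simplex S \<and> S \<subseteq> P}" by (rule finite_subset) simp
  then show ?thesis unfolding polyhedron_dim_def using assms by (intro Max_ge) auto
qed

text \<open>All four sets are counted directly, and inclusion-exclusion holds at every
  \<open>t\<close>. Each set needs some triangulation of dimension at most \<open>d\<close>; it is
  taken subordinate to the forms of \<open>P\<close> and \<open>Q\<close> together, but the four
  triangulations need not be related.\<close>

lemma rational_measure_valuation:
  fixes P Q :: "(real ^ 'n) set"
  assumes P: "rational_polyhedron P" and Q: "rational_polyhedron Q"
    and dim: "polyhedron_dim P \<le> int d" "polyhedron_dim Q \<le> int d"
  shows "rational_measure d P + rational_measure d Q = rational_measure d (P \<union> Q) + rational_measure d (P \<inter> Q)"
proof -
  obtain F1 F2 where F12: "sign_determined F1 P" "sign_determined F2 Q" using rational_polyhedronD(3) P Q by metis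
  define F where "F = F1 \<union> F2"
  have F: "sign_determined F P" "sign_determined F Q"
    using sign_determined_Un_left F12 unfolding F_def by (blast, metis Un_commute)
  note cP = rational_polyhedronD(1,2)[OF P] and cQ = rational_polyhedronD(1,2)[OF Q]
  have lim: "(\<lambda>t. real (Suc d) * real (card (lattice_points X t)) / real t ^ Suc d) \<longlonglongrightarrow> rational_measure d X"
    if X: "closed X" "bounded X" "sign_determined F X" "X \<subseteq> P \<union> Q" for X
  proof -
    obtain T where T: "regular_triangulation T X" and sgn: "\<And>S f x y. S \<in> T \<Longrightarrow> f \<in> F \<Longrightarrow> x \<in> rel_interior S \<Longrightarrow> y \<in> rel_interior S \<Longrightarrow>
       sgn (f \<bullet> lift1 x) = sgn (f \<bullet> lift1 y)" using regular_triangulation_exists[OF X(1-3)] by metis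
    have sc: "simplicial_complex T" "\<Union>T = X" using T by (auto simp: regular_triangulation_def triangulates_def)
    show ?thesis
    proof (rule rational_measure_limit_low_dim[OF T])
      fix S assume S: "S \<in> T"
      note simp = simplicial_complexD(7)[OF sc(1) S]
      show "aff_dim S \<le> int d"
      proof (cases "S = {}")
        case False
        then obtain x where x: "x \<in> rel_interior S" using rel_interior_eq_empty[OF simplicial_complexD(5)[OF sc(1) S]] by blast
        \<comment> \<open>All points of the relatively open simplex have the signs of
          \<open>x\<close>, so membership of \<open>x\<close> in \<open>P\<close> or
          \<open>Q\<close> passes to them and, by closedness, to the whole simplex. Its dimension is
          then bounded by that of \<open>P\<close> or \<open>Q\<close>.\<close>
        have sub: "S \<subseteq> R" if R: "x \<in> R" "sign_determined F R" "closed R" for R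
        proof -
          have "rel_interior S \<subseteq> R" using R(1,2) sgn[OF S _ x] unfolding sign_determined_def by blast
          then have "closure (rel_interior S) \<subseteq> R" using R(3) by (simp add: closure_minimal)
          then show ?thesis
            using convex_closure_rel_interior[OF simplicial_complexD(5)[OF sc(1) S]] closure_subset[of S] by simp
        qed
        have "x \<in> P \<or> x \<in> Q" using x X(4) sc(2) S rel_interior_subset by blast
        then have "S \<subseteq> P \<or> S \<subseteq> Q" using sub F cP cQ by blast
        then show ?thesis using simplex_le_polyhedron_dim[OF simp] dim order_trans by blast
      qed simp
    qed
  qed
  have l: "(\<lambda>t. real (Suc d) * real (card (lattice_points P t)) / real t ^ Suc d +
      real (Suc d) * real (card (lattice_points Q t)) / real t ^ Suc d) \<longlonglongrightarrow> rational_measure d P + rational_measure d Q"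
    using lim[of P] lim[of Q] F cP cQ by (intro tendsto_add) auto
  have r: "(\<lambda>t. real (Suc d) * real (card (lattice_points (P \<union> Q) t)) / real t ^ Suc d +
      real (Suc d) * real (card (lattice_points (P \<inter> Q) t)) / real t ^ Suc d) \<longlonglongrightarrow> rational_measure d (P \<union> Q) + rational_measure d (P \<inter> Q)"
    using lim[of "P \<union> Q"] lim[of "P \<inter> Q"] sign_determined_Un[OF F] sign_determined_Int[OF F] cP cQ
    by (intro tendsto_add) (auto simp: bounded_Int)
  have "card (lattice_points P t) + card (lattice_points Q t) = card (lattice_points (P \<union> Q) t) + card (lattice_points (P \<inter> Q) t)" for t
  proof -
    have "lattice_points (P \<union> Q) t = lattice_points P t \<union> lattice_points Q t" "lattice_points (P \<inter> Q) t = lattice_points P t \<inter> lattice_points Q t"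
      by (auto simp: lattice_points_def)
    then show ?thesis using card_Un_Int[OF finite_lattice_points[OF cP(2)] finite_lattice_points[OF cQ(2)], of t] by simp
  qed
  then have "real (card (lattice_points P t)) + real (card (lattice_points Q t)) = real (card (lattice_points (P \<union> Q) t)) + real (card (lattice_points (P \<inter> Q) t))" for t
    by (metis of_nat_add)
  then have "(\<lambda>t. real (Suc d) * real (card (lattice_points P t)) / real t ^ Suc d +
      real (Suc d) * real (card (lattice_points Q t)) / real t ^ Suc d) = (\<lambda>t. real (Suc d) * real (card (lattice_points (P \<union> Q) t)) / real t ^ Suc d +
      real (Suc d) * real (card (lattice_points (P \<inter> Q) t)) / real t ^ Suc d)"
    unfolding add_divide_distrib[symmetric] distrib_left[symmetric] by simp
  then show ?thesis using LIMSEQ_unique[OF l] r by simp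
qed

lemma rational_measure_empty: "rational_measure d ({} :: (real ^ 'n) set) = 0"
proof -
  have "rational_polyhedron ({} :: (real ^ 'n) set)" unfolding rational_polyhedron_def by (intro exI[of _ "{}"]) simp
  then obtain T where T: "regular_triangulation T ({} :: (real ^ 'n) set)" using rational_polyhedron_triangulation by blast
  have "S = {}" if "S \<in> T" for S using T that by (auto simp: regular_triangulation_def triangulates_def)
  then have "maximal_simplexes T d = {}" unfolding maximal_simplexes_def by fastforce
  then show ?thesis unfolding rational_measure_eq[OF T] by simp
qed

section \<open>Single regular simplexes and pyramids\<close>

lemma regular_simplex_face:
  assumes S: "regular_simplex S" and C: "C \<subseteq> vertices S"
  shows "regular_simplex (convex hull C)" "vertices (convex hull C) = C" "(int (card C) - 1) simplex (convex hull C)"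
proof -
  obtain k where k: "k simplex S" using S unfolding regular_simplex_def rational_simplex_def by blast
  note V = simplex_vertices[OF k]
  have aff: "\<not> affine_dependent C" using V(1) C affine_dependent_subset by blast
  then show v: "vertices (convex hull C) = C" by (rule vertices_convex_hull)
  show "(int (card C) - 1) simplex (convex hull C)" using aff by (intro simplex_convex_hull) auto
  then show "regular_simplex (convex hull C)"
    using S C unfolding regular_simplex_def rational_simplex_def v part_of_int_basis_def by (meson image_mono order_trans subsetD)
qed

lemma regular_triangulation_faces:
  assumes S: "regular_simplex S"
  shows "regular_triangulation {F. F face_of S} S"
proof -
  obtain k where k: "k simplex S" using S unfolding regular_simplex_def rational_simplex_def by blast
  note V = simplex_vertices[OF k]
  have face: "F face_of S \<longleftrightarrow> (\<exists>C\<subseteq>vertices S. F = convex hull C)" for F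
    using face_of_convex_hull_affine_independent[OF V(1), of F] V(3) by simp
  have reg: "regular_simplex F \<and> (\<exists>n. n simplex F)" if "F face_of S" for F
    using that regular_simplex_face[OF S] unfolding face by blast
  have "convex S" using k convex_simplex by blast
  have "simplicial_complex {F. F face_of S}"
    unfolding simplicial_complex_def
  proof (intro conjI ballI allI impI)
    show "finite {F. F face_of S}"
      using finite_polytope_faces[OF simplex_imp_polytope[OF k]] .
    show "\<exists>n. n simplex F" if "F \<in> {F. F face_of S}" for F using reg that by blast
    show "F \<in> {F. F face_of S}" if "G \<in> {F. F face_of S} \<and> F face_of G" for F G
      using that face_of_trans[of F G S] by simp
    show "F \<inter> G face_of F" if "F \<in> {F. F face_of S} \<and> G \<in> {F. F face_of S}" for F G
      using that face_of_Int[of F S G] face_of_face[of F S "F \<inter> G"] by simp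
  qed
  moreover have "\<Union>{F. F face_of S} = S" using face_of_refl[OF \<open>convex S\<close>] face_of_imp_subset by blast
  ultimately show ?thesis unfolding regular_triangulation_def triangulates_def using reg by blast
qed

lemma rational_measure_regular_simplex:
  assumes S: "regular_simplex S" "int k simplex S"
  shows "rational_measure k S = 1 / (fact k * real (simplex_den S))"
proof -
  have "maximal_simplexes {F. F face_of S} k = {S}"
  proof (intro equalityI subsetI)
    fix F assume "F \<in> maximal_simplexes {F. F face_of S} k"
    then show "F \<in> {S}" unfolding maximal_simplexes_def
      using face_of_refl[OF convex_simplex[OF S(2)]] face_of_imp_subset[of F S] by auto
  next
    fix F assume "F \<in> {S}"
    then show "F \<in> maximal_simplexes {F. F face_of S} k" unfolding maximal_simplexes_def
      using face_of_refl[OF convex_simplex[OF S(2)]] S(2) face_of_imp_subset by blast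
  qed
  then show ?thesis using rational_measure_eq[OF regular_triangulation_faces[OF S(1)], of k] by simp
qed

lemma den_integer_point: "integer_point x \<Longrightarrow> den x = 1"
  unfolding den_def by (rule Least_equality) (auto simp: integer_point_def)

text \<open>The apex has denominator 1, so both simplexes have the same product of denominators and
  only the factorials differ.\<close>

lemma rational_measure_pyramid:
  fixes v :: "nat \<Rightarrow> real ^ 'n"
  assumes k: "1 \<le> k" and S: "int k simplex (convex hull (v ` {0..k}))" "regular_simplex (convex hull (v ` {0..k}))"
    and v0: "integer_point (v 0)"
  shows "rational_measure k (convex hull (v ` {0..k})) = rational_measure (k - 1) (convex hull (v ` {1..k})) / real k"
proof -
  let ?S = "convex hull (v ` {0..k})"
  note V = simplex_vertices[OF S(1)]
  \<comment> \<open>A \<open>k\<close>-simplex has \<open>k + 1\<close> vertices, all among the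
    \<open>k + 1\<close> values of \<open>v\<close>; hence these values are distinct and are exactly
    the vertices.\<close>
  have sub: "vertices ?S \<subseteq> v ` {0..k}" unfolding vertices_def using extreme_point_of_convex_hull by blast
  have "card (vertices ?S) = Suc k" using V(2) by simp
  moreover have le: "card (v ` {0..k}) \<le> Suc k" using card_image_le[of "{0..k}" v] by simp
  moreover have "card (vertices ?S) \<le> card (v ` {0..k})" by (rule card_mono[OF _ sub]) simp
  ultimately have c: "card (v ` {0..k}) = Suc k" by simp
  then have inj: "inj_on v {0..k}" by (intro eq_card_imp_inj_on) auto
  have vS: "vertices ?S = v ` {0..k}" by (rule card_subset_eq[OF _ sub]) (use c V(2) in auto)
  have "v ` {1..k} \<subseteq> vertices ?S" unfolding vS by auto
  note F = regular_simplex_face[OF S(2) this]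
  have inj1: "inj_on v {1..k}" using inj by (rule inj_on_subset) auto
  then have "card (v ` {1..k}) = k" by (simp add: card_image)
  then have F3: "int (k - 1) simplex (convex hull (v ` {1..k}))" using F(3) k by (simp add: of_nat_diff)
  have "simplex_den ?S = (\<Prod>i\<in>{0..k}. den (v i))" unfolding simplex_den_def vS by (simp add: prod.reindex[OF inj])
  also have "\<dots> = (\<Prod>i\<in>insert 0 {1..k}. den (v i))" by (intro prod.cong) auto
  also have "\<dots> = (\<Prod>i\<in>{1..k}. den (v i))" by (simp add: den_integer_point[OF v0])
  also have "\<dots> = simplex_den (convex hull (v ` {1..k}))"
    unfolding simplex_den_def F(2) by (rule prod.reindex[OF inj1, symmetric, unfolded comp_def])
  finally have "simplex_den ?S = simplex_den (convex hull (v ` {1..k}))" .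
  moreover have "(fact k :: real) = real k * fact (k - 1)" using k by (simp add: fact_reduce)
  ultimately show ?thesis
    unfolding rational_measure_regular_simplex[OF S(2,1)] rational_measure_regular_simplex[OF F(1) F3]
    using k by (simp add: mult.commute mult.left_commute)
qed

section \<open>Counting lattice points by slices\<close>

text \<open>The lattice points of height \<open>q\<close> without their last coordinate, that is,
  the points of \<open>P\<close> whose denominator divides \<open>q\<close>, multiplied by
  \<open>q\<close>.\<close>

definition slice :: "(real ^ 'n) set \<Rightarrow> nat \<Rightarrow> (real ^ 'n) set" where
  "slice P q = {z. integer_point z \<and> (1 / real q) *\<^sub>R z \<in> P}"

lemma finite_slice:
  assumes "bounded P" "0 < q" shows "finite (slice P q)"
proof -
  have "finite {z \<in> (\<lambda>x. real q *\<^sub>R x) ` P. integer_point z}"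
    by (rule finite_integer_points) (rule bounded_scaling[OF assms(1)])
  moreover have "z \<in> (\<lambda>x. real q *\<^sub>R x) ` P" if "z \<in> slice P q" for z
    using that assms(2) by (intro image_eqI[of _ _ "(1 / real q) *\<^sub>R z"]) (auto simp: slice_def)
  then have "slice P q \<subseteq> {z \<in> (\<lambda>x. real q *\<^sub>R x) ` P. integer_point z}" by (auto simp: slice_def)
  ultimately show ?thesis by (rule rev_finite_subset)
qed

lemma card_lattice_points_slices:
  assumes "bounded P"
  shows "card (lattice_points P t) = (\<Sum>q=1..t. card (slice P q))"
proof -
  have "lattice_points P t = (\<Union>q\<in>{1..t}. (\<lambda>z. append_coord z (real q)) ` slice P q)"
  proof (intro equalityI subsetI)
    fix z assume z: "z \<in> lattice_points P t"
    then have h: "0 < z $ None" "z $ None \<le> real t" "integer_point z" "dehomog z \<in> P" by (auto simp: lattice_points_def)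
    then obtain m where m: "z $ None = of_int m" by (auto simp: integer_point_def elim: Ints_cases)
    define q where "q = nat m"
    have q: "z $ None = real q" "1 \<le> q" "q \<le> t" using h(1,2) m by (auto simp: q_def)
    let ?p = "\<chi> i. z $ Some i"
    have "(1 / real q) *\<^sub>R ?p = dehomog z" using q by (simp add: dehomog_def vec_eq_iff)
    then have "?p \<in> slice P q" using h by (auto simp: slice_def integer_point_def)
    moreover have "z = append_coord ?p (real q)" using q by (simp add: vec_option_eq_iff)
    ultimately show "z \<in> (\<Union>q\<in>{1..t}. (\<lambda>z. append_coord z (real q)) ` slice P q)" using q by auto
  next
    fix z assume "z \<in> (\<Union>q\<in>{1..t}. (\<lambda>z. append_coord z (real q)) ` slice P q)"
    then obtain q p where q: "1 \<le> q" "q \<le> t" "p \<in> slice P q" "z = append_coord p (real q)" by auto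
    have "dehomog z = (1 / real q) *\<^sub>R p" using q by (simp add: dehomog_def vec_eq_iff)
    moreover have "integer_point z" using q(3) unfolding q(4) integer_point_def slice_def
      by (auto simp: append_coord_def split: option.split)
    ultimately show "z \<in> lattice_points P t" using q by (auto simp: lattice_points_def slice_def)
  qed
  moreover have "card (\<Union>q\<in>{1..t}. (\<lambda>z. append_coord z (real q)) ` slice P q) = (\<Sum>q\<in>{1..t}. card ((\<lambda>z. append_coord z (real q)) ` slice P q))"
  proof (rule card_UN_disjoint)
    show "\<forall>q\<in>{1..t}. finite ((\<lambda>z. append_coord z (real q)) ` slice P q)" using finite_slice[OF assms] by simp
    show "\<forall>q\<in>{1..t}. \<forall>r\<in>{1..t}. q \<noteq> r \<longrightarrow> (\<lambda>z. append_coord z (real q)) ` slice P q \<inter> (\<lambda>z. append_coord z (real r)) ` slice P r = {}"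
      by (auto simp: vec_option_eq_iff)
  qed simp
  moreover have "card ((\<lambda>z. append_coord z (real q)) ` slice P q) = card (slice P q)" for q
    by (rule card_image) (auto simp: inj_on_def vec_option_eq_iff vec_eq_iff)
  ultimately show ?thesis by simp
qed

section \<open>From single heights to sums over heights\<close>

lemma cesaro_mean_zero:
  fixes a :: "nat \<Rightarrow> real"
  assumes "a \<longlonglongrightarrow> 0"
  shows "(\<lambda>t. (\<Sum>q=1..t. a q) / real t) \<longlonglongrightarrow> 0"
proof (rule LIMSEQ_I)
  fix r :: real assume "0 < r"
  then obtain N where N: "\<And>q. N \<le> q \<Longrightarrow> \<bar>a q\<bar> < r / 2" using LIMSEQ_D[OF assms, of "r / 2"] by auto
  define C where "C = (\<Sum>q\<in>{..<N}. \<bar>a q\<bar>)"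
  have C0: "0 \<le> C" by (simp add: C_def sum_nonneg)
  have "norm ((\<Sum>q=1..t. a q) / real t - 0) < r" if t: "nat \<lceil>2 * C / r\<rceil> + 1 \<le> t" for t
  proof -
    have "2 * C / r < real t" using t by linarith
    then have Ct: "C < r / 2 * real t" using \<open>0 < r\<close> by (simp add: field_simps)
    have "\<bar>a q\<bar> \<le> r / 2 + (if q < N then \<bar>a q\<bar> else 0)" for q using N[of q] \<open>0 < r\<close> by (cases "q < N") auto
    then have "\<bar>\<Sum>q=1..t. a q\<bar> \<le> (\<Sum>q=1..t. r / 2 + (if q < N then \<bar>a q\<bar> else 0))"
      by (intro order_trans[OF sum_abs] sum_mono)
    also have "\<dots> = real t * (r / 2) + (\<Sum>q\<in>{1..t} \<inter> {..<N}. \<bar>a q\<bar>)"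
      by (simp add: sum.distrib sum.If_cases lessThan_def)
    also have "(\<Sum>q\<in>{1..t} \<inter> {..<N}. \<bar>a q\<bar>) \<le> C" unfolding C_def by (intro sum_mono2) auto
    also have "real t * (r / 2) + C < r * real t" using Ct by (simp add: algebra_simps)
    finally have "\<bar>\<Sum>q=1..t. a q\<bar> < r * real t" by simp
    moreover have "0 < real t" using t by simp
    ultimately show ?thesis by (simp add: divide_less_eq abs_divide)
  qed
  then show "\<exists>no. \<forall>n\<ge>no. norm ((\<Sum>q=1..n. a q) / real n - 0) < r" by blast
qed

text \<open>A Stolz-Cesaro argument. The differences \<open>D q\<close> telescope to
  \<open>t ^ Suc m\<close> and are asymptotic to \<open>Suc m * q ^ m\<close>. So \<open>g q\<close>
  is of smaller order than \<open>q ^ m\<close>, and its sums are negligible by averaging.\<close>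

lemma sum_power_asymp:
  fixes f :: "nat \<Rightarrow> real"
  assumes "(\<lambda>q. f q / real q ^ m) \<longlonglongrightarrow> X"
  shows "(\<lambda>t. real (Suc m) * (\<Sum>q=1..t. f q) / real t ^ Suc m) \<longlonglongrightarrow> X"
proof -
  define D where "D q = real q ^ Suc m - (real q - 1) ^ Suc m" for q :: nat
  have D: "(\<lambda>q. D q / real q ^ m) \<longlonglongrightarrow> real (Suc m)"
  proof (rule tendsto_sandwich)
    show "eventually (\<lambda>q. real (Suc m) * (1 - 1 / real q) ^ m \<le> D q / real q ^ m) sequentially"
      using eventually_gt_at_top[of 0]
    proof eventually_elim
      case (elim q)
      have "real (Suc m) * (real q - 1) ^ m \<le> D q"
        using power_Suc_add_ge[of "real q - 1" 1 m] elim by (simp add: D_def)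
      moreover have "1 - 1 / real q = (real q - 1) / real q" using elim by (simp add: field_simps)
      ultimately show ?case by (simp add: power_divide divide_right_mono)
    qed
    show "eventually (\<lambda>q. D q / real q ^ m \<le> real (Suc m)) sequentially"
      using eventually_gt_at_top[of 0]
    proof eventually_elim
      case (elim q)
      have "D q \<le> real (Suc m) * real q ^ m"
        using power_Suc_add_le[of "real q - 1" 1 m] elim by (simp add: D_def)
      then show ?case using elim by (simp add: divide_le_eq)
    qed
    have "(\<lambda>q. real (Suc m) * (1 - 1 / real q) ^ m) \<longlonglongrightarrow> real (Suc m) * (1 - 0) ^ m"
      by (intro tendsto_intros lim_const_over_n)
    then show "(\<lambda>q. real (Suc m) * (1 - 1 / real q) ^ m) \<longlonglongrightarrow> real (Suc m)" by simp
  qed simp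
  define g where "g q = real (Suc m) * f q - X * D q" for q
  have "(\<lambda>q. real (Suc m) * (f q / real q ^ m) - X * (D q / real q ^ m)) \<longlonglongrightarrow> real (Suc m) * X - X * real (Suc m)"
    by (intro tendsto_diff tendsto_mult_left assms D)
  then have "(\<lambda>q. g q / real q ^ m) \<longlonglongrightarrow> 0" by (simp add: g_def diff_divide_distrib)
  then have "(\<lambda>q. \<bar>g q / real q ^ m\<bar>) \<longlonglongrightarrow> 0" by (rule tendsto_rabs_zero)
  from cesaro_mean_zero[OF this] have c: "(\<lambda>t. (\<Sum>q=1..t. \<bar>g q / real q ^ m\<bar>) / real t) \<longlonglongrightarrow> 0" .
  have G: "(\<lambda>t. (\<Sum>q=1..t. g q) / real t ^ Suc m) \<longlonglongrightarrow> 0"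
  proof (rule Lim_null_comparison[OF _ c])
    show "\<forall>\<^sub>F t in sequentially. norm ((\<Sum>q=1..t. g q) / real t ^ Suc m) \<le> (\<Sum>q=1..t. \<bar>g q / real q ^ m\<bar>) / real t"
      using eventually_gt_at_top[of 0]
    proof eventually_elim
      case (elim t)
      have "\<bar>\<Sum>q=1..t. g q\<bar> \<le> (\<Sum>q=1..t. \<bar>g q\<bar>)" by (rule sum_abs)
      also have "\<dots> \<le> (\<Sum>q=1..t. \<bar>g q / real q ^ m\<bar> * real t ^ m)"
      proof (rule sum_mono)
        fix q assume q: "q \<in> {1..t}"
        then have "\<bar>g q\<bar> = \<bar>g q / real q ^ m\<bar> * real q ^ m" by (simp add: abs_divide)
        also have "\<dots> \<le> \<bar>g q / real q ^ m\<bar> * real t ^ m" using q by (intro mult_left_mono power_mono) auto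
        finally show "\<bar>g q\<bar> \<le> \<bar>g q / real q ^ m\<bar> * real t ^ m" .
      qed
      also have "\<dots> = (\<Sum>q=1..t. \<bar>g q / real q ^ m\<bar>) * real t ^ m" by (simp only: sum_distrib_right)
      finally show ?case using elim by (simp add: abs_divide divide_le_eq field_simps)
    qed
  qed
  have sD: "(\<Sum>q=1..t. D q) = real t ^ Suc m" for t
    by (induction t) (simp_all add: D_def)
  have "(\<lambda>t. (\<Sum>q=1..t. g q) / real t ^ Suc m + X) \<longlonglongrightarrow> 0 + X" by (intro tendsto_add G tendsto_const)
  moreover have "\<forall>\<^sub>F t in sequentially. (\<Sum>q=1..t. g q) / real t ^ Suc m + X = real (Suc m) * (\<Sum>q=1..t. f q) / real t ^ Suc m"
    using eventually_gt_at_top[of 0]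
  proof eventually_elim
    case (elim t)
    have "(\<Sum>q=1..t. g q) = real (Suc m) * (\<Sum>q=1..t. f q) - X * real t ^ Suc m"
      unfolding g_def sum_subtractf sum_distrib_left[symmetric] sD ..
    then show ?case using elim by (simp add: diff_divide_distrib del: power_Suc)
  qed
  ultimately show ?thesis by (simp add: tendsto_cong)
qed

text \<open>No explicit triangulation of the parallelepiped is written down. A point of denominator
  dividing \<open>q\<close> has coefficients among the \<open>q + 1\<close> multiples of
  \<open>1 / q\<close> in the unit interval, which gives \<open>(q + 1) ^ j\<close> points at height
  \<open>q\<close>.\<close>

lemma rational_measure_parallelepiped:
  fixes B :: "(int ^ 'n) set"
  assumes B: "card B = j" "part_of_int_basis B"
  shows "rational_measure j {x. \<exists>\<gamma>. (\<forall>w\<in>B. 0 \<le> \<gamma> w \<and> \<gamma> w \<le> 1) \<and> x = (\<Sum>w\<in>B. \<gamma> w *\<^sub>R of_int_vec w)} = 1"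
    (is "rational_measure j ?P = 1")
proof -
  define W where "W = of_int_vec ` B"
  have injB: "inj_on of_int_vec B" using inj_of_int_vec inj_on_subset by blast
  have cW: "card W = j" using B(1) injB by (simp add: W_def card_image)
  have uW: "unimodular W" using B(2) unfolding W_def part_of_int_basis_iff_unimodular .
  have finW: "finite W" using unimodular_finite[OF uW] .
  obtain U \<phi> where U: "W \<subseteq> U" "dual_basis U \<phi>" using uW unfolding unimodular_def by blast
  note D = dual_basisD[OF U(2)]
  have coeff: "\<phi> b \<bullet> (\<Sum>w\<in>W. c w *\<^sub>R w) = (if b \<in> W then c b else 0)" if "b \<in> U" for c b
    using dual_coeff[OF U(2,1) that] .
  define P where "P = {x. \<exists>c. (\<forall>w\<in>W. 0 \<le> c w \<and> c w \<le> 1) \<and> x = (\<Sum>w\<in>W. c w *\<^sub>R w)}"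
  have P_W: "?P = P" unfolding P_def
  proof (intro Collect_cong iffI)
    fix x assume "\<exists>\<gamma>. (\<forall>w\<in>B. 0 \<le> \<gamma> w \<and> \<gamma> w \<le> 1) \<and> x = (\<Sum>w\<in>B. \<gamma> w *\<^sub>R of_int_vec w)"
    then obtain \<gamma> where "\<forall>w\<in>B. 0 \<le> \<gamma> w \<and> \<gamma> w \<le> 1" "x = (\<Sum>w\<in>B. \<gamma> w *\<^sub>R of_int_vec w)" by blast
    then show "\<exists>c. (\<forall>w\<in>W. 0 \<le> c w \<and> c w \<le> 1) \<and> x = (\<Sum>w\<in>W. c w *\<^sub>R w)"
      by (intro exI[of _ "\<lambda>w. \<gamma> (inv of_int_vec w)"]) (simp add: W_def sum.reindex[OF injB] inv_f_f[OF inj_of_int_vec])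
  next
    fix x assume "\<exists>c. (\<forall>w\<in>W. 0 \<le> c w \<and> c w \<le> 1) \<and> x = (\<Sum>w\<in>W. c w *\<^sub>R w)"
    then obtain c where "\<forall>w\<in>W. 0 \<le> c w \<and> c w \<le> 1" "x = (\<Sum>w\<in>W. c w *\<^sub>R w)" by blast
    then show "\<exists>\<gamma>. (\<forall>w\<in>B. 0 \<le> \<gamma> w \<and> \<gamma> w \<le> 1) \<and> x = (\<Sum>w\<in>B. \<gamma> w *\<^sub>R of_int_vec w)"
      by (intro exI[of _ "\<lambda>w. c (of_int_vec w)"]) (simp add: W_def sum.reindex[OF injB])
  qed
  have mem: "x \<in> P \<longleftrightarrow> (\<forall>b\<in>U. if b \<in> W then 0 \<le> \<phi> b \<bullet> x \<and> \<phi> b \<bullet> x - 1 \<le> 0 else \<phi> b \<bullet> x = 0)" for x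
  proof
    assume "x \<in> P"
    then obtain c where c: "\<forall>w\<in>W. 0 \<le> c w \<and> c w \<le> 1" "x = (\<Sum>w\<in>W. c w *\<^sub>R w)" unfolding P_def by blast
    show "\<forall>b\<in>U. if b \<in> W then 0 \<le> \<phi> b \<bullet> x \<and> \<phi> b \<bullet> x - 1 \<le> 0 else \<phi> b \<bullet> x = 0"
      unfolding c(2) using coeff c(1) by simp
  next
    assume R: "\<forall>b\<in>U. if b \<in> W then 0 \<le> \<phi> b \<bullet> x \<and> \<phi> b \<bullet> x - 1 \<le> 0 else \<phi> b \<bullet> x = 0"
    have "x = (\<Sum>b\<in>U. (\<phi> b \<bullet> x) *\<^sub>R b)" using D(5) by simp
    also have "\<dots> = (\<Sum>b\<in>W. (\<phi> b \<bullet> x) *\<^sub>R b)" using R U(1) D(1) by (intro sum.mono_neutral_right) auto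
    finally have x: "x = (\<Sum>b\<in>W. (\<phi> b \<bullet> x) *\<^sub>R b)" .
    have c: "0 \<le> \<phi> w \<bullet> x \<and> \<phi> w \<bullet> x \<le> 1" if "w \<in> W" for w
      using R[rule_format, OF subsetD[OF U(1) that]] that by simp
    show "x \<in> P" unfolding P_def
      by (rule CollectI, rule exI[of _ "\<lambda>b. \<phi> b \<bullet> x"]) (use x c in blast)
  qed
  \<comment> \<open>Last coordinate \<open>0\<close> compares \<open>\<phi> b \<bullet> x\<close>
    with 0, and last coordinate \<open>- 1\<close> compares it with 1.\<close>
  define F where "F = (\<lambda>b. append_coord (\<phi> b) 0) ` U \<union> (\<lambda>b. append_coord (\<phi> b) (- 1)) ` U"
  have inner: "append_coord f c \<bullet> lift1 x = f \<bullet> x + c" for f x :: "real ^ 'n" and c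
    by (simp add: inner_vec_def sum_UNIV_option)
  have "sign_determined F P"
    unfolding sign_determined_def
  proof (intro conjI ballI allI impI)
    show "finite F" using D(1) by (simp add: F_def)
    have "integer_point (append_coord (\<phi> b) c)" if "b \<in> U" "c \<in> \<int>" for b c
      using D(3)[OF that(1)] that(2) unfolding integer_point_def by (auto simp: append_coord_def split: option.split)
    then show "integer_point f" if "f \<in> F" for f using that by (auto simp: F_def)
    fix x y assume x: "x \<in> P" and sg: "\<forall>f\<in>F. sgn (f \<bullet> lift1 x) = sgn (f \<bullet> lift1 y)"
    have sgnD: "0 \<le> r \<longleftrightarrow> 0 \<le> s" "r = 0 \<longleftrightarrow> s = 0" "r \<le> 0 \<longleftrightarrow> s \<le> 0" if "sgn r = sgn s" for r s :: real
      using that by (auto simp: sgn_if split: if_splits)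
    have "if b \<in> W then 0 \<le> \<phi> b \<bullet> y \<and> \<phi> b \<bullet> y - 1 \<le> 0 else \<phi> b \<bullet> y = 0" if b: "b \<in> U" for b
    proof -
      have e: "sgn (\<phi> b \<bullet> x) = sgn (\<phi> b \<bullet> y)" "sgn (\<phi> b \<bullet> x - 1) = sgn (\<phi> b \<bullet> y - 1)"
        using sg[unfolded F_def, rule_format, of "append_coord (\<phi> b) 0"] sg[unfolded F_def, rule_format, of "append_coord (\<phi> b) (- 1)"] b
        by (simp_all add: inner)
      show ?thesis using x[unfolded mem, rule_format, OF b]
        unfolding sgnD(1,2)[OF e(1)] sgnD(3)[OF e(2)] .
    qed
    then show "y \<in> P" unfolding mem by blast
  qed
  moreover have "closed P"
  proof -
    define H where "H b = {x. if b \<in> W then 0 \<le> \<phi> b \<bullet> x \<and> \<phi> b \<bullet> x - 1 \<le> 0 else \<phi> b \<bullet> x = 0}" for b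
    have eq: "P = (\<Inter>b\<in>U. H b)" using mem by (auto simp only: H_def)
    have "closed (H b)" for b unfolding H_def
      by (cases "b \<in> W") (auto intro!: closed_Collect_conj closed_Collect_le closed_Collect_eq continuous_intros)
    then show ?thesis unfolding eq by (intro closed_INT ballI)
  qed
  moreover have bdd: "bounded P"
  proof -
    have "norm x \<le> (\<Sum>w\<in>W. norm w)" if x: "x \<in> P" for x
    proof -
      obtain c where c: "\<forall>w\<in>W. 0 \<le> c w \<and> c w \<le> 1" "x = (\<Sum>w\<in>W. c w *\<^sub>R w)" using x unfolding P_def by blast
      have "norm (c w *\<^sub>R w) \<le> norm w" if "w \<in> W" for w using c(1) that by (simp add: mult_left_le_one_le)
      then show ?thesis unfolding c(2) by (intro sum_norm_le)
    qed
    then show ?thesis unfolding bounded_iff by blast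
  qed
  ultimately obtain T where T: "regular_triangulation T P" using regular_triangulation_exists by metis
  have dim: "aff_dim S \<le> int j" if S: "S \<in> T" for S
  proof -
    have "S \<subseteq> P" using S T by (auto simp: regular_triangulation_def triangulates_def)
    also have "\<dots> \<subseteq> span W" unfolding P_def by (auto intro: span_sum span_scale span_base)
    finally have "aff_dim S \<le> aff_dim (span W)" by (rule aff_dim_subset)
    also have "\<dots> = int (dim (span W))" by (rule aff_dim_subspace) simp
    also have "dim (span W) = j" using dim_eq_card_independent[OF unimodular_independent[OF uW]] cW by simp
    finally show ?thesis by simp
  qed
  have slice: "card (slice P q) = (q + 1) ^ j" if q: "0 < q" for q
  proof -
    have "bij_betw (\<lambda>k. \<Sum>w\<in>W. real (k w) *\<^sub>R w) (W \<rightarrow>\<^sub>E {0..q}) (slice P q)"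
    proof (rule bij_betw_imageI)
      show "inj_on (\<lambda>k. \<Sum>w\<in>W. real (k w) *\<^sub>R w) (W \<rightarrow>\<^sub>E {0..q})"
      proof (rule inj_onI)
        fix k l assume kl: "k \<in> W \<rightarrow>\<^sub>E {0..q}" "l \<in> W \<rightarrow>\<^sub>E {0..q}" "(\<Sum>w\<in>W. real (k w) *\<^sub>R w) = (\<Sum>w\<in>W. real (l w) *\<^sub>R w)"
        have "k w = l w" if w: "w \<in> W" for w
          using coeff[of w "\<lambda>w. real (k w)"] coeff[of w "\<lambda>w. real (l w)"] kl(3) w U(1) by auto
        then show "k = l" using kl(1,2) by (intro PiE_ext)
      qed
      show "(\<lambda>k. \<Sum>w\<in>W. real (k w) *\<^sub>R w) ` (W \<rightarrow>\<^sub>E {0..q}) = slice P q"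
      proof (intro equalityI subsetI)
        fix z assume "z \<in> (\<lambda>k. \<Sum>w\<in>W. real (k w) *\<^sub>R w) ` (W \<rightarrow>\<^sub>E {0..q})"
        then obtain k where k: "k \<in> W \<rightarrow>\<^sub>E {0..q}" "z = (\<Sum>w\<in>W. real (k w) *\<^sub>R w)" by blast
        have "integer_point z" unfolding k(2) using unimodular_integer[OF uW] by (intro integer_point_sum) auto
        moreover have "(1 / real q) *\<^sub>R z = (\<Sum>w\<in>W. (real (k w) / real q) *\<^sub>R w)" unfolding k(2) by (simp add: scaleR_sum_right)
        then have "(1 / real q) *\<^sub>R z \<in> P" unfolding P_def using k(1) q by (intro CollectI exI[of _ "\<lambda>w. real (k w) / real q"]) (auto simp: PiE_iff)
        ultimately show "z \<in> slice P q" by (simp add: slice_def)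
      next
        fix z assume "z \<in> slice P q"
        then have iz: "integer_point z" and zP: "(1 / real q) *\<^sub>R z \<in> P" by (auto simp: slice_def)
        obtain c where c: "\<forall>w\<in>W. 0 \<le> c w \<and> c w \<le> 1" "(1 / real q) *\<^sub>R z = (\<Sum>w\<in>W. c w *\<^sub>R w)" using zP unfolding P_def by blast
        have "z = real q *\<^sub>R ((1 / real q) *\<^sub>R z)" using q by simp
        also have "\<dots> = (\<Sum>w\<in>W. (real q * c w) *\<^sub>R w)" unfolding c(2) by (simp add: scaleR_sum_right)
        finally have z: "z = (\<Sum>w\<in>W. (real q * c w) *\<^sub>R w)" .
        define k where "k = restrict (\<lambda>w. nat \<lfloor>real q * c w\<rfloor>) W"
        have ck: "real (k w) = real q * c w" "k w \<le> q" if w: "w \<in> W" for w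
        proof -
          have "\<phi> w \<bullet> z = real q * c w" using coeff[of w "\<lambda>w. real q * c w"] w U(1) z by auto
          then have "real q * c w \<in> \<int>" using integer_point_inner[OF D(3) iz] w U(1) by (metis subsetD)
          then obtain n where n: "real q * c w = of_int n" by (auto elim: Ints_cases)
          have "0 \<le> real q * c w" "real q * c w \<le> real q" using c(1) w by (auto intro: mult_left_le)
          then show "real (k w) = real q * c w" "k w \<le> q" using w n by (auto simp: k_def)
        qed
        have "k \<in> extensional W" unfolding k_def by (rule restrict_extensional)
        then have "k \<in> W \<rightarrow>\<^sub>E {0..q}" using ck(2) unfolding PiE_iff by simp
        moreover have "z = (\<Sum>w\<in>W. real (k w) *\<^sub>R w)" unfolding z using ck(1) by (intro sum.cong) auto
        ultimately show "z \<in> (\<lambda>k. \<Sum>w\<in>W. real (k w) *\<^sub>R w) ` (W \<rightarrow>\<^sub>E {0..q})" by blast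
      qed
    qed
    then have "card (slice P q) = card (W \<rightarrow>\<^sub>E {0..q})" by (rule bij_betw_same_card[symmetric])
    then show ?thesis using finW cW by (simp add: card_PiE)
  qed
  have count: "card (lattice_points P t) = (\<Sum>q=1..t. (q + 1) ^ j)" for t
    unfolding card_lattice_points_slices[OF bdd] using slice by (intro sum.cong) auto
  have lim: "(\<lambda>t. real (Suc j) * (\<Sum>q=1..t. real ((q + 1) ^ j)) / real t ^ Suc j) \<longlonglongrightarrow> 1"
  proof (rule sum_power_asymp)
    have "(\<lambda>q. (1 + 1 / real q) ^ j) \<longlonglongrightarrow> (1 + 0) ^ j" by (intro tendsto_intros lim_const_over_n)
    moreover have "\<forall>\<^sub>F q in sequentially. (1 + 1 / real q) ^ j = real ((q + 1) ^ j) / real q ^ j"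
      using eventually_gt_at_top[of 0]
    proof eventually_elim
      case (elim q)
      have "1 + 1 / real q = real (q + 1) / real q" using elim by (simp add: field_simps)
      then show ?case by (simp add: power_divide)
    qed
    ultimately show "(\<lambda>q. real ((q + 1) ^ j) / real q ^ j) \<longlonglongrightarrow> 1" by (simp add: tendsto_cong)
  qed
  have "(\<lambda>t. real (Suc j) * (\<Sum>q=1..t. real ((q + 1) ^ j)) / real t ^ Suc j) \<longlonglongrightarrow> rational_measure j P"
    using rational_measure_limit_low_dim[OF T dim] unfolding count by simp
  then have "rational_measure j P = 1" using LIMSEQ_unique lim by blast
  then show ?thesis unfolding P_W .
qed


section \<open>Hausdorff measure\<close>

text \<open>Lets near-optimal covers of two sets be chosen independently of each other.\<close>

lemma le_INF_add_INF_ennreal: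
  fixes f g :: "_ \<Rightarrow> ennreal"
  assumes "\<And>a b. a \<in> A \<Longrightarrow> b \<in> B \<Longrightarrow> z \<le> f a + g b"
  shows "z \<le> (INF a\<in>A. f a) + (INF b\<in>B. g b)"
proof (rule ennreal_le_epsilon)
  fix e :: real assume fin: "(INF a\<in>A. f a) + (INF b\<in>B. g b) < top" and e: "0 < e"
  have near: "\<exists>a\<in>A. h a < (INF a\<in>A. h a) + ennreal (e / 2)" if "(INF a\<in>A. h a) < top" for h :: "_ \<Rightarrow> ennreal" and A
  proof -
    have "(INF a\<in>A. h a) < (INF a\<in>A. h a) + ennreal (e / 2)"
      using that e by (cases "INF a\<in>A. h a") (auto simp: ennreal_less_iff simp flip: ennreal_plus)
    then show ?thesis by (simp only: INF_less_iff)
  qed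
  obtain a where a: "a \<in> A" "f a < (INF a\<in>A. f a) + ennreal (e / 2)" using near[of f A] fin by auto
  obtain b where b: "b \<in> B" "g b < (INF b\<in>B. g b) + ennreal (e / 2)" using near[of g B] fin by auto
  have "z \<le> f a + g b" using assms a b by blast
  also have "\<dots> \<le> ((INF a\<in>A. f a) + ennreal (e / 2)) + ((INF b\<in>B. g b) + ennreal (e / 2))"
    using a b by (intro add_mono) auto
  also have "\<dots> = (INF a\<in>A. f a) + (INF b\<in>B. g b) + (ennreal (e / 2) + ennreal (e / 2))" by (simp only: ac_simps)
  also have "ennreal (e / 2) + ennreal (e / 2) = ennreal e" using e by (simp flip: ennreal_plus)
  finally show "z \<le> (INF a\<in>A. f a) + (INF b\<in>B. g b) + ennreal e" .
qed

lemma hausdorff_gauge_empty [simp]: "hausdorff_gauge m {} = 0"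
  by (simp add: hausdorff_gauge_def)

lemma hausdorff_premeasure_le:
  assumes "E \<subseteq> (\<Union>i. C i)" "\<And>i. bounded (C i)" "\<And>i. diameter (C i) \<le> \<delta>"
  shows "hausdorff_premeasure m \<delta> E \<le> (\<Sum>i. hausdorff_gauge m (C (i::nat)))"
  unfolding hausdorff_premeasure_def using assms by (intro INF_lower) auto

lemma hausdorff_premeasure_greatest:
  assumes "\<And>C :: nat \<Rightarrow> 'a set. E \<subseteq> (\<Union>i. C i) \<Longrightarrow> (\<And>i. bounded (C i)) \<Longrightarrow> (\<And>i. diameter (C i) \<le> \<delta>) \<Longrightarrow> z \<le> (\<Sum>i. hausdorff_gauge m (C i))"
  shows "z \<le> hausdorff_premeasure m \<delta> (E :: 'a::metric_space set)"
  unfolding hausdorff_premeasure_def using assms by (intro INF_greatest) auto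

lemma hausdorff_premeasure_mono: "E \<subseteq> F \<Longrightarrow> hausdorff_premeasure m \<delta> E \<le> hausdorff_premeasure m \<delta> F"
  by (rule hausdorff_premeasure_greatest, rule hausdorff_premeasure_le) auto

lemma hausdorff_premeasure_antimono: "\<delta> \<le> \<delta>' \<Longrightarrow> hausdorff_premeasure m \<delta>' E \<le> hausdorff_premeasure m \<delta> E"
  by (rule hausdorff_premeasure_greatest, rule hausdorff_premeasure_le) (auto intro: order_trans)

lemma hausdorff_premeasure_le_measure: "0 < \<delta> \<Longrightarrow> hausdorff_premeasure m \<delta> E \<le> hausdorff_measure m E"
  unfolding hausdorff_measure_def by (rule SUP_upper) simp

lemma hausdorff_measure_least: "(\<And>\<delta>. 0 < \<delta> \<Longrightarrow> hausdorff_premeasure m \<delta> E \<le> z) \<Longrightarrow> hausdorff_measure m E \<le> z"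
  unfolding hausdorff_measure_def by (rule SUP_least) simp

lemma hausdorff_measure_mono: "E \<subseteq> F \<Longrightarrow> hausdorff_measure m E \<le> hausdorff_measure m F"
  by (rule hausdorff_measure_least, rule order_trans[OF hausdorff_premeasure_mono hausdorff_premeasure_le_measure])

text \<open>A cover of \<open>E\<close> and a cover of \<open>F\<close> are interleaved along even
  and odd indices.\<close>

lemma hausdorff_premeasure_Un: 
  "hausdorff_premeasure m \<delta> (E \<union> F) \<le> hausdorff_premeasure m \<delta> E + hausdorff_premeasure m \<delta> F"
proof -
  have "hausdorff_premeasure m \<delta> (E \<union> F) \<le> (\<Sum>i. hausdorff_gauge m (C i)) + (\<Sum>i. hausdorff_gauge m (D i))"
    if C: "E \<subseteq> (\<Union>i. C i)" "\<And>i. bounded (C i)" "\<And>i. diameter (C i) \<le> \<delta>"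
      and D: "F \<subseteq> (\<Union>i. D i)" "\<And>i. bounded (D i)" "\<And>i. diameter (D i) \<le> \<delta>" for C D :: "nat \<Rightarrow> 'a set"
  proof -
    define G where "G i = (if even i then C (i div 2) else D (i div 2))" for i :: nat
    have "C i = G (2 * i)" "D i = G (Suc (2 * i))" for i by (simp_all add: G_def)
    then have "(\<Union>i. C i) \<union> (\<Union>i. D i) \<subseteq> (\<Union>i. G i)" by auto
    then have "E \<union> F \<subseteq> (\<Union>i. G i)" using C(1) D(1) by (meson Un_mono order_trans)
    then have "hausdorff_premeasure m \<delta> (E \<union> F) \<le> (\<Sum>i. hausdorff_gauge m (G i))"
      using C D by (intro hausdorff_premeasure_le) (auto simp: G_def)
    also have "\<dots> \<le> (\<Sum>i. hausdorff_gauge m (C i)) + (\<Sum>i. hausdorff_gauge m (D i))"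
    proof (rule suminf_le_const[OF summableI])
      fix n
      have "(\<Sum>i<2 * n. hausdorff_gauge m (G i)) = (\<Sum>i<n. hausdorff_gauge m (C i)) + (\<Sum>i<n. hausdorff_gauge m (D i))"
        by (induction n) (simp_all add: G_def ac_simps)
      also have "\<dots> \<le> (\<Sum>i. hausdorff_gauge m (C i)) + (\<Sum>i. hausdorff_gauge m (D i))"
        by (intro add_mono sum_le_suminf summableI) auto
      finally show "(\<Sum>i<n. hausdorff_gauge m (G i)) \<le> (\<Sum>i. hausdorff_gauge m (C i)) + (\<Sum>i. hausdorff_gauge m (D i))"
        by (rule order_trans[rotated]) (auto intro!: sum_mono2)
    qed
    finally show ?thesis .
  qed
  then show ?thesis
    unfolding hausdorff_premeasure_def[of m \<delta> E] hausdorff_premeasure_def[of m \<delta> F]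
    by (intro le_INF_add_INF_ennreal) blast
qed

lemma hausdorff_premeasure_empty [simp]: "hausdorff_premeasure m \<delta> {} = 0" if "0 < \<delta>"
proof -
  have "hausdorff_premeasure m \<delta> ({} :: 'a set) \<le> (\<Sum>i::nat. hausdorff_gauge m ({} :: 'a set))"
    by (rule hausdorff_premeasure_le) (use that in auto)
  then show ?thesis by simp
qed

lemma hausdorff_measure_empty [simp]: "hausdorff_measure m {} = 0"
proof -
  have "hausdorff_measure m ({} :: 'a set) \<le> 0" by (rule hausdorff_measure_least) simp
  then show ?thesis by simp
qed

lemma hausdorff_premeasure_UN:
  assumes "finite I" "0 < \<delta>"
  shows "hausdorff_premeasure m \<delta> (\<Union>i\<in>I. E i) \<le> (\<Sum>i\<in>I. hausdorff_premeasure m \<delta> (E i))"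
  using assms
proof (induction I rule: finite_induct)
  case (insert i I)
  then show ?case
    by simp (meson add_left_mono hausdorff_premeasure_Un order_trans)
qed simp

lemma hausdorff_measure_UN:
  assumes "finite I"
  shows "hausdorff_measure m (\<Union>i\<in>I. E i) \<le> (\<Sum>i\<in>I. hausdorff_measure m (E i))"
  by (rule hausdorff_measure_least, rule order_trans[OF hausdorff_premeasure_UN[OF assms]], assumption)
    (auto intro: sum_mono hausdorff_premeasure_le_measure)

lemma hausdorff_premeasure_le_gauge:
  assumes "bounded C" "diameter C \<le> \<delta>" "0 < \<delta>"
  shows "hausdorff_premeasure m \<delta> C \<le> hausdorff_gauge m C"
proof -
  let ?C = "\<lambda>i::nat. if i = 0 then C else {}"
  have "hausdorff_premeasure m \<delta> C \<le> (\<Sum>i. hausdorff_gauge m (?C i))"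
    by (rule hausdorff_premeasure_le) (use assms in \<open>auto split: if_splits\<close>)
  also have "\<dots> = (\<Sum>i\<in>{0}. hausdorff_gauge m (?C i))" by (rule suminf_finite) auto
  finally show ?thesis by simp
qed

lemma hausdorff_gauge_mono:
  assumes "C \<subseteq> D" "bounded D" shows "hausdorff_gauge m C \<le> hausdorff_gauge m D"
proof -
  have "diameter C \<le> diameter D" "0 \<le> diameter C"
    using assms diameter_subset diameter_ge_0 bounded_subset by blast+
  then show ?thesis using assms(1)
    by (auto simp: hausdorff_gauge_def intro!: ennreal_leI mult_left_mono power_mono divide_right_mono)
qed

text \<open>A covering set of diameter below \<open>r\<close> meets at most one of the two sets, so
  a fine cover splits into a cover of each. Restricting to small \<open>\<delta>\<close> is harmless
  because premeasures grow as \<open>\<delta>\<close> shrinks.\<close>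

lemma hausdorff_measure_separated:
  assumes "0 < r" "\<And>x y. x \<in> E \<Longrightarrow> y \<in> F \<Longrightarrow> r \<le> dist x y"
  shows "hausdorff_measure m E + hausdorff_measure m F \<le> hausdorff_measure m (E \<union> F)"
proof -
  have pre: "hausdorff_premeasure m \<delta> E + hausdorff_premeasure m \<delta> F \<le> hausdorff_premeasure m \<delta> (E \<union> F)"
    if \<delta>: "0 < \<delta>" "\<delta> < r" for \<delta>
  proof (rule hausdorff_premeasure_greatest)
    fix C :: "nat \<Rightarrow> 'a set"
    assume C: "E \<union> F \<subseteq> (\<Union>i. C i)" "\<And>i. bounded (C i)" "\<And>i. diameter (C i) \<le> \<delta>"
    have "C i \<inter> E = {} \<or> C i \<inter> F = {}" for i
    proof (rule ccontr)
      assume "\<not> ?thesis"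
      then obtain x y where xy: "x \<in> C i" "x \<in> E" "y \<in> C i" "y \<in> F" by blast
      then have "r \<le> dist x y" using assms(2) by blast
      also have "\<dots> \<le> diameter (C i)" using diameter_bounded_bound[OF C(2)] xy by blast
      finally show False using C(3)[of i] \<delta> by simp
    qed
    then have g: "hausdorff_gauge m (C i \<inter> E) + hausdorff_gauge m (C i \<inter> F) \<le> hausdorff_gauge m (C i)" for i
      using hausdorff_gauge_mono[OF _ C(2), of "C i \<inter> E" i m] hausdorff_gauge_mono[OF _ C(2), of "C i \<inter> F" i m]
      by (metis Int_lower1 add.left_neutral add.right_neutral hausdorff_gauge_empty)
    have le: "hausdorff_premeasure m \<delta> X \<le> (\<Sum>i. hausdorff_gauge m (C i \<inter> X))" if "X \<subseteq> E \<union> F" for X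
    proof (rule hausdorff_premeasure_le)
      show "X \<subseteq> (\<Union>i. C i \<inter> X)" using C(1) that by blast
      show "bounded (C i \<inter> X)" for i using C(2) by (meson Int_lower1 bounded_subset)
      show "diameter (C i \<inter> X) \<le> \<delta>" for i using diameter_subset[OF Int_lower1 C(2)] C(3) order_trans by blast
    qed
    have "hausdorff_premeasure m \<delta> E + hausdorff_premeasure m \<delta> F \<le> (\<Sum>i. hausdorff_gauge m (C i \<inter> E)) + (\<Sum>i. hausdorff_gauge m (C i \<inter> F))"
      by (intro add_mono le) auto
    also have "\<dots> = (\<Sum>i. hausdorff_gauge m (C i \<inter> E) + hausdorff_gauge m (C i \<inter> F))"
      by (rule suminf_add) (rule summableI)+
    also have "\<dots> \<le> (\<Sum>i. hausdorff_gauge m (C i))" by (intro suminf_le g summableI)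
    finally show "hausdorff_premeasure m \<delta> E + hausdorff_premeasure m \<delta> F \<le> (\<Sum>i. hausdorff_gauge m (C i))" .
  qed
  have "hausdorff_measure m E + hausdorff_measure m F =
     (SUP \<delta>\<in>{0<..}. hausdorff_premeasure m \<delta> E + hausdorff_premeasure m \<delta> F)"
    unfolding hausdorff_measure_def
  proof (rule SUP_add_directed_ennreal[symmetric])
    fix i j :: real assume "i \<in> {0<..}" "j \<in> {0<..}"
    then show "\<exists>k\<in>{0<..}. hausdorff_premeasure m i E + hausdorff_premeasure m j F \<le> hausdorff_premeasure m k E + hausdorff_premeasure m k F"
      by (intro bexI[of _ "min i j"] add_mono hausdorff_premeasure_antimono) auto
  qed
  also have "\<dots> \<le> hausdorff_measure m (E \<union> F)"
  proof (rule SUP_least)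
    fix \<delta> :: real assume "\<delta> \<in> {0<..}"
    then have k: "0 < min \<delta> (r / 2)" "min \<delta> (r / 2) < r" using assms(1) by auto
    have "hausdorff_premeasure m \<delta> E + hausdorff_premeasure m \<delta> F \<le> hausdorff_premeasure m (min \<delta> (r / 2)) E + hausdorff_premeasure m (min \<delta> (r / 2)) F"
      by (intro add_mono hausdorff_premeasure_antimono) auto
    also have "\<dots> \<le> hausdorff_measure m (E \<union> F)" using pre[OF k] hausdorff_premeasure_le_measure[OF k(1)] order_trans by blast
    finally show "hausdorff_premeasure m \<delta> E + hausdorff_premeasure m \<delta> F \<le> hausdorff_measure m (E \<union> F)" .
  qed
  finally show ?thesis .
qed

lemma hausdorff_measure_UN_separated:
  assumes "finite I" "0 < r"
    and "\<And>i j x y. i \<in> I \<Longrightarrow> j \<in> I \<Longrightarrow> i \<noteq> j \<Longrightarrow> x \<in> E i \<Longrightarrow> y \<in> E j \<Longrightarrow> r \<le> dist x y"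
  shows "(\<Sum>i\<in>I. hausdorff_measure m (E i)) \<le> hausdorff_measure m (\<Union>i\<in>I. E i)"
  using assms(1,3)
proof (induction I rule: finite_induct)
  case (insert i I)
  have "(\<Sum>j\<in>insert i I. hausdorff_measure m (E j)) = hausdorff_measure m (E i) + (\<Sum>j\<in>I. hausdorff_measure m (E j))"
    using insert by simp
  also have "\<dots> \<le> hausdorff_measure m (E i) + hausdorff_measure m (\<Union>j\<in>I. E j)"
    using insert by (intro add_left_mono insert.IH) auto
  also have "\<dots> \<le> hausdorff_measure m (E i \<union> (\<Union>j\<in>I. E j))"
  proof (rule hausdorff_measure_separated[OF assms(2)])
    fix x y assume "x \<in> E i" "y \<in> (\<Union>j\<in>I. E j)"
    then obtain j where "j \<in> I" "y \<in> E j" by blast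
    then show "r \<le> dist x y" using insert.prems[of i j x y] insert.hyps \<open>x \<in> E i\<close> by auto
  qed
  finally show ?case by simp
qed simp

text \<open>The images of covering sets cover the image, with diameters enlarged at most by
  \<open>s\<close>. Applied to similarities it gives the scaling of Hausdorff measure.\<close>

lemma hausdorff_measure_lipschitz:
  fixes f :: "'a::metric_space \<Rightarrow> 'b::metric_space"
  assumes s: "0 < s" and f: "\<And>x y. dist (f x) (f y) \<le> s * dist x y"
  shows "hausdorff_measure m (f ` E) \<le> ennreal (s ^ m) * hausdorff_measure m E"
proof (rule hausdorff_measure_least)
  fix \<delta> :: real assume \<delta>: "0 < \<delta>"
  have diam: "bounded (f ` C)" "diameter (f ` C) \<le> s * diameter C" if "bounded C" for C
  proof -
    have d: "dist x y \<le> s * diameter C" if xy: "x \<in> f ` C" "y \<in> f ` C" for x y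
    proof -
      obtain u v where uv: "u \<in> C" "v \<in> C" "x = f u" "y = f v" using xy by blast
      have "dist x y \<le> s * dist u v" using f uv by blast
      also have "\<dots> \<le> s * diameter C" using s diameter_bounded_bound[OF \<open>bounded C\<close> uv(1,2)] by simp
      finally show ?thesis .
    qed
    show "bounded (f ` C)"
    proof (cases "C = {}")
      case False
      then obtain u where "u \<in> C" by blast
      then show ?thesis unfolding bounded_def using d by blast
    qed simp
    have "0 \<le> s * diameter C" using s diameter_ge_0[OF that] by simp
    then show "diameter (f ` C) \<le> s * diameter C" unfolding diameter_def[of "f ` C"] using d by (auto intro!: cSUP_least)
  qed
  have "ennreal (1 / s ^ m) * hausdorff_premeasure m \<delta> (f ` E) \<le> hausdorff_premeasure m (\<delta> / s) E"
  proof (rule hausdorff_premeasure_greatest)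
    fix C :: "nat \<Rightarrow> 'a set"
    assume C: "E \<subseteq> (\<Union>i. C i)" "\<And>i. bounded (C i)" "\<And>i. diameter (C i) \<le> \<delta> / s"
    have "diameter (f ` C i) \<le> \<delta>" for i
      using diam(2)[OF C(2), of i] C(3)[of i] s by (simp add: field_simps)
    moreover have "f ` E \<subseteq> (\<Union>i. f ` C i)" using image_mono[OF C(1), of f] by (simp only: image_UN)
    ultimately have "hausdorff_premeasure m \<delta> (f ` E) \<le> (\<Sum>i. hausdorff_gauge m (f ` C i))"
      using diam(1)[OF C(2)] by (intro hausdorff_premeasure_le)
    also have "\<dots> \<le> (\<Sum>i. ennreal (s ^ m) * hausdorff_gauge m (C i))"
    proof (intro suminf_le summableI)
      fix i
      have "(diameter (f ` C i) / 2) ^ m \<le> (s * diameter (C i) / 2) ^ m"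
        using diam[OF C(2), of i] diameter_ge_0[of "f ` C i"] by (intro power_mono divide_right_mono) auto
      also have "\<dots> = s ^ m * (diameter (C i) / 2) ^ m" by (simp add: power_mult_distrib power_divide)
      finally have "unit_ball_vol (real m) * (diameter (f ` C i) / 2) ^ m \<le> s ^ m * (unit_ball_vol (real m) * (diameter (C i) / 2) ^ m)"
        using mult_left_mono[of _ _ "unit_ball_vol (real m)"] by (simp add: mult.left_commute)
      then show "hausdorff_gauge m (f ` C i) \<le> ennreal (s ^ m) * hausdorff_gauge m (C i)"
        using s by (auto simp: hausdorff_gauge_def simp flip: ennreal_mult' intro!: ennreal_leI)
    qed
    also have "\<dots> = ennreal (s ^ m) * (\<Sum>i. hausdorff_gauge m (C i))" by simp
    finally have "ennreal (1 / s ^ m) * hausdorff_premeasure m \<delta> (f ` E) \<le> ennreal (1 / s ^ m) * (ennreal (s ^ m) * (\<Sum>i. hausdorff_gauge m (C i)))"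
      by (rule mult_left_mono) simp
    also have "\<dots> = (\<Sum>i. hausdorff_gauge m (C i))" using s by (simp add: mult.assoc[symmetric] ennreal_mult'[symmetric])
    finally show "ennreal (1 / s ^ m) * hausdorff_premeasure m \<delta> (f ` E) \<le> (\<Sum>i. hausdorff_gauge m (C i))" .
  qed
  also have "\<dots> \<le> hausdorff_measure m E" using s \<delta> by (intro hausdorff_premeasure_le_measure) simp
  finally have "ennreal (s ^ m) * (ennreal (1 / s ^ m) * hausdorff_premeasure m \<delta> (f ` E)) \<le> ennreal (s ^ m) * hausdorff_measure m E"
    by (rule mult_left_mono) simp
  then show "hausdorff_premeasure m \<delta> (f ` E) \<le> ennreal (s ^ m) * hausdorff_measure m E"
    using s by (simp add: mult.assoc[symmetric] ennreal_mult'[symmetric])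
qed

section \<open>Lattice frames of rational affine subspaces\<close>


text \<open>Euclid's algorithm on the heights.\<close>

lemma unimodular_concentrate_height:
  fixes W :: "(real ^ 'n::finite option) set"
  assumes "unimodular W" "\<forall>w\<in>W. 0 \<le> w $ None" "\<exists>w\<in>W. 0 < w $ None"
  shows "\<exists>W' u. unimodular W' \<and> card W' = card W \<and> span W' = span W \<and> u \<in> W' \<and> 0 < u $ None \<and> (\<forall>w\<in>W' - {u}. w $ None = 0)"
  using assms
proof (induction "\<Sum>w\<in>W. nat \<lfloor>w $ None\<rfloor>" arbitrary: W rule: less_induct)
  case less
  note W = less.prems
  have fin: "finite W" by (rule unimodular_finite[OF W(1)])
  have int: "w $ None \<in> \<int>" if "w \<in> W" for w using unimodular_integer[OF W(1) that] by (simp add: integer_point_def)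
  show ?case
  proof (cases "\<exists>a\<in>W. \<exists>b\<in>W. a \<noteq> b \<and> 0 < a $ None \<and> a $ None \<le> b $ None")
    case True
    then obtain a b where ab: "a \<in> W" "b \<in> W" "a \<noteq> b" "0 < a $ None" "a $ None \<le> b $ None" by blast
    \<comment> \<open>One subtraction step: the larger height drops by the smaller positive one,
      while cardinality and span are unchanged.\<close>
    define c where "c = (- 1) *\<^sub>R a + b"
    let ?W = "insert c (W - {b})"
    have uni: "unimodular ?W" unfolding c_def using unimodular_exchange[OF W(1) ab(1-3), of "- 1"] by simp
    have b: "b = c + a" by (simp add: c_def)
    have bs: "b \<in> span (insert c (W - {b}))"
    proof -
      have "c + a \<in> span (insert c (W - {b}))" using ab(1,3) by (intro span_add span_base) simp_all
      then show ?thesis unfolding b[symmetric] .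
    qed
    have "c \<notin> W - {b}"
    proof
      assume "c \<in> W - {b}"
      then have "insert c (W - {b}) = W - {b}" by blast
      then have "b \<in> span (W - {b})" using bs by metis
      then show False using unimodular_independent[OF W(1)] ab(2) unfolding dependent_def by blast
    qed
    then have "card ?W = Suc (card (W - {b}))" using fin by simp
    then have card: "card ?W = card W" using card.remove[OF fin ab(2)] by simp
    have span: "span ?W = span W"
    proof (rule span_eq[THEN iffD2], intro conjI)
      have "c \<in> span W" unfolding c_def using ab by (intro span_add span_scale span_base)
      then show "?W \<subseteq> span W" using span_superset by blast
      show "W \<subseteq> span ?W" using bs span_superset[of ?W] by blast
    qed
    have hc: "c $ None = b $ None - a $ None" by (simp add: c_def)
    obtain p q where pq: "a $ None = of_int p" "b $ None = of_int q" using int[OF ab(1)] int[OF ab(2)] by (auto elim!: Ints_cases)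
    have lt: "nat \<lfloor>c $ None\<rfloor> < nat \<lfloor>b $ None\<rfloor>" using ab(4,5) unfolding hc pq by (simp flip: of_int_diff)
    have "(\<Sum>w\<in>?W. nat \<lfloor>w $ None\<rfloor>) = nat \<lfloor>c $ None\<rfloor> + (\<Sum>w\<in>W - {b}. nat \<lfloor>w $ None\<rfloor>)"
      using \<open>c \<notin> W - {b}\<close> fin by simp
    also have "\<dots> < nat \<lfloor>b $ None\<rfloor> + (\<Sum>w\<in>W - {b}. nat \<lfloor>w $ None\<rfloor>)" using lt by simp
    also have "\<dots> = (\<Sum>w\<in>W. nat \<lfloor>w $ None\<rfloor>)" using fin ab(2) by (simp add: sum.remove)
    finally have "(\<Sum>w\<in>?W. nat \<lfloor>w $ None\<rfloor>) < (\<Sum>w\<in>W. nat \<lfloor>w $ None\<rfloor>)" .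
    moreover have "\<forall>w\<in>?W. 0 \<le> w $ None" using W(2) ab(5) hc by auto
    moreover have "\<exists>w\<in>?W. 0 < w $ None" using ab by (intro bexI[of _ a]) auto
    ultimately obtain W' u where W': "unimodular W'" "card W' = card ?W" "span W' = span ?W" "u \<in> W'" "0 < u $ None" "\<forall>w\<in>W' - {u}. w $ None = 0"
      using less.hyps[OF _ uni] by metis
    then show ?thesis unfolding card span by blast
  next
    case False
    obtain u where u: "u \<in> W" "0 < u $ None" using W(3) by blast
    have "w $ None = 0" if w: "w \<in> W - {u}" for w
    proof (rule ccontr)
      assume "w $ None \<noteq> 0"
      then have "0 < w $ None" using w W(2) by (simp add: order_less_le)
      moreover have "u $ None \<le> w $ None \<or> w $ None \<le> u $ None" by linarith
      ultimately show False using False u w by (metis Diff_iff singletonI)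
    qed
    then show ?thesis using W(1) u by blast
  qed
qed

lemma lift1_affine_hull_in_span:
  fixes W :: "(real ^ 'n::finite option) set"
  assumes fin: "finite W" and pos: "\<And>w. w \<in> W \<Longrightarrow> w $ None > 0" and x: "x \<in> affine hull (dehomog ` W)"
  shows "lift1 x \<in> span W"
proof -
  obtain u where u: "sum u (dehomog ` W) = 1" "(\<Sum>v\<in>dehomog ` W. u v *\<^sub>R v) = x"
    using x affine_hull_finite[of "dehomog ` W"] fin by auto
  have "lift1 x = (\<Sum>v\<in>dehomog ` W. u v *\<^sub>R lift1 v)" unfolding u(2)[symmetric] by (rule lift1_convex_comb[OF u(1)])
  moreover have "lift1 v \<in> span W" if v: "v \<in> dehomog ` W" for v
  proof -
    obtain w where w: "w \<in> W" "v = dehomog w" using v by blast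
    have "lift1 v = (1 / w $ None) *\<^sub>R (w $ None *\<^sub>R lift1 v)" using pos[OF w(1)] by simp
    also have "\<dots> = (1 / w $ None) *\<^sub>R w" unfolding w(2) using lift1_dehomog[of w] pos[OF w(1)] by simp
    finally show ?thesis using w(1) by (simp add: span_base span_scale)
  qed
  ultimately show ?thesis by (simp add: span_scale span_sum)
qed

text \<open>After concentration one generator \<open>u\<close> has positive height \<open>c\<close>.
  Its projection is \<open>p\<close>, and the other generators, at height zero, are the directions
  \<open>D\<close>. If \<open>q x\<close> is integral for a point \<open>x\<close> of the affine
  hull, then \<open>(q x, q)\<close> is an integer combination of the generators. Comparing heights
  shows that \<open>c\<close> divides \<open>q\<close>, and the other coordinates place
  \<open>x\<close> in \<open>p\<close> plus \<open>1 / q\<close> times the lattice of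
  \<open>D\<close>. So \<open>c\<close> is the least denominator that occurs.\<close>

lemma lattice_frame:
  fixes S :: "(real ^ 'n) set"
  assumes S: "regular_simplex S" "int m simplex S"
  shows "\<exists>c p D. 0 < c \<and> finite D \<and> card D = m \<and> independent D \<and> (\<forall>d\<in>D. integer_point d) \<and>
    integer_point (real c *\<^sub>R p) \<and>
    (\<forall>x. x \<in> affine hull S \<longleftrightarrow> (\<exists>\<gamma>. x = p + (\<Sum>d\<in>D. \<gamma> d *\<^sub>R d))) \<and>
    (\<forall>x\<in>affine hull S. \<forall>q>0. integer_point (real q *\<^sub>R x) \<longrightarrow>
       c dvd q \<and> (\<exists>k :: real ^ 'n \<Rightarrow> int. x = p + (\<Sum>d\<in>D. (of_int (k d) / real q) *\<^sub>R d)))"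
proof -
  obtain W where W: "unimodular W" "\<And>w. w \<in> W \<Longrightarrow> w $ None > 0" "dehomog ` W = vertices S" "inj_on dehomog W"
    using regular_simplex_cone[OF S(1)] by metis
  note V = simplex_vertices[OF S(2)]
  have cW: "card W = Suc m" using V(2) W(3,4) card_image by fastforce
  have aS: "affine hull S = affine hull (dehomog ` W)" using V(3) W(3) affine_hull_convex_hull by metis
  have "W \<noteq> {}" using cW by auto
  then obtain W' u where W': "unimodular W'" "card W' = Suc m" "span W' = span W" and u: "u \<in> W'" "0 < u $ None" "\<forall>w\<in>W' - {u}. w $ None = 0"
    using unimodular_concentrate_height[OF W(1)] W(2) cW by (metis all_not_in_conv less_imp_le)
  have finW': "finite W'" by (rule unimodular_finite[OF W'(1)])
  have intW': "integer_point w" if "w \<in> W'" for w using unimodular_integer[OF W'(1) that] .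
  obtain \<phi> where \<phi>: "\<forall>w\<in>W'. integer_point (\<phi> w)" 
    "\<forall>w\<in>W'. \<forall>T c. T \<subseteq> W' \<longrightarrow> \<phi> w \<bullet> (\<Sum>v\<in>T. c v *\<^sub>R v) = (if w \<in> T then c w else 0)"
    using unimodular_dual[OF W'(1)] by blast
  have \<phi>W: "\<phi> w \<bullet> (\<Sum>v\<in>W'. c v *\<^sub>R v) = c w" if "w \<in> W'" for w c
    using \<phi>(2)[rule_format, OF that order_refl] that by simp
  define c where "c = nat \<lfloor>u $ None\<rfloor>"
  obtain n where "u $ None = of_int n" using intW'[OF u(1)] by (auto simp: integer_point_def elim: Ints_cases)
  then have hu: "u $ None = real c" "0 < c" using u(2) by (auto simp: c_def)
  define pr where "pr w = (\<chi> i. w $ Some i)" for w :: "real ^ 'n option"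
  define p where "p = dehomog u"
  have cp: "real c *\<^sub>R p = pr u" using hu by (simp add: p_def dehomog_def pr_def vec_eq_iff)
  define W0 where "W0 = W' - {u}"
  define D where "D = pr ` W0"
  have w0: "w = append_coord (pr w) 0" if "w \<in> W0" for w
  proof -
    have "w $ None = 0" using u(3) that by (simp add: W0_def)
    then show ?thesis by (simp add: vec_option_eq_iff pr_def)
  qed
  have injpr: "inj_on pr W0"
  proof (rule inj_onI)
    fix v w assume vw: "v \<in> W0" "w \<in> W0" "pr v = pr w"
    have "v = append_coord (pr v) 0" by (rule w0[OF vw(1)])
    also have "\<dots> = append_coord (pr w) 0" by (simp only: vw(3))
    also have "\<dots> = w" by (rule w0[OF vw(2), symmetric])
    finally show "v = w" .
  qed
  have sumD: "(\<Sum>d\<in>D. f d *\<^sub>R d) = (\<Sum>w\<in>W0. f (pr w) *\<^sub>R pr w)" for f unfolding D_def by (simp add: sum.reindex[OF injpr])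
  have sumW0: "(\<Sum>w\<in>W0. f w *\<^sub>R w) = append_coord (\<Sum>w\<in>W0. f w *\<^sub>R pr w) 0" for f
  proof -
    have "(\<Sum>w\<in>W0. f w *\<^sub>R w) = (\<Sum>w\<in>W0. f w *\<^sub>R append_coord (pr w) 0)" by (intro sum.cong refl) (use w0 in metis)
    also have "\<dots> = append_coord (\<Sum>w\<in>W0. f w *\<^sub>R pr w) 0" by (simp add: vec_option_eq_iff)
    finally show ?thesis .
  qed
  have finW0: "finite W0" using finW' by (simp add: W0_def)
  have finD: "finite D" using finW0 by (simp add: D_def)
  have cardD: "card D = m" unfolding D_def using card_image[OF injpr] W'(2) u(1) finW' by (simp add: W0_def)
  have intD: "integer_point d" if d: "d \<in> D" for d
  proof -
    obtain w where "w \<in> W'" "d = pr w" using d unfolding D_def W0_def by blast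
    then show ?thesis using intW'[of w] by (simp add: integer_point_def pr_def)
  qed
  have indD: "independent D"
  proof -
    have "f d = 0" if f: "(\<Sum>d\<in>D. f d *\<^sub>R d) = 0" "d \<in> D" for f d
    proof -
      obtain w where w: "w \<in> W0" "d = pr w" using f(2) unfolding D_def by blast
      have "(\<Sum>w\<in>W0. f (pr w) *\<^sub>R w) = 0" unfolding sumW0 using f(1) by (simp add: sumD vec_option_eq_iff)
      then have "\<phi> w \<bullet> 0 = f (pr w)" 
        using \<phi>(2)[rule_format, of w W0 "\<lambda>w. f (pr w)"] w(1) by (simp add: W0_def)
      then show ?thesis using w(2) by simp
    qed
    then show ?thesis unfolding dependent_finite[OF finD] by blast
  qed
  have expand: "k u * real c = h \<and> (k u * real c) *\<^sub>R p + (\<Sum>w\<in>W0. k w *\<^sub>R pr w) = h *\<^sub>R x"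
    if "h *\<^sub>R lift1 x = (\<Sum>w\<in>W'. k w *\<^sub>R w)" for h x k
  proof -
    have "(\<Sum>w\<in>W'. k w *\<^sub>R w) = k u *\<^sub>R u + (\<Sum>w\<in>W0. k w *\<^sub>R w)" unfolding W0_def using u(1) finW' by (rule sum.remove[rotated])
    then have eq: "h *\<^sub>R lift1 x = k u *\<^sub>R u + append_coord (\<Sum>w\<in>W0. k w *\<^sub>R pr w) 0" using that sumW0 by simp
    have "h = k u * real c" using arg_cong[OF eq, of "\<lambda>v. v $ None"] hu by simp
    moreover have "h *\<^sub>R x = k u *\<^sub>R pr u + (\<Sum>w\<in>W0. k w *\<^sub>R pr w)"
    proof -
      have "h * x $ i = k u * u $ Some i + (\<Sum>w\<in>W0. k w *\<^sub>R pr w) $ i" for i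
        using arg_cong[OF eq, of "\<lambda>v. v $ Some i"] by simp
      then show ?thesis by (simp add: vec_eq_iff pr_def)
    qed
    ultimately show ?thesis using cp by (metis scaleR_scaleR)
  qed
  have span_sum: "\<exists>k. h *\<^sub>R lift1 x = (\<Sum>w\<in>W'. k w *\<^sub>R w)" if "x \<in> affine hull S" for x h
  proof -
    have "lift1 x \<in> span W'" using lift1_affine_hull_in_span[OF unimodular_finite[OF W(1)] W(2)] that aS W'(3) by metis
    then have "h *\<^sub>R lift1 x \<in> span W'" by (rule span_scale)
    then show ?thesis unfolding span_finite[OF finW'] by auto
  qed
  let ?A = "(+) p ` span D"
  have A: "x \<in> ?A \<longleftrightarrow> (\<exists>\<gamma>. x = p + (\<Sum>d\<in>D. \<gamma> d *\<^sub>R d))" for x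
    unfolding span_finite[OF finD] by (auto simp: image_iff)
  have sub: "affine hull S \<subseteq> ?A"
  proof
    fix x assume "x \<in> affine hull S"
    then obtain k where k: "1 *\<^sub>R lift1 x = (\<Sum>w\<in>W'. k w *\<^sub>R w)" using span_sum by blast
    have "x = p + (\<Sum>w\<in>W0. k w *\<^sub>R pr w)" using expand[OF k] by (metis scaleR_one)
    also have "(\<Sum>w\<in>W0. k w *\<^sub>R pr w) = (\<Sum>d\<in>D. k (the_inv_into W0 pr d) *\<^sub>R d)"
      unfolding sumD by (intro sum.cong refl) (simp add: the_inv_into_f_f[OF injpr])
    finally show "x \<in> ?A" by (rule iffD2[OF A exI])
  qed
  have "aff_dim ?A = int m" 
    using aff_dim_translation_eq[of p "span D"] aff_dim_subspace[of "span D"] dim_eq_card_independent[OF indD] cardD by simp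
  moreover have "aff_dim (affine hull S) = int m" using aff_dim_simplex[OF S(2)] by simp
  moreover have "affine ?A" using affine_translation[of "span D" p] subspace_imp_affine[of "span D"] by simp
  moreover have "affine hull S \<noteq> {}" using aff_dim_simplex[OF S(2)] by auto
  ultimately have "affine hull S = ?A" using affine_dim_equal[of "affine hull S" ?A] sub by simp
  then have mem: "x \<in> affine hull S \<longleftrightarrow> (\<exists>\<gamma>. x = p + (\<Sum>d\<in>D. \<gamma> d *\<^sub>R d))" for x using A by simp
  have lat: "c dvd q \<and> (\<exists>k :: real ^ 'n \<Rightarrow> int. x = p + (\<Sum>d\<in>D. (of_int (k d) / real q) *\<^sub>R d))"
    if x: "x \<in> affine hull S" and q: "0 < q" and i: "integer_point (real q *\<^sub>R x)" for x q
  proof -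
    obtain k where k: "real q *\<^sub>R lift1 x = (\<Sum>w\<in>W'. k w *\<^sub>R w)" using span_sum[OF x] by blast
    have "integer_point (real q *\<^sub>R lift1 x)" using i by (simp add: integer_point_lift1)
    then have "k w \<in> \<int>" if "w \<in> W'" for w using \<phi>W[OF that, of k] integer_point_inner \<phi>(1) that k by metis
    then have "k w = of_int \<lfloor>k w\<rfloor>" if "w \<in> W'" for w using that by simp
    then obtain n :: "real ^ 'n option \<Rightarrow> int" where n: "\<And>w. w \<in> W' \<Longrightarrow> k w = of_int (n w)" by (rule that)
    note e = expand[OF k]
    have "real_of_int (n u * int c) = real_of_int (int q)" using e n[OF u(1)] by simp
    then have "n u * int c = int q" by (simp only: of_int_eq_iff)
    then have "int c dvd int q" by (metis dvd_triv_right)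
    moreover have "real q *\<^sub>R p + (\<Sum>w\<in>W0. k w *\<^sub>R pr w) = real q *\<^sub>R x" using e by metis
    then have "(1 / real q) *\<^sub>R (real q *\<^sub>R p + (\<Sum>w\<in>W0. k w *\<^sub>R pr w)) = (1 / real q) *\<^sub>R (real q *\<^sub>R x)" by (simp only:)
    then have "p + (\<Sum>w\<in>W0. (k w / real q) *\<^sub>R pr w) = x" using q by (simp add: scaleR_right_distrib scaleR_sum_right)
    moreover have "(\<Sum>w\<in>W0. (k w / real q) *\<^sub>R pr w) = (\<Sum>d\<in>D. (of_int (n (the_inv_into W0 pr d)) / real q) *\<^sub>R d)"
      unfolding sumD
    proof (rule sum.cong[OF refl])
      fix w assume w: "w \<in> W0"
      then have "k w = of_int (n w)" using n by (simp add: W0_def)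
      then show "(k w / real q) *\<^sub>R pr w = (of_int (n (the_inv_into W0 pr (pr w))) / real q) *\<^sub>R pr w"
        by (simp add: the_inv_into_f_f[OF injpr w])
    qed
    ultimately show ?thesis by (intro conjI exI[of _ "\<lambda>d. n (the_inv_into W0 pr d)"]) auto
  qed
  have "integer_point (real c *\<^sub>R p)" unfolding cp using intW'[OF u(1)] by (simp add: integer_point_def pr_def)
  then show ?thesis
    using hu(2) finD cardD indD intD mem lat by (intro exI[of _ c] exI[of _ p] exI[of _ D]) blast
qed

section \<open>Hausdorff measure of a parallelepiped\<close>

definition parallelepiped :: "'a::real_vector set \<Rightarrow> 'a set" where
  "parallelepiped D = {\<Sum>d\<in>D. \<gamma> d *\<^sub>R d | \<gamma>. \<forall>d\<in>D. 0 \<le> \<gamma> d \<and> \<gamma> d \<le> 1}"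

text \<open>Cut into \<open>N ^ m\<close> cells of diameter at most \<open>M / N\<close>, the
  parallelepiped has a cover whose total gauge is bounded independently of \<open>N\<close>, while
  the diameters become arbitrarily small.\<close>

lemma hausdorff_measure_parallelepiped_finite:
  fixes D :: "'a::real_normed_vector set"
  assumes fin: "finite D"
  shows "hausdorff_measure (card D) (parallelepiped D) < top"
proof -
  define m M where "m = card D" and "M = (\<Sum>d\<in>D. norm d)"
  have M0: "0 \<le> M" by (simp add: M_def sum_nonneg)
  have "hausdorff_measure m (parallelepiped D) \<le> ennreal (unit_ball_vol (real m) * (M / 2) ^ m)"
  proof (rule hausdorff_measure_least)
    fix \<delta> :: real assume \<delta>: "0 < \<delta>"
    obtain N :: nat where N: "M / \<delta> < real N" "0 < N"
    proof -
      obtain N where "M / \<delta> < real N" using reals_Archimedean2 by blast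
      then have "M / \<delta> < real (Suc N)" by simp
      then show thesis by (rule that) simp
    qed
    then have MN: "M / real N \<le> \<delta>" using \<delta> by (simp add: field_simps)
    define I where "I = D \<rightarrow>\<^sub>E {..<N}"
    define cell where "cell k = {\<Sum>d\<in>D. \<gamma> d *\<^sub>R d | \<gamma>. \<forall>d\<in>D. real (k d) / real N \<le> \<gamma> d \<and> \<gamma> d \<le> (real (k d) + 1) / real N}" for k
    have finI: "finite I" unfolding I_def using fin by (intro finite_PiE) auto
    have cardI: "card I = N ^ m" using fin by (simp add: I_def m_def card_PiE)
    have cell_dist: "norm (x - y) \<le> M / real N" if xy: "x \<in> cell k" "y \<in> cell k" for x y k
    proof -
      obtain f where f: "x = (\<Sum>d\<in>D. f d *\<^sub>R d)" "\<forall>d\<in>D. real (k d) / real N \<le> f d \<and> f d \<le> (real (k d) + 1) / real N"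
        using xy(1) unfolding cell_def by blast
      obtain g where g: "y = (\<Sum>d\<in>D. g d *\<^sub>R d)" "\<forall>d\<in>D. real (k d) / real N \<le> g d \<and> g d \<le> (real (k d) + 1) / real N"
        using xy(2) unfolding cell_def by blast
      have "norm (x - y) = norm (\<Sum>d\<in>D. (f d - g d) *\<^sub>R d)" by (simp add: f(1) g(1) scaleR_left_diff_distrib sum_subtractf)
      also have "\<dots> \<le> (\<Sum>d\<in>D. 1 / real N * norm d)"
      proof (rule sum_norm_le)
        fix d assume "d \<in> D"
        then have "\<bar>f d - g d\<bar> \<le> 1 / real N" using f(2) g(2) by (fastforce simp: add_divide_distrib abs_le_iff)
        then show "norm ((f d - g d) *\<^sub>R d) \<le> 1 / real N * norm d"
            using mult_right_mono[of "\<bar>f d - g d\<bar>" "1 / real N" "norm d"] by simp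
      qed
      also have "\<dots> = M / real N" by (simp add: M_def sum_divide_distrib)
      finally show ?thesis .
    qed
    have cell_bdd: "bounded (cell k)" for k
    proof (cases "cell k = {}")
      case False
      then obtain x where "x \<in> cell k" by blast
      then show ?thesis using cell_dist unfolding bounded_def dist_norm by blast
    qed simp
    have cell_diam: "diameter (cell k) \<le> M / real N" for k
      using cell_dist M0 by (intro diameter_le) auto
    have "parallelepiped D \<subseteq> (\<Union>k\<in>I. cell k)"
    proof
      fix x assume "x \<in> parallelepiped D"
      then obtain \<gamma> where \<gamma>: "x = (\<Sum>d\<in>D. \<gamma> d *\<^sub>R d)" "\<forall>d\<in>D. 0 \<le> \<gamma> d \<and> \<gamma> d \<le> 1" unfolding parallelepiped_def by blast
      \<comment> \<open>The cap \<open>N - 1\<close> puts the coefficient 1, where the floor would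
        be \<open>N\<close>, into the last cell.\<close>
      define k where "k = restrict (\<lambda>d. min (nat \<lfloor>real N * \<gamma> d\<rfloor>) (N - 1)) D"
      have "k \<in> I" unfolding I_def k_def using N by auto
      moreover have "x \<in> cell k"
        unfolding cell_def
      proof (intro CollectI exI[of _ \<gamma>] conjI \<gamma>(1) ballI)
        fix d assume d: "d \<in> D"
        have g: "0 \<le> real N * \<gamma> d" "real N * \<gamma> d \<le> real N" using \<gamma>(2) d by (auto intro: mult_left_le)
        have kd: "k d = min (nat \<lfloor>real N * \<gamma> d\<rfloor>) (N - 1)" using d by (simp add: k_def)
        have "real (k d) \<le> real N * \<gamma> d" unfolding kd using g(1) by linarith
        then show "real (k d) / real N \<le> \<gamma> d" using N(2) by (simp add: divide_le_eq mult.commute)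
        have "real N * \<gamma> d \<le> real (k d) + 1"
        proof (cases "nat \<lfloor>real N * \<gamma> d\<rfloor> \<le> N - 1")
          case True
          then show ?thesis unfolding kd using g(1) by simp
        next
          case False
          then have "k d = N - 1" unfolding kd by simp
          then show ?thesis using g(2) N(2) by (simp add: of_nat_diff)
        qed
        then show "\<gamma> d \<le> (real (k d) + 1) / real N" using N(2) by (simp add: le_divide_eq mult.commute)
      qed
      ultimately show "x \<in> (\<Union>k\<in>I. cell k)" by blast
    qed
    then have "hausdorff_premeasure m \<delta> (parallelepiped D) \<le> hausdorff_premeasure m \<delta> (\<Union>k\<in>I. cell k)"
      by (rule hausdorff_premeasure_mono)
    also have "\<dots> \<le> (\<Sum>k\<in>I. hausdorff_premeasure m \<delta> (cell k))" by (rule hausdorff_premeasure_UN[OF finI \<delta>])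
    also have "\<dots> \<le> (\<Sum>k\<in>I. ennreal (unit_ball_vol (real m) * (M / real N / 2) ^ m))"
    proof (rule sum_mono)
      fix k
      have "hausdorff_premeasure m \<delta> (cell k) \<le> hausdorff_gauge m (cell k)"
        using cell_diam[of k] MN by (intro hausdorff_premeasure_le_gauge cell_bdd \<delta>) simp
      also have "\<dots> \<le> ennreal (unit_ball_vol (real m) * (M / real N / 2) ^ m)"
        using cell_diam[of k] diameter_ge_0[OF cell_bdd[of k]]
        by (auto simp: hausdorff_gauge_def intro!: ennreal_leI mult_left_mono power_mono divide_right_mono)
      finally show "hausdorff_premeasure m \<delta> (cell k) \<le> ennreal (unit_ball_vol (real m) * (M / real N / 2) ^ m)" .
    qed
    also have "\<dots> = ennreal (unit_ball_vol (real m) * (M / 2) ^ m)"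
    proof -
      have "(M / real N / 2) ^ m = (M / 2) ^ m / real N ^ m" by (simp add: power_divide)
      then have "real (N ^ m) * (unit_ball_vol (real m) * (M / real N / 2) ^ m) = unit_ball_vol (real m) * (M / 2) ^ m"
        using N(2) by simp
      then show ?thesis using M0 by (simp add: cardI ennreal_of_nat_eq_real_of_nat flip: ennreal_mult')
    qed
    finally show "hausdorff_premeasure m \<delta> (parallelepiped D) \<le> ennreal (unit_ball_vol (real m) * (M / 2) ^ m)" .
  qed
  then show ?thesis unfolding m_def using ennreal_less_top order_le_less_trans by blast
qed

lemma emeasure_lborel_cbox_cart:
  fixes a b :: "real ^ 'n"
  assumes "\<And>i. a $ i \<le> b $ i"
  shows "emeasure lborel (cbox a b) = ennreal (\<Prod>i\<in>UNIV. b $ i - a $ i)"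
proof -
  have "cbox a b \<noteq> {}" using assms by (auto simp: interval_ne_empty_cart)
  then have "measure lborel (cbox a b) = (\<Prod>i\<in>UNIV. b $ i - a $ i)" by (simp add: content_cbox_cart)
  then show ?thesis
    using emeasure_eq_ennreal_measure[of lborel "cbox a b"] emeasure_lborel_cbox_finite[of a b] by simp
qed

lemma independent_coordinate_bound:
  fixes g \<psi> :: "'n::finite \<Rightarrow> real ^ 'n" 
  assumes "\<And>x. x = (\<Sum>i\<in>UNIV. (\<psi> i \<bullet> x) *\<^sub>R g i)"
  shows "\<bar>\<psi> i \<bullet> x\<bar> \<le> (1 + (\<Sum>i\<in>UNIV. norm (\<psi> i))) * norm x"
proof -
  have "\<bar>\<psi> i \<bullet> x\<bar> \<le> norm (\<psi> i) * norm x" by (rule Cauchy_Schwarz_ineq2)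
  also have "norm (\<psi> i) \<le> (\<Sum>i\<in>UNIV. norm (\<psi> i))" by (rule member_le_sum) auto
  then have "norm (\<psi> i) * norm x \<le> (1 + (\<Sum>i\<in>UNIV. norm (\<psi> i))) * norm x" by (intro mult_right_mono) auto
  finally show ?thesis .
qed

text \<open>A cover of the parallelepiped is thickened to a cover of the unit cube by boxes, to which Lebesgue measure
  applies.\<close>

lemma hausdorff_measure_parallelepiped_pos:
  fixes D :: "(real ^ 'n) set"
  assumes ind: "independent D" and rat: "\<And>d. d \<in> D \<Longrightarrow> rational_point d"
  shows "0 < hausdorff_measure (card D) (parallelepiped D)"
proof -
  obtain g \<psi> :: "'n \<Rightarrow> real ^ 'n" where g: "inj g" "D \<subseteq> range g" and "\<And>i. rational_point (\<psi> i)"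
    and \<delta>: "\<And>i j. \<psi> i \<bullet> g j = (if j = i then 1 else 0)" and ex: "\<And>x. x = (\<Sum>i\<in>UNIV. (\<psi> i \<bullet> x) *\<^sub>R g i)"
    by (rule rational_dual_family[OF ind rat]) (assumption, rule that, assumption+)
  define K where "K = 1 + (\<Sum>i\<in>UNIV. norm (\<psi> i))"
  have K: "0 < K" "\<bar>\<psi> i \<bullet> x\<bar> \<le> K * norm x" for i x
    using independent_coordinate_bound[OF ex] by (auto simp: K_def intro!: add_pos_nonneg sum_nonneg)
  define m J where "m = card D" and "J = {i. g i \<in> D}"
  have gJ: "g ` J = D" using g(2) by (auto simp: J_def)
  have cJ: "card J = m" unfolding m_def gJ[symmetric] using card_image[OF inj_on_subset[OF g(1)]] by simp
  \<comment> \<open>A set of diameter \<open>x\<close> is thickened to a box with \<open>m\<close>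
    sides of length \<open>2 * K * x\<close> and all others of length 1; the volume of this box is
    \<open>1 / v\<close> times the gauge of the set.\<close>
  define v where "v = unit_ball_vol (real m) / (4 * K) ^ m"
  have v: "0 < v" using K(1) by (simp add: v_def)
  have "ennreal v \<le> hausdorff_premeasure m 1 (parallelepiped D)"
  proof (rule hausdorff_premeasure_greatest)
    fix C :: "nat \<Rightarrow> (real ^ 'n) set"
    assume C: "parallelepiped D \<subseteq> (\<Union>i. C i)" "\<And>i. bounded (C i)"
    define pt where "pt i = (SOME x. x \<in> C i)" for i
    have pt: "pt i \<in> C i" if "C i \<noteq> {}" for i using that unfolding pt_def by (metis all_not_in_conv someI_ex)
    define r where "r i = K * diameter (C i)" for i
    have r0: "0 \<le> r i" for i using K(1) diameter_ge_0[OF C(2)] by (simp add: r_def)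
    define lo where "lo i = (\<chi> j. if j \<in> J then \<psi> j \<bullet> pt i - r i else 0)" for i
    define hi where "hi i = (\<chi> j. if j \<in> J then \<psi> j \<bullet> pt i + r i else 1)" for i
    define box where "box i = (if C i = {} then {} else cbox (lo i) (hi i))" for i
    have cube: "cbox 0 (\<chi> j. 1) \<subseteq> (\<Union>i. box i)"
    proof
      fix y :: "real ^ 'n" assume y: "y \<in> cbox 0 (\<chi> j. 1)"
      define x where "x = (\<Sum>j\<in>J. (y $ j) *\<^sub>R g j)"
      have "x = (\<Sum>d\<in>D. (y $ inv g d) *\<^sub>R d)"
        unfolding x_def gJ[symmetric] by (simp add: sum.reindex[OF inj_on_subset[OF g(1)]] inv_f_f[OF g(1)])
      then have "x \<in> parallelepiped D" using y unfolding parallelepiped_def 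
        by (intro CollectI exI[of _ "\<lambda>d. y $ inv g d"]) (auto simp: mem_box_cart)
      then obtain i where i: "x \<in> C i" using C(1) by blast
      have yx: "\<psi> j \<bullet> x = y $ j" if "j \<in> J" for j
      proof -
        have "\<psi> j \<bullet> x = (\<Sum>l\<in>J. if l = j then y $ l else 0)"
          unfolding x_def inner_sum_right by (intro sum.cong refl) (simp add: \<delta>)
        then show ?thesis using that by simp
      qed
      have "\<bar>y $ j - \<psi> j \<bullet> pt i\<bar> \<le> r i" if "j \<in> J" for j
      proof -
        have "y $ j - \<psi> j \<bullet> pt i = \<psi> j \<bullet> (x - pt i)" using yx[OF that] by (simp add: inner_diff_right)
        then have "\<bar>y $ j - \<psi> j \<bullet> pt i\<bar> \<le> K * norm (x - pt i)" using K(2) by simp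
        also have "norm (x - pt i) \<le> diameter (C i)"
          using diameter_bounded_bound[OF C(2) i pt[of i]] i by (auto simp: dist_norm)
        finally show ?thesis using K(1) by (simp add: r_def)
      qed
      then have "y \<in> cbox (lo i) (hi i)" using y by (fastforce simp: mem_box_cart lo_def hi_def abs_le_iff)
      then show "y \<in> (\<Union>i. box i)" using i by (auto simp: box_def)
    qed
    have meas: "emeasure lborel (box i) \<le> ennreal (1 / v) * hausdorff_gauge m (C i)" for i
    proof (cases "C i = {}")
      case False
      have "emeasure lborel (box i) = ennreal (\<Prod>j\<in>UNIV. hi i $ j - lo i $ j)"
        using False r0 by (simp add: box_def emeasure_lborel_cbox_cart lo_def hi_def)
      also have "(\<Prod>j\<in>UNIV. hi i $ j - lo i $ j) = (\<Prod>j\<in>UNIV. if j \<in> J then 2 * r i else 1)"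
        by (intro prod.cong) (auto simp: lo_def hi_def)
      also have "\<dots> = (2 * r i) ^ m" using cJ by (simp add: prod.If_cases)
      also have "2 * r i = 4 * K * (diameter (C i) / 2)" by (simp add: r_def)
      also have "(4 * K * (diameter (C i) / 2)) ^ m = 1 / v * (unit_ball_vol (real m) * (diameter (C i) / 2) ^ m)"
      proof -
        have "0 < unit_ball_vol (real m)" by simp
        then have "unit_ball_vol (real m) \<noteq> 0" by linarith
        then show ?thesis using K(1) unfolding power_mult_distrib[of "4 * K"] by (simp add: v_def)
      qed
      also have "ennreal \<dots> = ennreal (1 / v) * ennreal (unit_ball_vol (real m) * (diameter (C i) / 2) ^ m)"
        using v by (intro ennreal_mult') simp
      finally show ?thesis using False by (simp add: hausdorff_gauge_def)
    qed (simp add: box_def)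
    have "ennreal 1 = emeasure lborel (cbox (0 :: real ^ 'n) (\<chi> j. 1))" by (subst emeasure_lborel_cbox_cart) auto
    also have "\<dots> \<le> emeasure lborel (\<Union>i. box i)" using cube by (intro emeasure_mono) (auto simp: box_def)
    also have "\<dots> \<le> (\<Sum>i. emeasure lborel (box i))" by (intro emeasure_subadditive_countably) (auto simp: box_def)
    also have "\<dots> \<le> (\<Sum>i. ennreal (1 / v) * hausdorff_gauge m (C i))" by (intro suminf_le meas summableI)
    also have "\<dots> = ennreal (1 / v) * (\<Sum>i. hausdorff_gauge m (C i))" by simp
    finally have "ennreal v * ennreal 1 \<le> ennreal v * (ennreal (1 / v) * (\<Sum>i. hausdorff_gauge m (C i)))"
      by (rule mult_left_mono) simp
    also have "\<dots> = (\<Sum>i. hausdorff_gauge m (C i))" using v by (simp add: mult.assoc[symmetric] ennreal_mult'[symmetric])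
    finally show "ennreal v \<le> (\<Sum>i. hausdorff_gauge m (C i))" by simp
  qed
  also have "\<dots> \<le> hausdorff_measure m (parallelepiped D)" by (rule hausdorff_premeasure_le_measure) simp
  finally have "ennreal v \<le> hausdorff_measure m (parallelepiped D)" .
  moreover have "0 < ennreal v" using v by simp
  ultimately show ?thesis unfolding m_def by (rule order_less_le_trans[rotated])
qed

section \<open>Proportionality\<close>


lemma floor_parallelepiped:
  fixes D :: "'a::real_vector set"
  assumes "0 < q"
  shows "(1 / real q) *\<^sub>R (\<Sum>d\<in>D. frac (real q * \<gamma> d) *\<^sub>R d) =
     (\<Sum>d\<in>D. \<gamma> d *\<^sub>R d) - (\<Sum>d\<in>D. (of_int \<lfloor>real q * \<gamma> d\<rfloor> / real q) *\<^sub>R d)"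
proof -
  have "(1 / real q) *\<^sub>R (\<Sum>d\<in>D. frac (real q * \<gamma> d) *\<^sub>R d) = (\<Sum>d\<in>D. (frac (real q * \<gamma> d) / real q) *\<^sub>R d)"
    by (simp add: scaleR_sum_right)
  also have "\<dots> = (\<Sum>d\<in>D. (\<gamma> d - of_int \<lfloor>real q * \<gamma> d\<rfloor> / real q) *\<^sub>R d)"
    using assms by (intro sum.cong refl) (simp add: frac_def diff_divide_distrib)
  finally show ?thesis by (simp add: scaleR_left_diff_distrib sum_subtractf)
qed

section \<open>Counting points of a given denominator in a convex set inside a lattice frame\<close>

context
  fixes D Q A :: "(real ^ 'n) set" and p :: "real ^ 'n" and c :: nat
  assumes c: "0 < c" and ind: "independent D" and intD: "\<And>d. d \<in> D \<Longrightarrow> integer_point d"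
    and cp: "integer_point (real c *\<^sub>R p)"
    and A: "\<And>x. x \<in> A \<longleftrightarrow> (\<exists>\<gamma>. x = p + (\<Sum>d\<in>D. \<gamma> d *\<^sub>R d))"
    and lat: "\<And>x q. x \<in> A \<Longrightarrow> 0 < q \<Longrightarrow> integer_point (real q *\<^sub>R x) \<Longrightarrow>
       c dvd q \<and> (\<exists>k :: real ^ 'n \<Rightarrow> int. x = p + (\<Sum>d\<in>D. (of_int (k d) / real q) *\<^sub>R d))"
    and Q: "convex Q" "bounded Q" "Q \<noteq> {}" "affine hull Q = A"
begin

private abbreviation (input) "H \<equiv> hausdorff_measure (card D)"
private abbreviation (input) "E \<equiv> parallelepiped D"
private abbreviation (input) "N \<equiv> \<lambda>q. card (slice Q q)"

private lemma finD: "finite D"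
  using ind independent_imp_finite by blast

private lemma E_bound: "x \<in> E \<Longrightarrow> norm x \<le> (\<Sum>d\<in>D. norm d)"
proof -
  assume "x \<in> E"
  then obtain \<gamma> where \<gamma>: "x = (\<Sum>d\<in>D. \<gamma> d *\<^sub>R d)" "\<forall>d\<in>D. 0 \<le> \<gamma> d \<and> \<gamma> d \<le> 1" unfolding parallelepiped_def by blast
  have "norm (\<gamma> d *\<^sub>R d) \<le> norm d" if "d \<in> D" for d using \<gamma>(2) that by (simp add: mult_left_le_one_le)
  then show "norm x \<le> (\<Sum>d\<in>D. norm d)" unfolding \<gamma>(1) by (rule sum_norm_le)
qed

private lemma affine_A: "affine A"
  using Q(4) affine_affine_hull by metis

private lemma A_translate: "x \<in> A \<Longrightarrow> e \<in> E \<Longrightarrow> x + s *\<^sub>R e \<in> A"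
proof -
  assume "x \<in> A" "e \<in> E"
  then obtain \<gamma> \<beta> where "x = p + (\<Sum>d\<in>D. \<gamma> d *\<^sub>R d)" "e = (\<Sum>d\<in>D. \<beta> d *\<^sub>R d)" unfolding A parallelepiped_def by blast
  then have "x + s *\<^sub>R e = p + (\<Sum>d\<in>D. (\<gamma> d + s * \<beta> d) *\<^sub>R d)" by (simp add: scaleR_left_distrib sum.distrib scaleR_sum_right)
  then show "x + s *\<^sub>R e \<in> A" unfolding A by (rule exI[of _ "\<lambda>d. \<gamma> d + s * \<beta> d"])
qed

private lemma slice_not_dvd: "0 < q \<Longrightarrow> \<not> c dvd q \<Longrightarrow> slice Q q = {}"
proof (rule ccontr)
  assume q: "0 < q" "\<not> c dvd q" "slice Q q \<noteq> {}"
  then obtain z where z: "integer_point z" "(1 / real q) *\<^sub>R z \<in> Q" unfolding slice_def by blast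
  then have "(1 / real q) *\<^sub>R z \<in> A" using hull_subset[of Q affine] unfolding Q(4) by blast
  then show False using lat[of "(1 / real q) *\<^sub>R z" q] q z by simp
qed

text \<open>The scaled copies \<open>f ` Q\<close> and \<open>g ` Q\<close> of \<open>Q\<close>, with factors \<open>1 / s\<close> and \<open>s\<close>, are sandwiched between
  the cells of side \<open>1 / q\<close> and those of side \<open>1 / (s q)\<close> based at the points of denominator \<open>q\<close> in \<open>Q\<close>.\<close>

private lemma slice_bounds:
  assumes s: "1 < s"
  shows "\<forall>\<^sub>F k in sequentially.
    H Q \<le> ennreal (s ^ card D) * (of_nat (N (c * k)) * (ennreal ((1 / real (c * k)) ^ card D) * H E)) \<and>
    of_nat (N (c * k)) * H E \<le> ennreal ((s * real (c * k)) ^ card D) * (ennreal (s ^ card D) * H Q)"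
proof -
  let ?m = "card D"
  define M where "M = (\<Sum>d\<in>D. norm d)"
  have M0: "0 \<le> M" by (simp add: M_def sum_nonneg)
  obtain ctr where "ctr \<in> rel_interior Q" using rel_interior_eq_empty[OF Q(1)] Q(3) by blast
  then obtain \<rho> where \<rho>: "ctr \<in> Q" "0 < \<rho>" "cball ctr \<rho> \<inter> A \<subseteq> Q" unfolding mem_rel_interior_cball Q(4) by blast
  have QA: "Q \<subseteq> A" using hull_subset[of Q affine] unfolding Q(4) .
  define \<epsilon> where "\<epsilon> = s - 1"
  have \<epsilon>: "0 < \<epsilon>" using s by (simp add: \<epsilon>_def)
  define f where "f x = ctr + (1 / s) *\<^sub>R (x - ctr)" for x
  define g where "g x = ctr + s *\<^sub>R (x - ctr)" for x
  have fg: "f (g x) = x" "g (f x) = x" for x using s by (simp_all add: f_def g_def)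
  have gA: "g x \<in> A" if "x \<in> A" for x unfolding g_def using mem_affine_3_minus[OF affine_A, of ctr x ctr s] that \<rho>(1) QA by blast
  \<comment> \<open>The ball around \<open>ctr\<close> gives room: \<open>f y\<close> is the convex
    combination of \<open>x\<close> and \<open>ctr + (y - x) / \<epsilon>\<close> with weights
    \<open>1 / s\<close> and \<open>\<epsilon> / s\<close>, and the second point is in
    \<open>Q\<close> when \<open>y\<close> is close to \<open>x\<close>.\<close>
  have shrink: "f y \<in> Q" if "x \<in> Q" "y \<in> A" "norm (y - x) \<le> \<epsilon> * \<rho>" for x y
  proof -
    let ?o = "ctr + (1 / \<epsilon>) *\<^sub>R (y - x)"
    have "?o \<in> A" using mem_affine_3_minus[OF affine_A, of ctr y x "1 / \<epsilon>"] that \<rho>(1) QA by blast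
    moreover have "?o \<in> cball ctr \<rho>" using that(3) \<epsilon> by (simp add: dist_norm divide_le_eq mult.commute)
    ultimately have "?o \<in> Q" using \<rho>(3) by blast
    then have "(1 / s) *\<^sub>R x + (\<epsilon> / s) *\<^sub>R ?o \<in> Q"
      using that(1) s \<epsilon> by (intro convexD[OF Q(1)]) (auto simp: \<epsilon>_def field_simps)
    also have "(1 / s) *\<^sub>R x + (\<epsilon> / s) *\<^sub>R ?o = f y"
    proof -
      have e: "\<epsilon> / s = 1 - 1 / s" using s by (simp add: \<epsilon>_def diff_divide_distrib)
      have "(\<epsilon> / s) *\<^sub>R ?o = (\<epsilon> / s) *\<^sub>R ctr + (1 / s) *\<^sub>R (y - x)" using \<epsilon> by (simp add: scaleR_right_distrib)
      then show ?thesis unfolding e f_def by (simp add: algebra_simps)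
    qed
    finally show ?thesis .
  qed
  obtain G \<psi> :: "'n \<Rightarrow> real ^ 'n" where G: "inj G" "D \<subseteq> range G" and "\<And>i. rational_point (\<psi> i)"
    and \<delta>: "\<And>i j. \<psi> i \<bullet> G j = (if j = i then 1 else 0)" and ex: "\<And>x. x = (\<Sum>i\<in>UNIV. (\<psi> i \<bullet> x) *\<^sub>R G i)"
  proof (rule rational_dual_family[OF ind])
    show "rational_point d" if "d \<in> D" for d
      using intD[OF that] Ints_subset_Rats by (auto simp: integer_point_def rational_point_def)
  qed (rule that, assumption+)
  define K where "K = 1 + (\<Sum>i\<in>UNIV. norm (\<psi> i))"
  have K0: "0 < K" by (auto simp: K_def intro!: add_pos_nonneg sum_nonneg)
  have K: "\<bar>\<beta> d\<bar> \<le> K * norm (\<Sum>d\<in>D. \<beta> d *\<^sub>R d)" if d: "d \<in> D" for \<beta> d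
  proof -
    obtain i where i: "d = G i" using d G(2) by blast
    have "\<psi> i \<bullet> (\<Sum>d\<in>D. \<beta> d *\<^sub>R d) = (\<Sum>e\<in>D. if e = d then \<beta> e else 0)"
      unfolding inner_sum_right using G(2) \<delta> inj_eq[OF G(1)] i by (intro sum.cong refl) auto
    also have "\<dots> = \<beta> d" using d finD by simp
    finally have "\<beta> d = \<psi> i \<bullet> (\<Sum>d\<in>D. \<beta> d *\<^sub>R d)" by simp
    then show ?thesis using independent_coordinate_bound[OF ex, of i "\<Sum>d\<in>D. \<beta> d *\<^sub>R d"] unfolding K_def by simp
  qed
  \<comment> \<open>From here on the displacement by a cell, at most \<open>s * M / q\<close>, is
    within the tolerance \<open>\<epsilon> * \<rho>\<close> of \<open>shrink\<close>.\<close>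
  obtain k0 :: nat where k0: "s * M / (\<epsilon> * \<rho>) < real k0" using reals_Archimedean2 by blast
  show ?thesis
    using eventually_gt_at_top[of k0]
  proof eventually_elim
    case (elim k)
    define q where "q = c * k"
    have k: "0 < k" using elim by simp
    have q: "0 < q" using k c by (simp add: q_def)
    have "s * M / (\<epsilon> * \<rho>) < real k" using k0 elim by linarith
    also have "real k \<le> real q" using c unfolding q_def by (simp add: Suc_le_eq mult_le_cancel_right1)
    finally have sMq: "s * M / real q \<le> \<epsilon> * \<rho>" using \<epsilon> \<rho>(2) q by (simp add: field_simps)
    have "M / real q \<le> s * M / real q" using s M0 by (intro divide_right_mono) (auto simp: mult_le_cancel_right1)
    then have Mq: "M / real q \<le> \<epsilon> * \<rho>" using sMq by simp
    have bdd_slice: "finite (slice Q q)" by (rule finite_slice[OF Q(2) q])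
    \<comment> \<open>Since \<open>c\<close> divides \<open>q\<close>, all points of the frame
      lattice of mesh \<open>1 / q\<close> have denominator dividing \<open>q\<close>.\<close>
    have qp: "integer_point (real q *\<^sub>R p)"
    proof -
      have "real q *\<^sub>R p = real k *\<^sub>R (real c *\<^sub>R p)" by (simp add: q_def mult.commute)
      also have "integer_point \<dots>" by (intro integer_point_simps(5) Ints_of_nat cp)
      finally show ?thesis .
    qed
    have U: "H Q \<le> ennreal (s ^ ?m) * (of_nat (N q) * (ennreal ((1 / real q) ^ ?m) * H E))"
    proof -
      define cell where "cell z = (\<lambda>x. (1 / real q) *\<^sub>R z + (1 / real q) *\<^sub>R x) ` E" for z
      \<comment> \<open>Rounding the frame coordinates of \<open>y\<close> down gives the base point
        \<open>x\<close> of its cell. The point \<open>g x\<close> is close to the original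
        \<open>y'\<close> in \<open>Q\<close>, so shrinking it back by \<open>f\<close> shows that
        \<open>x\<close> lies in \<open>Q\<close>.\<close>
      have "f ` Q \<subseteq> (\<Union>z\<in>slice Q q. cell z)"
      proof
        fix y assume "y \<in> f ` Q"
        then obtain y' where y': "y' \<in> Q" "y = f y'" by blast
        have "y \<in> A" unfolding y'(2) f_def using mem_affine_3_minus[OF affine_A, of ctr y' ctr "1 / s"] y'(1) \<rho>(1) QA by blast
        then obtain \<gamma> where \<gamma>: "y = p + (\<Sum>d\<in>D. \<gamma> d *\<^sub>R d)" unfolding A by blast
        define n where "n d = \<lfloor>real q * \<gamma> d\<rfloor>" for d
        define x where "x = p + (\<Sum>d\<in>D. (of_int (n d) / real q) *\<^sub>R d)"
        define e where "e = (\<Sum>d\<in>D. frac (real q * \<gamma> d) *\<^sub>R d)"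
        have eE: "e \<in> E" unfolding parallelepiped_def e_def
          by (intro CollectI exI[of _ "\<lambda>d. frac (real q * \<gamma> d)"]) (auto simp: frac_ge_0 less_imp_le[OF frac_lt_1])
        have yx: "y = x + (1 / real q) *\<^sub>R e"
          unfolding e_def floor_parallelepiped[OF q] \<gamma> x_def n_def by simp
        have xA: "x \<in> A" unfolding A x_def by (rule exI[of _ "\<lambda>d. of_int (n d) / real q"]) (rule refl)
        have "norm (g x - y') \<le> \<epsilon> * \<rho>"
        proof -
          have "g x - y' = - (s *\<^sub>R ((1 / real q) *\<^sub>R e))"
          proof -
            have "y' = g y" using y'(2) fg by simp
            then show ?thesis unfolding yx g_def by (simp add: algebra_simps)
          qed
          then have "norm (g x - y') = s * norm e / real q" using s by simp
          also have "\<dots> \<le> s * M / real q" using E_bound[OF eE] s unfolding M_def by (intro divide_right_mono mult_left_mono) auto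
          finally show ?thesis using sMq by simp
        qed
        from shrink[OF y'(1) gA[OF xA] this] have xQ: "x \<in> Q" by (simp add: fg)
        have "real q *\<^sub>R x = real q *\<^sub>R p + (\<Sum>d\<in>D. of_int (n d) *\<^sub>R d)"
          using q by (simp add: x_def scaleR_right_distrib scaleR_sum_right)
        also have "integer_point \<dots>"
          by (intro integer_point_simps(2,5) qp integer_point_sum Ints_of_int intD)
        finally have "integer_point (real q *\<^sub>R x)" .
        then have "real q *\<^sub>R x \<in> slice Q q" using xQ q by (simp add: slice_def)
        moreover have "y \<in> cell (real q *\<^sub>R x)" unfolding cell_def using yx eE q by (intro image_eqI[of _ _ e]) auto
        ultimately show "y \<in> (\<Union>z\<in>slice Q q. cell z)" by blast
      qed
      then have "H (f ` Q) \<le> H (\<Union>z\<in>slice Q q. cell z)" by (rule hausdorff_measure_mono)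
      also have "\<dots> \<le> (\<Sum>z\<in>slice Q q. H (cell z))" by (rule hausdorff_measure_UN[OF bdd_slice])
      also have "\<dots> \<le> (\<Sum>z\<in>slice Q q. ennreal ((1 / real q) ^ ?m) * H E)"
        unfolding cell_def using q by (intro sum_mono hausdorff_measure_lipschitz) (auto simp: dist_norm simp flip: scaleR_diff_right)
      also have "\<dots> = of_nat (N q) * (ennreal ((1 / real q) ^ ?m) * H E)" by simp
      finally have *: "H (f ` Q) \<le> of_nat (N q) * (ennreal ((1 / real q) ^ ?m) * H E)" .
      have "H (g ` (f ` Q)) \<le> ennreal (s ^ ?m) * H (f ` Q)"
        using s by (intro hausdorff_measure_lipschitz) (auto simp: dist_norm g_def simp flip: scaleR_diff_right)
      moreover have "g ` (f ` Q) = Q" by (simp add: image_image fg)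
      ultimately have "H Q \<le> ennreal (s ^ ?m) * H (f ` Q)" by simp
      also have "\<dots> \<le> ennreal (s ^ ?m) * (of_nat (N q) * (ennreal ((1 / real q) ^ ?m) * H E))"
        using * by (intro mult_left_mono) auto
      finally show ?thesis .
    qed
    have L: "of_nat (N q) * H E \<le> ennreal ((s * real q) ^ ?m) * (ennreal (s ^ ?m) * H Q)"
    proof -
      define cell where "cell z = (\<lambda>x. (1 / real q) *\<^sub>R z + (1 / (s * real q)) *\<^sub>R x) ` E" for z
      have sub: "(\<Union>z\<in>slice Q q. cell z) \<subseteq> g ` Q"
      proof
        fix y assume "y \<in> (\<Union>z\<in>slice Q q. cell z)"
        then obtain z e where z: "z \<in> slice Q q" "e \<in> E" "y = (1 / real q) *\<^sub>R z + (1 / (s * real q)) *\<^sub>R e" unfolding cell_def by blast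
        have zQ: "(1 / real q) *\<^sub>R z \<in> Q" using z(1) by (simp add: slice_def)
        have "y \<in> A" unfolding z(3) using A_translate[of "(1 / real q) *\<^sub>R z" e "1 / (s * real q)"] z(2) zQ QA by blast
        moreover have "norm (y - (1 / real q) *\<^sub>R z) \<le> \<epsilon> * \<rho>"
        proof -
          have "norm (y - (1 / real q) *\<^sub>R z) = norm e / (s * real q)" unfolding z(3) using s q by simp
          also have "\<dots> \<le> M / (s * real q)" using E_bound[OF z(2)] s q unfolding M_def by (intro divide_right_mono) auto
          also have "\<dots> \<le> M / real q" using s q M0 by (intro divide_left_mono) (auto simp: mult_le_cancel_right1)
          finally show ?thesis using Mq by simp
        qed
        ultimately have "f y \<in> Q" by (rule shrink[OF zQ])
        then show "y \<in> g ` Q" using fg(2)[of y] by (metis imageI)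
      qed
      \<comment> \<open>Distinct base points differ by at least \<open>1 / q\<close> in some frame
        coordinate, of which the cells use up at most \<open>1 / (s * q)\<close>; \<open>K\<close>
        bounds coordinates by norms. The gap exists because the cells were shrunken by
        \<open>s\<close>.\<close>
      define r where "r = (1 - 1 / s) / (real q * K)"
      have r: "0 < r" using s q K0 by (simp add: r_def)
      have sep: "r \<le> dist x y" if ij: "i \<in> slice Q q" "j \<in> slice Q q" "i \<noteq> j" and xy: "x \<in> cell i" "y \<in> cell j" for i j x y
      proof -
        have rep: "\<exists>n :: real ^ 'n \<Rightarrow> int. (1 / real q) *\<^sub>R z = p + (\<Sum>d\<in>D. (of_int (n d) / real q) *\<^sub>R d)" if z: "z \<in> slice Q q" for z
        proof -
          have "(1 / real q) *\<^sub>R z \<in> A" "integer_point (real q *\<^sub>R ((1 / real q) *\<^sub>R z))" using z QA q by (auto simp: slice_def)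
          then show ?thesis using lat q by blast
        qed
        obtain n where n: "(1 / real q) *\<^sub>R i = p + (\<Sum>d\<in>D. (of_int (n d) / real q) *\<^sub>R d)" using rep[OF ij(1)] by blast
        obtain n' where n': "(1 / real q) *\<^sub>R j = p + (\<Sum>d\<in>D. (of_int (n' d) / real q) *\<^sub>R d)" using rep[OF ij(2)] by blast
        obtain d where d: "d \<in> D" "n d \<noteq> n' d"
        proof (rule ccontr)
          assume "\<not> thesis"
          then have "\<forall>d\<in>D. n d = n' d" using that by blast
          then have "(1 / real q) *\<^sub>R i = (1 / real q) *\<^sub>R j" unfolding n n' by simp
          then show False using \<open>i \<noteq> j\<close> q by simp
        qed
        obtain \<beta> where \<beta>: "x = (1 / real q) *\<^sub>R i + (1 / (s * real q)) *\<^sub>R (\<Sum>d\<in>D. \<beta> d *\<^sub>R d)" "\<forall>d\<in>D. 0 \<le> \<beta> d \<and> \<beta> d \<le> 1"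
          using xy(1) unfolding cell_def parallelepiped_def by blast
        obtain \<beta>' where \<beta>': "y = (1 / real q) *\<^sub>R j + (1 / (s * real q)) *\<^sub>R (\<Sum>d\<in>D. \<beta>' d *\<^sub>R d)" "\<forall>d\<in>D. 0 \<le> \<beta>' d \<and> \<beta>' d \<le> 1"
          using xy(2) unfolding cell_def parallelepiped_def by blast
        let ?\<gamma> = "\<lambda>d. of_int (n d) / real q - of_int (n' d) / real q + (\<beta> d - \<beta>' d) / (s * real q)"
        have "x - y = (\<Sum>d\<in>D. ?\<gamma> d *\<^sub>R d)"
          unfolding \<beta>(1) \<beta>'(1) n n' scaleR_sum_right
          by (simp add: scaleR_left_distrib scaleR_left_diff_distrib sum.distrib sum_subtractf diff_divide_distrib)
        then have "\<bar>?\<gamma> d\<bar> \<le> K * dist x y" using K[OF d(1), of ?\<gamma>] by (simp only: dist_norm)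
        moreover have "(1 - 1 / s) / real q \<le> \<bar>?\<gamma> d\<bar>"
        proof -
          have a: "1 \<le> \<bar>real_of_int (n d) - of_int (n' d)\<bar>" using d(2) by (simp flip: of_int_diff of_int_abs)
          have "\<bar>\<beta> d - \<beta>' d\<bar> \<le> 1" using \<beta>(2) \<beta>'(2) d(1) by (fastforce simp: abs_le_iff)
          then have b: "\<bar>(\<beta> d - \<beta>' d) / s\<bar> \<le> 1 / s" using s by (simp add: abs_divide divide_right_mono)
          have "?\<gamma> d = ((real_of_int (n d) - of_int (n' d)) + (\<beta> d - \<beta>' d) / s) / real q"
            by (simp add: add_divide_distrib diff_divide_distrib)
          then have "\<bar>?\<gamma> d\<bar> = \<bar>(real_of_int (n d) - of_int (n' d)) + (\<beta> d - \<beta>' d) / s\<bar> / real q" by (simp only: abs_divide abs_of_nat)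
          moreover have "1 - 1 / s \<le> \<bar>(real_of_int (n d) - of_int (n' d)) + (\<beta> d - \<beta>' d) / s\<bar>" using a b by linarith
          ultimately show ?thesis using q by (simp add: divide_right_mono)
        qed
        ultimately have "(1 - 1 / s) / real q \<le> K * dist x y" by linarith
        then show ?thesis unfolding r_def using K0 q by (simp add: field_simps)
      qed
      have cellE: "H E \<le> ennreal ((s * real q) ^ ?m) * H (cell z)" for z
      proof -
        let ?h = "\<lambda>y. (s * real q) *\<^sub>R (y - (1 / real q) *\<^sub>R z)"
        have "?h ` cell z = E" unfolding cell_def image_image using s q by simp
        moreover have "H (?h ` cell z) \<le> ennreal ((s * real q) ^ ?m) * H (cell z)"
          using s q by (intro hausdorff_measure_lipschitz) (auto simp: dist_norm simp flip: scaleR_diff_right)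
        ultimately show ?thesis by simp
      qed
      have "of_nat (N q) * H E = (\<Sum>z\<in>slice Q q. H E)" by simp
      also have "\<dots> \<le> (\<Sum>z\<in>slice Q q. ennreal ((s * real q) ^ ?m) * H (cell z))" by (intro sum_mono cellE)
      also have "\<dots> = ennreal ((s * real q) ^ ?m) * (\<Sum>z\<in>slice Q q. H (cell z))" by (simp add: sum_distrib_left)
      also have "\<dots> \<le> ennreal ((s * real q) ^ ?m) * H (\<Union>z\<in>slice Q q. cell z)"
        by (intro mult_left_mono hausdorff_measure_UN_separated[OF bdd_slice r] sep) auto
      also have "\<dots> \<le> ennreal ((s * real q) ^ ?m) * H (g ` Q)" by (intro mult_left_mono hausdorff_measure_mono sub) auto
      also have "\<dots> \<le> ennreal ((s * real q) ^ ?m) * (ennreal (s ^ ?m) * H Q)"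
        using s by (intro mult_left_mono hausdorff_measure_lipschitz) (auto simp: dist_norm g_def simp flip: scaleR_diff_right)
      finally show ?thesis .
    qed
    from U L show ?case unfolding q_def by blast
  qed
qed

text \<open>Letting \<open>s\<close> tend to 1 from above in \<open>slice_bounds\<close> squeezes
  the count. The limit runs along multiples of \<open>c\<close>, as there are no points at other
  heights.\<close>

lemma hausdorff_measure_eq_slice_limit:
  fixes e h :: real
  defines "e \<equiv> enn2real (hausdorff_measure (card D) (parallelepiped D))" and "h \<equiv> enn2real (hausdorff_measure (card D) Q)"
  shows "0 < e" "hausdorff_measure (card D) Q = ennreal h"
    "(\<lambda>k. real (card (slice Q (c * k))) / real (c * k) ^ card D) \<longlonglongrightarrow> h / e"
proof -
  let ?m = "card D"
  have "rational_point d" if "d \<in> D" for d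
    using intD[OF that] Ints_subset_Rats by (auto simp: integer_point_def rational_point_def)
  then have pos: "0 < H E" by (rule hausdorff_measure_parallelepiped_pos[OF ind])
  have finE: "H E < top" by (rule hausdorff_measure_parallelepiped_finite[OF finD])
  then have e: "H E = ennreal e" by (simp add: e_def)
  show e0: "0 < e" using pos e by (metis ennreal_0 ennreal_less_zero_iff)
  \<comment> \<open>The upper bound for any fixed \<open>s > 1\<close> shows that the measure of
    \<open>Q\<close> is finite; 2 is an arbitrary choice.\<close>
  obtain k where "H Q \<le> ennreal (2 ^ ?m) * (of_nat (N (c * k)) * (ennreal ((1 / real (c * k)) ^ ?m) * H E))"
    using eventually_happens'[OF sequentially_bot slice_bounds[of 2]] by auto
  also have "\<dots> < top" unfolding e ennreal_of_nat_eq_real_of_nat by (simp flip: ennreal_mult')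
  finally show hQ: "H Q = ennreal h" by (simp add: h_def)
  have h0: "0 \<le> h" by (simp add: h_def)
  define R where "R k = real (N (c * k)) / real (c * k) ^ ?m" for k
  have bounds: "\<forall>\<^sub>F k in sequentially. h / e / s ^ ?m \<le> R k \<and> R k \<le> h / e * (s ^ ?m * s ^ ?m)" if s: "1 < s" for s
    using slice_bounds[OF s] eventually_gt_at_top[of 0]
  proof eventually_elim
    case (elim k)
    let ?q = "real (c * k)"
    have q: "0 < ?q" using elim(2) c by simp
    have "ennreal h \<le> ennreal (s ^ ?m * (real (N (c * k)) * ((1 / ?q) ^ ?m * e)))"
      using elim(1) s e0 unfolding e hQ ennreal_of_nat_eq_real_of_nat by (simp add: ennreal_mult')
    then have "h \<le> s ^ ?m * (real (N (c * k)) * ((1 / ?q) ^ ?m * e))" using s e0 by (subst (asm) ennreal_le_iff) auto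
    also have "\<dots> = s ^ ?m * (R k * e)" by (simp add: R_def power_one_over)
    finally have 1: "h / e / s ^ ?m \<le> R k" using s e0 by (simp add: field_simps)
    have "ennreal (real (N (c * k)) * e) \<le> ennreal ((s * ?q) ^ ?m * (s ^ ?m * h))"
      using elim(1) s e0 h0 q unfolding e hQ ennreal_of_nat_eq_real_of_nat by (simp add: ennreal_mult')
    then have "real (N (c * k)) * e \<le> (s * ?q) ^ ?m * (s ^ ?m * h)" using s h0 by (subst (asm) ennreal_le_iff) auto
    also have "\<dots> = ?q ^ ?m * (s ^ ?m * s ^ ?m * h)" by (simp only: power_mult_distrib ac_simps)
    finally have "real (N (c * k)) * e \<le> ?q ^ ?m * (s ^ ?m * s ^ ?m * h)" .
    then have "R k * e \<le> s ^ ?m * s ^ ?m * h" using q by (simp add: R_def divide_le_eq mult.commute)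
    then have 2: "R k \<le> h / e * (s ^ ?m * s ^ ?m)" using e0 by (simp add: le_divide_eq mult.commute)
    from 1 2 show ?case by blast
  qed
  have "R \<longlonglongrightarrow> h / e"
  proof (rule order_tendstoI)
    fix a assume a: "a < h / e"
    have "((\<lambda>s. h / e / s ^ ?m) \<longlongrightarrow> h / e / 1 ^ ?m) (at_right 1)" by (intro tendsto_intros) auto
    then have "\<forall>\<^sub>F s in at_right 1. a < h / e / s ^ ?m" using a by (intro order_tendstoD(1)) auto
    then obtain s where "1 < s" "a < h / e / s ^ ?m"
      using eventually_happens'[OF trivial_limit_at_right_real eventually_conj[OF eventually_at_right_less]] by blast
    then show "\<forall>\<^sub>F k in sequentially. a < R k" using bounds[of s] by (auto elim: eventually_mono)
  next
    fix a assume a: "h / e < a"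
    have "((\<lambda>s. h / e * (s ^ ?m * s ^ ?m)) \<longlongrightarrow> h / e * (1 ^ ?m * 1 ^ ?m)) (at_right 1)" by (intro tendsto_intros)
    then have "\<forall>\<^sub>F s in at_right 1. h / e * (s ^ ?m * s ^ ?m) < a" using a by (intro order_tendstoD(2)) auto
    then obtain s where "1 < s" "h / e * (s ^ ?m * s ^ ?m) < a"
      using eventually_happens'[OF trivial_limit_at_right_real eventually_conj[OF eventually_at_right_less]] by blast
    then show "\<forall>\<^sub>F k in sequentially. R k < a" using bounds[of s] by (auto elim: eventually_mono)
  qed
  then show "(\<lambda>k. real (card (slice Q (c * k))) / real (c * k) ^ card D) \<longlonglongrightarrow> h / e" unfolding R_def[abs_def] .
qed

text \<open>Only heights divisible by \<open>c\<close> carry points, so the count up to height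
  \<open>c * k\<close> has \<open>k\<close> terms. In terms of \<open>k\<close> their growth carries
  a factor \<open>c ^ m\<close>, where \<open>m\<close> is the dimension, and dividing by
  \<open>c ^ Suc m\<close> leaves \<open>1 / c\<close>.\<close>

lemma lattice_points_limit_Hausdorff:
  "(\<lambda>k. real (Suc (card D)) * real (card (lattice_points Q (c * k))) / real (c * k) ^ Suc (card D)) \<longlonglongrightarrow>
     enn2real (hausdorff_measure (card D) Q) / enn2real (hausdorff_measure (card D) (parallelepiped D)) / real c"
proof -
  let ?m = "card D"
  let ?X = "enn2real (H Q) / enn2real (H E)"
  have "(\<lambda>k. real c ^ ?m * (real (N (c * k)) / real (c * k) ^ ?m)) \<longlonglongrightarrow> real c ^ ?m * ?X"
    by (intro tendsto_mult_left hausdorff_measure_eq_slice_limit(3))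
  moreover have "real c ^ ?m * (real (N (c * k)) / real (c * k) ^ ?m) = real (N (c * k)) / real k ^ ?m" for k
    using c by (simp add: power_mult_distrib)
  ultimately have "(\<lambda>k. real (N (c * k)) / real k ^ ?m) \<longlonglongrightarrow> real c ^ ?m * ?X" by simp
  from sum_power_asymp[OF this]
  have "(\<lambda>k. real (Suc ?m) * (\<Sum>j=1..k. real (N (c * j))) / real k ^ Suc ?m / real c ^ Suc ?m) \<longlonglongrightarrow> real c ^ ?m * ?X / real c ^ Suc ?m"
    by (intro tendsto_divide tendsto_const) (use c in auto)
  moreover have "real (card (lattice_points Q (c * k))) = (\<Sum>j=1..k. real (N (c * j)))" for k
  proof -
    have inj: "inj_on ((*) c) {1..k}" using c by (auto simp: inj_on_def)
    have "(\<Sum>q=1..c * k. N q) = (\<Sum>q\<in>(*) c ` {1..k}. N q)"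
    proof (rule sum.mono_neutral_right)
      show "(*) c ` {1..k} \<subseteq> {1..c * k}" using c by auto
      show "\<forall>q\<in>{1..c * k} - (*) c ` {1..k}. N q = 0"
      proof
        fix q assume q: "q \<in> {1..c * k} - (*) c ` {1..k}"
        have "\<not> c dvd q"
        proof
          assume "c dvd q"
          then obtain j where j: "q = c * j" by blast
          then have "j \<in> {1..k}" using q c by auto
          then show False using q j by blast
        qed
        then have "slice Q q = {}" using q by (intro slice_not_dvd) auto
        then show "N q = 0" by simp
      qed
    qed simp
    also have "\<dots> = (\<Sum>j=1..k. N (c * j))" by (rule sum.reindex[OF inj, unfolded comp_def])
    finally show ?thesis unfolding card_lattice_points_slices[OF Q(2)] by simp
  qed
  moreover have "real c ^ ?m * ?X / real c ^ Suc ?m = ?X / real c" using c by simp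
  moreover have "z / real k ^ Suc ?m / real c ^ Suc ?m = z / real (c * k) ^ Suc ?m" for z k
    by (simp only: of_nat_mult power_mult_distrib divide_divide_eq_left mult.commute)
  ultimately show ?thesis by (simp only:)
qed

end

text \<open>Otherwise finitely many closed sets of smaller dimension would cover the relative
  interior of \<open>Q\<close>.\<close>

lemma polyhedron_covered_full_dim:
  fixes Q :: "(real ^ 'n) set"
  assumes T: "simplicial_complex T" "\<Union>T = Q" and Q: "int m simplex Q"
  shows "\<exists>S\<in>T. int m simplex S"
proof (rule ccontr)
  assume no: "\<not> ?thesis"
  have dim: "aff_dim S < int m" if "S \<in> T" for S
  proof -
    have "aff_dim S \<le> int m" using aff_dim_subset[of S Q] aff_dim_simplex[OF Q] T(2) that by auto
    moreover have "aff_dim S \<noteq> int m" using no simplicial_complexD(7)[OF T(1) that] that by auto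
    ultimately show ?thesis by simp
  qed
  have conv: "convex Q" and "Q \<noteq> {}" using Q convex_simplex by auto
  then have ne: "rel_interior Q \<noteq> {}" using rel_interior_eq_empty by blast
  have h: "affine hull (rel_interior Q) = affine hull Q" by (rule rel_interior_same_affine_hull[OF conv])
  have "\<not> rel_interior Q \<subseteq> \<Union>T"
  proof (rule open_not_covered_by_lower_dim[OF simplicial_complexD(1)[OF T(1)] ne])
    show "openin (top_of_set (affine hull rel_interior Q)) (rel_interior Q)" unfolding h by (rule openin_rel_interior)
    show "closed S" if "S \<in> T" for S using simplicial_complexD(6)[OF T(1) that] .
    show "aff_dim S < aff_dim (rel_interior Q)" if "S \<in> T" for S
      using dim[OF that] aff_dim_simplex[OF Q] rel_interior_aff_dim[OF conv] by simp
  qed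
  then show False using rel_interior_subset T(2) by blast
qed

text \<open>A regular \<open>m\<close>-simplex from the triangulation of one rational
  \<open>m\<close>-simplex in \<open>A\<close> supplies the lattice frame. All
  \<open>m\<close>-simplexes in \<open>A\<close> have affine hull \<open>A\<close>, so this frame
  serves every one of them, with the same \<open>e\<close> and \<open>c\<close>.\<close>

lemma rational_measure_proportional:
  fixes A :: "(real ^ 'n) set"
  assumes aff: "affine A" and dim: "aff_dim A = int m"
  shows "\<exists>\<kappa>>0. \<forall>Q. int m simplex Q \<and> rational_simplex Q \<and> Q \<subseteq> A \<longrightarrow>
     ennreal (rational_measure m Q) = ennreal \<kappa> * hausdorff_measure m Q"
proof (cases "\<exists>Q. int m simplex Q \<and> rational_simplex Q \<and> Q \<subseteq> A")
  case False
  \<comment> \<open>Without a rational \<open>m\<close>-simplex in \<open>A\<close> the claim is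
    vacuous, and 1 is an arbitrary positive constant.\<close>
  then show ?thesis by (intro exI[of _ 1]) auto
next
  case True
  have poly: "rational_polyhedron Q" if "rational_simplex Q" for Q :: "(real ^ 'n) set"
    unfolding rational_polyhedron_def using that by (intro exI[of _ "{Q}"]) auto
  have hullA: "affine hull S = A" if "int m simplex S" "S \<subseteq> A" for S
  proof (rule affine_dim_equal)
    show "affine hull S \<subseteq> A" using that(2) aff by (simp add: hull_minimal)
    show "aff_dim (affine hull S) = aff_dim A" using aff_dim_simplex[OF that(1)] dim by simp
    show "affine hull S \<noteq> {}" using aff_dim_simplex[OF that(1)] by auto
  qed (use aff in auto)
  obtain Q0 where Q0: "int m simplex Q0" "rational_simplex Q0" "Q0 \<subseteq> A" using True by blast
  obtain T0 where T0: "regular_triangulation T0 Q0" using rational_polyhedron_triangulation poly[OF Q0(2)] by blast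
  then obtain S0 where S0: "S0 \<in> T0" "int m simplex S0"
    using polyhedron_covered_full_dim[of T0 Q0 m] Q0(1) by (auto simp: regular_triangulation_def triangulates_def)
  have reg: "regular_simplex S0" and "S0 \<subseteq> A" using T0 S0(1) Q0(3) by (auto simp: regular_triangulation_def triangulates_def)
  then have hS0: "affine hull S0 = A" using hullA S0(2) by blast
  obtain c p D where c: "0 < c" and D: "finite D" "card D = m" "independent D" and intD: "\<forall>d\<in>D. integer_point d"
    and cp: "integer_point (real c *\<^sub>R p)"
    and A: "\<forall>x. x \<in> A \<longleftrightarrow> (\<exists>\<gamma>. x = p + (\<Sum>d\<in>D. \<gamma> d *\<^sub>R d))"
    and lat: "\<forall>x\<in>A. \<forall>q>0. integer_point (real q *\<^sub>R x) \<longrightarrow>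
       c dvd q \<and> (\<exists>k :: real ^ 'n \<Rightarrow> int. x = p + (\<Sum>d\<in>D. (of_int (k d) / real q) *\<^sub>R d))"
    using lattice_frame[OF reg S0(2)] unfolding hS0 by (elim exE conjE) (rule that)
  define e where "e = enn2real (hausdorff_measure m (parallelepiped D))"
  have main: "0 < e \<and> ennreal (rational_measure m Q) = ennreal (1 / (e * real c)) * hausdorff_measure m Q"
    if Q: "int m simplex Q" "rational_simplex Q" "Q \<subseteq> A" for Q
  proof -
    have Qc: "convex Q" "bounded Q" "Q \<noteq> {}"
      using convex_simplex[OF Q(1)] compact_imp_bounded[OF compact_simplex[OF Q(1)]] Q(1) by auto
    note hyps = c D(3) intD[rule_format] cp A[rule_format] lat[rule_format] Qc hullA[OF Q(1,3)]
    note sl = hausdorff_measure_eq_slice_limit[OF hyps, unfolded D(2)] and ll = lattice_points_limit_Hausdorff[OF hyps, unfolded D(2)]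
    obtain T where T: "regular_triangulation T Q" using rational_polyhedron_triangulation poly[OF Q(2)] by blast
    have "aff_dim S \<le> int m" if "S \<in> T" for S
    proof -
      have "S \<subseteq> Q" using T that by (auto simp: regular_triangulation_def triangulates_def)
      then show ?thesis using aff_dim_subset aff_dim_simplex[OF Q(1)] by metis
    qed
    note lim = rational_measure_limit_low_dim[OF T this]
    \<comment> \<open>The counts converge to the measure along all heights; passing to the multiples
      of \<open>c\<close> makes this limit comparable with the one computed from the Hausdorff
      measure.\<close>
    have "strict_mono (\<lambda>k. c * k)" using c by (simp add: strict_mono_def)
    from LIMSEQ_subseq_LIMSEQ[OF lim this]
    have "(\<lambda>k. real (Suc m) * real (card (lattice_points Q (c * k))) / real (c * k) ^ Suc m) \<longlonglongrightarrow> rational_measure m Q"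
      unfolding comp_def .
    then have eq: "rational_measure m Q = enn2real (hausdorff_measure m Q) / e / real c" using LIMSEQ_unique ll unfolding e_def by blast
    have e: "0 < e" using sl(1) by (simp add: e_def)
    have "ennreal (rational_measure m Q) = ennreal (1 / (e * real c) * enn2real (hausdorff_measure m Q))" unfolding eq by simp
    also have "\<dots> = ennreal (1 / (e * real c)) * ennreal (enn2real (hausdorff_measure m Q))" using e by (intro ennreal_mult) auto
    also have "ennreal (enn2real (hausdorff_measure m Q)) = hausdorff_measure m Q" by (rule sl(2)[symmetric])
    finally show ?thesis using e by blast
  qed
  then have "0 < e" using Q0 by blast
  then show ?thesis using main c by (intro exI[of _ "1 / (e * real c)"]) auto
qed

lemma affine_rational_affine_subspace:
  assumes "rational_affine_subspace A" shows "affine A"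
proof -
  obtain \<H> where \<H>: "\<And>X. X \<in> \<H> \<Longrightarrow> rational_hyperplane X" "A = \<Inter>\<H>"
    using assms unfolding rational_affine_subspace_def by blast
  have "affine X" if X: "X \<in> \<H>" for X
  proof -
    obtain a t where "X = {x. a \<bullet> x + t = 0}" using \<H>(1)[OF X] unfolding rational_hyperplane_def by blast
    then have "X = {x. a \<bullet> x = - t}" by (simp add: eq_neg_iff_add_eq_0)
    then show ?thesis by (simp add: affine_hyperplane)
  qed
  then show ?thesis unfolding \<H>(2) by (rule affine_Inter)
qed

theorem theorem4p2:
  fixes d :: nat
  shows
    "(\<forall>P :: (real ^ 'n) set. rational_polyhedron P \<longrightarrow> 0 \<le> rational_measure d P) \<and>
     \<comment> \<open>(i) Invariance\<close>
     (\<forall>P Q :: (real ^ 'n) set. \<forall>\<gamma>\<in>integral_affine_group.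
        rational_polyhedron P \<and> rational_polyhedron Q \<and> P = \<gamma> ` Q \<longrightarrow>
        rational_measure d P = rational_measure d Q) \<and>
     \<comment> \<open>(ii) Valuation\<close>
     rational_measure d ({} :: (real ^ 'n) set) = 0 \<and>
     (\<forall>P :: (real ^ 'n) set. rational_polyhedron P \<longrightarrow>
        rational_measure d P = rational_measure d (dim_part d P)) \<and>
     (\<forall>P Q :: (real ^ 'n) set.
        rational_polyhedron P \<and> rational_polyhedron Q \<and>
        polyhedron_dim P \<le> int d \<and> polyhedron_dim Q \<le> int d \<longrightarrow>
        rational_measure d P + rational_measure d Q =
        rational_measure d (P \<union> Q) + rational_measure d (P \<inter> Q)) \<and>
     \<comment> \<open>(iii) Conservativity\<close>
     (\<forall>P :: (real ^ 'n) set. rational_polyhedron P \<longrightarrow>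
        rational_measure d P = rational_measure d ((\<lambda>x. append_coord x 0) ` P)) \<and>
     \<comment> \<open>(iv) Pyramid\<close>
     (\<forall>k \<in> {1..CARD('n)}. \<forall>v :: nat \<Rightarrow> real ^ 'n.
        int k simplex (convex hull (v ` {0..k})) \<and>
        regular_simplex (convex hull (v ` {0..k})) \<and> integer_point (v 0) \<longrightarrow>
        rational_measure k (convex hull (v ` {0..k})) =
        rational_measure (k - 1) (convex hull (v ` {1..k})) / real k) \<and>
     \<comment> \<open>(v) Normalization\<close>
     (\<forall>j \<in> {1..CARD('n)}. \<forall>B :: (int ^ 'n) set.
        card B = j \<and> part_of_int_basis B \<longrightarrow>
        rational_measure j
          {x. \<exists>\<gamma>. (\<forall>w\<in>B. 0 \<le> \<gamma> w \<and> \<gamma> w \<le> 1) \<and> x = (\<Sum>w\<in>B. \<gamma> w *\<^sub>R of_int_vec w)} = 1) \<and>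
     \<comment> \<open>(vi) Proportionality\<close>
     (\<forall>m \<in> {0..CARD('n)}. \<forall>A :: (real ^ 'n) set.
        rational_affine_subspace A \<and> aff_dim A = int m \<longrightarrow>
        (\<exists>\<kappa>>0. \<forall>Q. int m simplex Q \<and> rational_simplex Q \<and> Q \<subseteq> A \<longrightarrow>
           ennreal (rational_measure m Q) = ennreal \<kappa> * hausdorff_measure m Q))"
proof (intro conjI allI ballI impI)
  show "0 \<le> rational_measure d P" for P :: "(real ^ 'n) set" by (rule rational_measure_nonneg)
  show "rational_measure d P = rational_measure d Q"
    if "\<gamma> \<in> integral_affine_group" "rational_polyhedron P \<and> rational_polyhedron Q \<and> P = \<gamma> ` Q" for P Q :: "(real ^ 'n) set" and \<gamma>
    using that rational_measure_invariant[of \<gamma> P Q d] by blast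
  show "rational_measure d ({} :: (real ^ 'n) set) = 0" by (rule rational_measure_empty)
  show "rational_measure d P = rational_measure d (dim_part d P)" if "rational_polyhedron P" for P :: "(real ^ 'n) set"
    using rational_polyhedron_triangulation[OF that] rational_measure_dim_part by blast
  show "rational_measure d P + rational_measure d Q = rational_measure d (P \<union> Q) + rational_measure d (P \<inter> Q)"
    if "rational_polyhedron P \<and> rational_polyhedron Q \<and> polyhedron_dim P \<le> int d \<and> polyhedron_dim Q \<le> int d"
    for P Q :: "(real ^ 'n) set"
    using that rational_measure_valuation by blast
  show "rational_measure d P = rational_measure d ((\<lambda>x. append_coord x 0) ` P)" if "rational_polyhedron P" for P :: "(real ^ 'n) set"
    using that by (rule rational_measure_conservative)
  show "rational_measure k (convex hull (v ` {0..k})) = rational_measure (k - 1) (convex hull (v ` {1..k})) / real k"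
    if "k \<in> {1..CARD('n)}" "int k simplex (convex hull (v ` {0..k})) \<and> regular_simplex (convex hull (v ` {0..k})) \<and> integer_point (v 0)"
    for k and v :: "nat \<Rightarrow> real ^ 'n"
    using that rational_measure_pyramid[of k v] by simp
  show "rational_measure j {x. \<exists>\<gamma>. (\<forall>w\<in>B. 0 \<le> \<gamma> w \<and> \<gamma> w \<le> 1) \<and> x = (\<Sum>w\<in>B. \<gamma> w *\<^sub>R of_int_vec w)} = 1"
    if "card B = j \<and> part_of_int_basis B" for j and B :: "(int ^ 'n) set"
    using that rational_measure_parallelepiped by blast
  show "\<exists>\<kappa>>0. \<forall>Q. int m simplex Q \<and> rational_simplex Q \<and> Q \<subseteq> A \<longrightarrow>
           ennreal (rational_measure m Q) = ennreal \<kappa> * hausdorff_measure m Q"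
    if "rational_affine_subspace A \<and> aff_dim A = int m" for m and A :: "(real ^ 'n) set"
    using that rational_measure_proportional affine_rational_affine_subspace by blast
qed

end
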